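(* Let $(m_t,\kappa_t)_{t\in I}$ and $(m^n_t,\kappa^n_t)_{t\in I}$, $n\in\mathbb N$, be reduced generators. Let $(\mathfrak c_{s,t})_{s\le t}$, $(\mathfrak m_{s,t})_{s\le t}$, $(f_t)_t$, $(f_{s,t})_{s\le t}$ be the $\ast$-convolution hemigroup, $\rhd$-convolution hemigroup (both with finite second moment), $\mathcal P^2$-DLC and $\mathcal P^2$-REF having reduced generator $(m_t,\kappa_t)_t$, and let $(\mathfrak c^n_{s,t})$, $(\mathfrak m^n_{s,t})$, $(f^n_t)$, $(f^n_{s,t})$ be those having reduced generator $(m^n_t,\kappa^n_t)_t$. Then the following are equivalent as $n\to\infty$: (1) $(\mathfrak c^n_{s,t})$ converges weakly to $(\mathfrak c_{s,t})$ locally uniformly and $\mathrm V(\mathfrak c^n_{s,t})\to\mathrm V(\mathfrak c_{s,t})$ locally uniformly on $I^2_\le$; (2) $(\mathfrak m^n_{s,t})$ converges weakly to $(\mathfrak m_{s,t})$ locally uniformly and $\mathrm V(\mathfrak m^n_{s,t})\to\mathrm V(\mathfrak m_{s,t})$ locally uniformly on $I^2_\le$; (3) $f^n_t(z)\to f_t(z)$ locally uniformly in $(z,t)\in\mathbb C^+\times I$ and $\mathrm r(f^n_t)\to\mathrm r(f_t)$ locally uniformly on $I$; (4) $f^n_{s,t}(z)\to f_{s,t}(z)$ locally uniformly in $(z,s,t)\in\mathbb C^+\times I^2_\le$ and $\mathrm r(f^n_{s,t})\to\mathrm r(f_{s,t})$ locally uniformly on $I^2_\le$; (5) $(m^n_t)\to(m_t)$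 locally uniformly on $I$ and $(\kappa^n_t)$ converges weakly to $(\kappa_t)$ locally uniformly on $I$.
   Context: $I$ is a fixed interval $[0,T_0)$ ($0<T_0\le+\infty$) or $[0,T_0]$ ($0<T_0<+\infty$), and $I^2_\le=\{(s,t)\in I^2:s\le t\}$. $\mathbb C^+$ is the open upper half-plane; $\mathbf P(\mathbb R)$, $\mathbf M(\mathbb R)$ are the sets of Borel probability measures and of finite nonnegative Borel measures on $\mathbb R$; $\mathrm V(\mu)$ is the variance; $\widehat\mu(\xi)=\int e^{i\xi x}\mu(dx)$. For $\mu\in\mathbf P(\mathbb R)$: $G_\mu(z)=\int\frac1{z-x}\mu(dx)$, $F_\mu=F[\mu]=1/G_\mu$ on $\mathbb C^+$; $\mathcal P^2=\{F_\mu:\mu\in\mathbf P(\mathbb R),\int x^2\mu(dx)<\infty\}$. Each $f\in\mathcal P^2$ is uniquely written $f(z)=z-\mathrm m(f)+\int\frac1{x-z}\rho_f(dx)$ with $\mathrm m(f)\in\mathbb R$, $\rho_f\in\mathbf M(\mathbb R)$, and $\mathrm r(f)=\rho_f(\mathbb R)$. $\ast$ is classical convolution; $\rhd$ is determined by $F_{\mu\rhd\nu}=F_\mu\circ F_\nu$. For $\star\in\{\ast,\rhd\}$, a $\star$-convolution hemigroup is a family $(\mu_{s,t})_{(s,t)\in I^2_\le}$ in $\mathbf P(\mathbb R)$ with $\mu_{s,s}=\delta_0$, $\mu_{s,t}\star\mu_{t,u}=\mu_{s,u}$ for $s\le t\le u$, and $(s,t)\mapsto\mu_{s,t}$ weakly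 continuous; it has finite second moment if every $\mu_{s,t}$ does. A reduced generator is a family $(m_t,\kappa_t)_{t\in I}$ in $\mathbb R\times\mathbf M(\mathbb R)$ with $m_0=0$, $t\mapsto m_t$ continuous, $\kappa_0=0$, and $t\mapsto\kappa_t(B)$ nondecreasing and continuous for every Borel $B\subset\mathbb R$. Let $\mathcal K$ be the Borel measure on $\mathbb R\times I$ with $\mathcal K(B\times(s,t])=\kappa_t(B)-\kappa_s(B)$ and $\mathcal K(\mathbb R\times\{0\})=0$. - The $\ast$-convolution hemigroup with this reduced generator is the unique one with $\widehat{\mathfrak c}_{0,t}(\xi)=\exp\big(im_t\xi+\int_{\mathbb R}\frac{e^{i\xi x}-1-i\xi x}{x^2}\,\kappa_t(dx)\big)$ (integrand at $x=0$ equal to $-\xi^2/2$). - The $\mathcal P^2$-REF with this reduced generator is the unique family $(f_{s,t})_{s\le t}\subset\mathcal P^2$ with $f_{s,s}=\mathrm{id}$, $f_{s,t}\circ f_{t,u}=f_{s,u}$, $(s,t)\mapsto f_{s,t}$ continuous for locally uniform convergence, and $f_{s,t}(z)=z-m_t+m_s+\int_{\mathbb R\times[s,t]}\frac1{x-f_{r,t}(z)}\,\mathcal K(dx\,dr)$ for $s\le t$, $z\in\mathbb C^+$; the $\mathcal P^2$-DLC is $f_t=f_{0,t}$; and the $\rhd$-convolution hemigroup is determined by $F[\mathfrak m_{s,t}]=f_{s,t}$. For $\mathbb I=I$ or $I^2_\le$, $(\mu^n_\tau)_{\tau\in\mathbb I}$ converges weakly to $(\mu_\tau)_{\tau\in\mathbb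 I}$ locally uniformly on $\mathbb I$ if $\lim_n\sup_{\tau\in K}|\int f\,d\mu^n_\tau-\int f\,d\mu_\tau|=0$ for every compact $K\subset\mathbb I$ and every bounded continuous $f:\mathbb R\to\mathbb R$. *)

theory Defs
  imports "HOL-Probability.Probability"
begin

section \<open>Time intervals and modes of convergence\<close>

definition time_interval :: "real set \<Rightarrow> bool" where
  "time_interval I \<longleftrightarrow> I = {0..} \<or> (\<exists>T>0. I = {0..<T} \<or> I = {0..T})"

definition I2le :: "real set \<Rightarrow> (real \<times> real) set" where
  "I2le I = {(s, t). s \<in> I \<and> t \<in> I \<and> s \<le> t}"

definition UHP :: "complex set" where
  "UHP = {z. 0 < Im z}"

text \<open>
  Uniform convergence on every compact subset. All domains below
  (\<open>I\<close>, \<open>I2le I\<close> and their products with the upper half-plane) are locally compact.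
\<close>

definition loc_unif_conv ::
  "'a::topological_space set \<Rightarrow> (nat \<Rightarrow> 'a \<Rightarrow> 'b::metric_space) \<Rightarrow> ('a \<Rightarrow> 'b) \<Rightarrow> bool" where
  "loc_unif_conv D g h \<longleftrightarrow>
     (\<forall>C. compact C \<and> C \<subseteq> D \<longrightarrow> uniform_limit C g h sequentially)"

definition bdd_cont :: "(real \<Rightarrow> real) \<Rightarrow> bool" where
  "bdd_cont \<phi> \<longleftrightarrow> continuous_on UNIV \<phi> \<and> bounded (range \<phi>)"

definition weak_conv_loc_unif ::
  "'a::topological_space set \<Rightarrow> (nat \<Rightarrow> 'a \<Rightarrow> real measure) \<Rightarrow> ('a \<Rightarrow> real measure) \<Rightarrow> bool" where
  "weak_conv_loc_unif D \<mu>n \<mu> \<longleftrightarrow>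
     (\<forall>\<phi>. bdd_cont \<phi> \<longrightarrow>
        loc_unif_conv D (\<lambda>n \<tau>. LINT x|\<mu>n n \<tau>. \<phi> x) (\<lambda>\<tau>. LINT x|\<mu> \<tau>. \<phi> x))"

definition all_equivalent :: "bool list \<Rightarrow> bool" where
  "all_equivalent Ps \<longleftrightarrow> (\<forall>P\<in>set Ps. \<forall>Q\<in>set Ps. P \<longleftrightarrow> Q)"


section \<open>Cauchy transforms and Nevanlinna representation\<close>

definition cauchy_G :: "real measure \<Rightarrow> complex \<Rightarrow> complex" where
  "cauchy_G \<mu> z = (CLINT x|\<mu>. 1 / (z - of_real x))"

definition cauchy_F :: "real measure \<Rightarrow> complex \<Rightarrow> complex" where
  "cauchy_F \<mu> z = 1 / cauchy_G \<mu> z"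

text \<open>
  Functions on the upper half-plane are represented by total functions
  of which only the values on \<open>UHP\<close> are relevant.
\<close>

definition P2 :: "(complex \<Rightarrow> complex) set" where
  "P2 = {f. \<exists>\<mu>. real_distribution \<mu> \<and> integrable \<mu> (\<lambda>x. x\<^sup>2) \<and> (\<forall>z\<in>UHP. f z = cauchy_F \<mu> z)}"

definition nevanlinna_rep :: "(complex \<Rightarrow> complex) \<Rightarrow> real \<Rightarrow> real measure \<Rightarrow> bool" where
  "nevanlinna_rep f a \<rho> \<longleftrightarrow> finite_borel_measure \<rho> \<and>
     (\<forall>z\<in>UHP. f z = z - of_real a + (CLINT x|\<rho>. 1 / (of_real x - z)))"

text \<open>For \<open>f \<in> P2\<close> the pair \<open>(a, \<rho>)\<close> exists and is unique, so the choice below is immaterial.\<close>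

definition nev_measure :: "(complex \<Rightarrow> complex) \<Rightarrow> real measure" where
  "nev_measure f = (SOME \<rho>. \<exists>a. nevanlinna_rep f a \<rho>)"

definition nev_r :: "(complex \<Rightarrow> complex) \<Rightarrow> real" where
  "nev_r f = measure (nev_measure f) UNIV"

definition Var :: "real measure \<Rightarrow> real" where
  "Var \<mu> = prob_space.variance \<mu> (\<lambda>x. x)"


section \<open>Convolution hemigroups\<close>

text \<open>The measure chosen here exists and is unique, as a probability measure is determined by its Cauchy transform.\<close>

definition monotone_convolution :: "real measure \<Rightarrow> real measure \<Rightarrow> real measure" where
  "monotone_convolution \<mu> \<nu> =
     (SOME \<sigma>. real_distribution \<sigma> \<and> (\<forall>z\<in>UHP. cauchy_F \<sigma> z = cauchy_F \<mu> (cauchy_F \<nu> z)))"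

definition conv_hemigroup ::
  "(real measure \<Rightarrow> real measure \<Rightarrow> real measure) \<Rightarrow> real set \<Rightarrow> (real \<times> real \<Rightarrow> real measure) \<Rightarrow> bool" where
  "conv_hemigroup star I \<mu> \<longleftrightarrow>
     (\<forall>\<tau>\<in>I2le I. real_distribution (\<mu> \<tau>)) \<and>
     (\<forall>s\<in>I. \<mu> (s, s) = return borel 0) \<and>
     (\<forall>s\<in>I. \<forall>t\<in>I. \<forall>u\<in>I. s \<le> t \<longrightarrow> t \<le> u \<longrightarrow> star (\<mu> (s, t)) (\<mu> (t, u)) = \<mu> (s, u)) \<and>
     (\<forall>\<phi>. bdd_cont \<phi> \<longrightarrow> continuous_on (I2le I) (\<lambda>\<tau>. LINT x|\<mu> \<tau>. \<phi> x))"

definition finite_second_moment :: "real set \<Rightarrow> (real \<times> real \<Rightarrow> real measure) \<Rightarrow> bool" where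
  "finite_second_moment I \<mu> \<longleftrightarrow> (\<forall>\<tau>\<in>I2le I. integrable (\<mu> \<tau>) (\<lambda>x. x\<^sup>2))"


section \<open>Reduced generators and the objects they generate\<close>

definition reduced_generator :: "real set \<Rightarrow> (real \<Rightarrow> real) \<Rightarrow> (real \<Rightarrow> real measure) \<Rightarrow> bool" where
  "reduced_generator I m \<kappa> \<longleftrightarrow>
     m 0 = 0 \<and> continuous_on I m \<and>
     (\<forall>t\<in>I. finite_borel_measure (\<kappa> t)) \<and>
     \<kappa> 0 = null_measure borel \<and>
     (\<forall>B\<in>sets borel. mono_on I (\<lambda>t. measure (\<kappa> t) B) \<and> continuous_on I (\<lambda>t. measure (\<kappa> t) B))"

text \<open>The Borel measure on \<open>\<real> \<times> I\<close> (possibly of infinite total mass, but determined uniquely).\<close>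

definition space_time_measure ::
  "real set \<Rightarrow> (real \<Rightarrow> real measure) \<Rightarrow> (real \<times> real) measure \<Rightarrow> bool" where
  "space_time_measure I \<kappa> K \<longleftrightarrow>
     sets K = sets (restrict_space borel (UNIV \<times> I)) \<and>
     (\<forall>B\<in>sets borel. \<forall>s\<in>I. \<forall>t\<in>I. s \<le> t \<longrightarrow>
        emeasure K (B \<times> {s<..t}) = ennreal (measure (\<kappa> t) B - measure (\<kappa> s) B)) \<and>
     emeasure K (UNIV \<times> {0}) = 0"

definition classical_hemigroup_of ::
  "real set \<Rightarrow> (real \<Rightarrow> real) \<Rightarrow> (real \<Rightarrow> real measure) \<Rightarrow> (real \<times> real \<Rightarrow> real measure) \<Rightarrow> bool" where
  "classical_hemigroup_of I m \<kappa> c \<longleftrightarrow>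
     conv_hemigroup convolution I c \<and>
     (\<forall>t\<in>I. \<forall>\<xi>. char (c (0, t)) \<xi> =
        exp (\<i> * of_real (m t * \<xi>) +
          (CLINT x|\<kappa> t. if x = 0 then - of_real (\<xi>\<^sup>2 / 2)
                       else (iexp (\<xi> * x) - 1 - \<i> * of_real (\<xi> * x)) / of_real (x\<^sup>2))))"

definition P2_REF_of ::
  "real set \<Rightarrow> (real \<Rightarrow> real) \<Rightarrow> (real \<Rightarrow> real measure) \<Rightarrow> (real \<times> real \<Rightarrow> complex \<Rightarrow> complex) \<Rightarrow> bool" where
  "P2_REF_of I m \<kappa> f \<longleftrightarrow>
     (\<forall>\<tau>\<in>I2le I. f \<tau> \<in> P2) \<and>
     (\<forall>s\<in>I. \<forall>z\<in>UHP. f (s, s) z = z) \<and>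
     (\<forall>s\<in>I. \<forall>t\<in>I. \<forall>u\<in>I. s \<le> t \<longrightarrow> t \<le> u \<longrightarrow>
        (\<forall>z\<in>UHP. f (s, t) (f (t, u) z) = f (s, u) z)) \<and>
     (\<forall>\<tau>\<in>I2le I. \<forall>C. compact C \<and> C \<subseteq> UHP \<longrightarrow> uniform_limit C f (f \<tau>) (at \<tau> within I2le I)) \<and>
     (\<exists>K. space_time_measure I \<kappa> K \<and>
        (\<forall>s\<in>I. \<forall>t\<in>I. s \<le> t \<longrightarrow> (\<forall>z\<in>UHP.
           f (s, t) z = z - of_real (m t) + of_real (m s) +
             (CLINT p:UNIV \<times> {s..t}|K. 1 / (of_real (fst p) - f (snd p, t) z)))))"

definition P2_DLC :: "(real \<times> real \<Rightarrow> complex \<Rightarrow> complex) \<Rightarrow> real \<Rightarrow> complex \<Rightarrow> complex" where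
  "P2_DLC f t = f (0, t)"

text \<open>
  The monotone hemigroup having the same reduced generator as a given \<open>P2\<close>-REF \<open>f\<close>
  is the one whose \<open>F\<close>-transforms are \<open>f\<close>.
\<close>

definition monotone_hemigroup_of ::
  "real set \<Rightarrow> (real \<times> real \<Rightarrow> complex \<Rightarrow> complex) \<Rightarrow> (real \<times> real \<Rightarrow> real measure) \<Rightarrow> bool" where
  "monotone_hemigroup_of I f \<mu> \<longleftrightarrow>
     conv_hemigroup monotone_convolution I \<mu> \<and>
     (\<forall>\<tau>\<in>I2le I. \<forall>z\<in>UHP. cauchy_F (\<mu> \<tau>) z = f \<tau> z)"

end

theory Submission
  imports Defs "HOL-Complex_Analysis.Complex_Analysis"
begin

text \<open>
  Write \<open>k t = \<kappa> t (\<real>)\<close> for the total mass of the generator. This one function is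
  behind all the numerical conditions: \<open>k t - k s\<close> is the variance of the classical law
  \<open>c (s, t)\<close>, the variance of the monotone law \<open>mu (s, t)\<close> and the Nevanlinna mass
  of \<open>f (s, t)\<close>. Since \<open>k 0 = 0\<close>, the second half of each of the first four
  conditions says that the masses \<open>k\<close> converge locally uniformly; in the fifth condition this
  is the constant test function. All limits being continuous, locally uniform convergence amounts to
  convergence along convergent sequences of arguments (\<open>loc_unif_conv_iff_sequential\<close>), which
  leaves statements about sequences of measures and of holomorphic maps.

  Two facts about the upper half-plane are needed. First, Cauchy transforms determine weak limits
  (\<open>cauchy_G_continuity\<close>): the imaginary part of a Cauchy transform is a Poisson smoothing of
  the measure, and a narrow Poisson kernel hardly changes a uniformly continuous test function. Second, the
  reciprocal Cauchy transform of a law with finite variance has a Nevanlinna representation whose mass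
  is the variance (\<open>nevanlinna_rep_cauchy_F\<close>): on a horizontal line the representing density is
  given by the Poisson formula, and Helly's theorem yields a limit as the line descends to the real axis.
  Besides identifying the masses, the representation shows that the maps of an evolution family are
  Lipschitz with constants governed by \<open>k\<close>, and injective (\<open>f_lipschitz\<close>,
  \<open>f_injective\<close>).

  The core is the equivalence of the convergence of the maps and of the generators. Over a short time interval,
  \<open>f (s, t) z\<close> differs from the Euler step \<open>z - (m t - m s) - (G_t z - G_s z)\<close>, with
  \<open>G_t\<close> the Cauchy transform of \<open>\<kappa> t\<close>, by an error of smaller order than the
  mass \<open>k t - k s\<close> (\<open>euler_step\<close>). Summing the steps over a fine grid expresses
  \<open>G_t\<close> through the maps; composing them, with a discrete Gronwall inequality, expresses the maps
  through \<open>G\<close>. Both approximations are uniform in \<open>n\<close>, because the functions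
  \<open>m\<close> and \<open>k\<close> converge uniformly and so are equicontinuous
  (\<open>\<kappa>_converge_if_f_converge\<close>, \<open>f_converge_if_\<kappa>_converge\<close>). That the
  chain started at time \<open>0\<close> suffices comes from \<open>f (0, s) (f (s, t) z) = f (0, t) z\<close> and
  injectivity (\<open>f_converge_if_DLC_converge\<close>); the monotone hemigroup is equivalent to the maps
  through \<open>F = 1 / G\<close> (\<open>monotone_condition_iff\<close>).

  On the classical side, the generator gives the characteristic functions explicitly, and Levy's
  theorem gives weak convergence. In the other direction, convergence of the variances makes quadratic test
  functions admissible, so the first two derivatives of the characteristic functions converge; and
  the second derivative of the logarithm of the characteristic function of \<open>c (0, t)\<close> is
  minus the Fourier transform of \<open>\<kappa> t\<close> (\<open>classical_condition_iff\<close>).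
\<close>

section \<open>Locally uniform convergence along sequences\<close>

text \<open>
  In compactness arguments the index of the functions has to run through a subsequence while the
  arguments converge.
\<close>

lemma loc_unif_conv_subsequence:
  fixes D :: "'a::heine_borel set" and h :: "'a \<Rightarrow> 'b::metric_space"
  assumes L: "loc_unif_conv D g h" and cont: "continuous_on D h" and \<sigma>: "strict_mono (\<sigma> :: nat \<Rightarrow> nat)"
    and x: "\<And>j. x j \<in> D" and l: "l \<in> D" and lim: "x \<longlonglongrightarrow> l"
  shows "(\<lambda>j. g (\<sigma> j) (x j)) \<longlonglongrightarrow> h l"
proof -
  have "compact (insert l (range x))"
    using lim by (rule compact_sequence_with_limit)
  then have U: "uniform_limit (insert l (range x)) g h sequentially"
    using L x l by (auto simp: loc_unif_conv_def)
  have hl: "(\<lambda>j. h (x j)) \<longlonglongrightarrow> h l"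
    using cont lim x l by (auto simp: continuous_on_sequentially o_def)
  show ?thesis
  proof (rule tendstoI)
    fix e :: real assume "e > 0"
    then have "\<forall>\<^sub>F n in sequentially. \<forall>y\<in>insert l (range x). dist (g n y) (h y) < e/2"
      using uniform_limitD[OF U, of "e/2"] by simp
    then have "\<forall>\<^sub>F j in sequentially. \<forall>y\<in>insert l (range x). dist (g (\<sigma> j) y) (h y) < e/2"
      by (rule eventually_subseq[OF \<sigma>])
    moreover have "\<forall>\<^sub>F j in sequentially. dist (h (x j)) (h l) < e/2"
      using hl \<open>e > 0\<close> by (auto dest: tendstoD[of _ _ _ "e/2"])
    ultimately show "\<forall>\<^sub>F j in sequentially. dist (g (\<sigma> j) (x j)) (h l) < e"
    proof eventually_elim
      case (elim j)
      have "dist (g (\<sigma> j) (x j)) (h (x j)) < e / 2" using elim(1) by simp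
      moreover have "dist (h l) (h (x j)) < e / 2" using elim(2) by (simp add: dist_commute)
      ultimately show ?case by (rule dist_triangle_half_l)
    qed
  qed
qed

text \<open>
  Since the limit is continuous, uniformity on compact sets can be tested on convergent sequences of
  arguments. All convergence statements below are handled in this form.
\<close>

lemma loc_unif_conv_iff_sequential:
  fixes D :: "'a::heine_borel set" and h :: "'a \<Rightarrow> 'b::metric_space"
  assumes cont: "continuous_on D h"
  shows "loc_unif_conv D g h \<longleftrightarrow>
    (\<forall>x l. (\<forall>n. x n \<in> D) \<longrightarrow> l \<in> D \<longrightarrow> x \<longlonglongrightarrow> l \<longrightarrow> (\<lambda>n. g n (x n)) \<longlonglongrightarrow> h l)"
proof
  assume L: "loc_unif_conv D g h"
  show "\<forall>x l. (\<forall>n. x n \<in> D) \<longrightarrow> l \<in> D \<longrightarrow> x \<longlonglongrightarrow> l \<longrightarrow> (\<lambda>n. g n (x n)) \<longlonglongrightarrow> h l"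
  proof (intro allI impI)
    fix x l assume x: "\<forall>n. x n \<in> D" and l: "l \<in> D" and lim: "x \<longlonglongrightarrow> l"
    show "(\<lambda>n. g n (x n)) \<longlonglongrightarrow> h l"
      using loc_unif_conv_subsequence[OF L cont strict_mono_id x[rule_format] l lim] by simp
  qed
next
  assume S: "\<forall>x l. (\<forall>n. x n \<in> D) \<longrightarrow> l \<in> D \<longrightarrow> x \<longlonglongrightarrow> l \<longrightarrow> (\<lambda>n. g n (x n)) \<longlonglongrightarrow> h l"
  show "loc_unif_conv D g h"
    unfolding loc_unif_conv_def
  proof (intro allI impI; elim conjE; rule ccontr)
    fix C assume C: "compact C" "C \<subseteq> D" and N: "\<not> uniform_limit C g h sequentially"
    from N obtain e where e: "e > 0" and
      F: "\<not> (\<forall>\<^sub>F n in sequentially. \<forall>x\<in>C. dist (g n x) (h x) < e)"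
      by (auto simp: uniform_limit_iff)
    then have "\<forall>N. \<exists>n\<ge>N. \<exists>x\<in>C. \<not> dist (g n x) (h x) < e"
      by (auto simp: eventually_sequentially)
    then have inf: "\<exists>\<^sub>\<infinity>n. \<exists>x\<in>C. \<not> dist (g n x) (h x) < e"
      by (auto simp: INFM_nat_le)
    define A where "A = {n. \<exists>x\<in>C. \<not> dist (g n x) (h x) < e}"
    have "infinite A" using inf by (simp add: A_def INFM_iff_infinite)
    then obtain r :: "nat \<Rightarrow> nat" where r: "strict_mono r" "\<And>k. r k \<in> A"
      using infinite_enumerate[of A] by auto
    then obtain x where x: "\<And>k. x k \<in> C" "\<And>k. \<not> dist (g (r k) (x k)) (h (x k)) < e"
      unfolding A_def by simp metis
    obtain l q where l: "l \<in> C" and q: "strict_mono (q :: nat \<Rightarrow> nat)" and xq: "(x \<circ> q) \<longlonglongrightarrow> l"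
      using C(1) x(1) unfolding compact_def by (metis)
    define \<sigma> where "\<sigma> = r \<circ> q"
    have \<sigma>: "strict_mono \<sigma>" unfolding \<sigma>_def using r(1) q by (rule strict_mono_o)
    have inj: "inj \<sigma>" using \<sigma> by (rule strict_mono_imp_inj_on)
    \<comment> \<open>The bad subsequence is filled up with its limit point to a full sequence.\<close>
    define y where "y n = (if n \<in> range \<sigma> then x (q (inv \<sigma> n)) else l)" for n
    have y\<sigma>: "y (\<sigma> k) = x (q k)" for k
      unfolding y_def using inj by simp
    have ylim: "y \<longlonglongrightarrow> l"
    proof (rule metric_LIMSEQ_I)
      fix \<epsilon> :: real assume "\<epsilon> > 0"
      then obtain K where K: "\<And>k. k \<ge> K \<Longrightarrow> dist (x (q k)) l < \<epsilon>"
        using metric_LIMSEQ_D[OF xq] by auto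
      have "dist (y n) l < \<epsilon>" if "n \<ge> \<sigma> K" for n
      proof (cases "n \<in> range \<sigma>")
        case True
        then obtain k where k: "n = \<sigma> k" by auto
        then have "k \<ge> K" using that \<sigma> by (simp add: strict_mono_less_eq)
        then show ?thesis using K k y\<sigma> by simp
      qed (use \<open>\<epsilon> > 0\<close> in \<open>simp add: y_def\<close>)
      then show "\<exists>N. \<forall>n\<ge>N. dist (y n) l < \<epsilon>" by blast
    qed
    have "\<forall>n. y n \<in> D" using x(1) l C(2) by (auto simp: y_def)
    then have "(\<lambda>n. g n (y n)) \<longlonglongrightarrow> h l" using S ylim l C(2) by blast
    from LIMSEQ_subseq_LIMSEQ[OF this \<sigma>]
    have 1: "(\<lambda>k. g (\<sigma> k) (x (q k))) \<longlonglongrightarrow> h l" by (simp add: o_def y\<sigma>)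
    have 2: "(\<lambda>k. h (x (q k))) \<longlonglongrightarrow> h l"
      using cont xq x(1) l C(2) by (auto simp: continuous_on_sequentially o_def subset_iff)
    have "(\<lambda>k. dist (g (\<sigma> k) (x (q k))) (h (x (q k)))) \<longlonglongrightarrow> dist (h l) (h l)"
      by (intro tendsto_dist 1 2)
    then have "(\<lambda>k. dist (g (\<sigma> k) (x (q k))) (h (x (q k)))) \<longlonglongrightarrow> 0"
      by simp
    then have "\<forall>\<^sub>F k in sequentially. dist (g (\<sigma> k) (x (q k))) (h (x (q k))) < e"
      using order_tendstoD(2)[OF _ e] by blast
    then show False using x(2) unfolding \<sigma>_def by (auto simp: eventually_sequentially)
  qed
qed

section \<open>Weak convergence of finite measures\<close>

lemma (in finite_borel_measure) integrable_bounded_continuous: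
  fixes \<phi> :: "real \<Rightarrow> 'b::{banach, second_countable_topology}"
  assumes "continuous_on UNIV \<phi>" "\<And>x. norm (\<phi> x) \<le> B"
  shows "integrable M \<phi>"
  using assms by (intro integrable_const_bound[where B=B])
    (auto intro!: borel_measurable_continuous_onI simp: measurable_cong_sets[OF M_is_borel refl])

lemma (in finite_borel_measure) norm_integral_le_mass:
  fixes \<phi> :: "real \<Rightarrow> 'b::{banach, second_countable_topology}"
  assumes "continuous_on UNIV \<phi>" "\<And>x. norm (\<phi> x) \<le> B"
  shows "norm (integral\<^sup>L M \<phi>) \<le> B * measure M UNIV"
proof -
  have "norm (integral\<^sup>L M \<phi>) \<le> (\<integral>x. norm (\<phi> x) \<partial>M)" by (rule integral_norm_bound)
  also have "\<dots> \<le> (\<integral>x. B \<partial>M)"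
    using assms by (intro integral_mono integrable_norm integrable_bounded_continuous[OF assms]) auto
  finally show ?thesis by (simp add: mult.commute borel_UNIV)
qed

lemma bdd_cont_if_compact_support:
  fixes \<phi> :: "real \<Rightarrow> real"
  assumes c: "continuous_on UNIV \<phi>" and R: "\<And>x. \<bar>x\<bar> \<ge> R \<Longrightarrow> \<phi> x = 0"
  shows "bdd_cont \<phi>"
proof -
  have "compact (\<phi> ` {-R..R})"
    by (intro compact_continuous_image continuous_on_subset[OF c]) auto
  then have "bounded (insert 0 (\<phi> ` {-R..R}))" by (simp add: compact_imp_bounded)
  moreover have "range \<phi> \<subseteq> insert 0 (\<phi> ` {-R..R})"
  proof
    fix v assume "v \<in> range \<phi>"
    then obtain x where x: "v = \<phi> x" by blast
    show "v \<in> insert 0 (\<phi> ` {-R..R})"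
      using R[of x] by (cases "x \<in> {-R..R}") (auto simp: x)
  qed
  ultimately show ?thesis unfolding bdd_cont_def using c bounded_subset by blast
qed

text \<open>
  Cut-offs turn bounded test functions into compactly supported ones, and their integrals measure how
  much mass lies in a bounded region.
\<close>

definition cutoff :: "real \<Rightarrow> real \<Rightarrow> real" where
  "cutoff R x = max 0 (min 1 (R + 1 - \<bar>x\<bar>))"

lemma continuous_cutoff: "continuous_on UNIV (cutoff R)"
  unfolding cutoff_def by (intro continuous_intros)

lemma cutoff_bounds: "0 \<le> cutoff R x" "cutoff R x \<le> 1"
  by (auto simp: cutoff_def)

lemma (in finite_borel_measure) integrable_cutoff: "integrable M (cutoff R)"
  using cutoff_bounds by (intro integrable_bounded_continuous[OF continuous_cutoff, where B=1]) simp

lemma (in finite_borel_measure) integral_cutoff_tendsto_mass: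
  "(\<lambda>j. integral\<^sup>L M (cutoff (real j))) \<longlonglongrightarrow> measure M UNIV"
proof -
  have "(\<lambda>j. integral\<^sup>L M (cutoff (real j))) \<longlonglongrightarrow> (\<integral>x. 1 \<partial>M)"
  proof (rule integral_dominated_convergence[where w="\<lambda>_. 1"])
    show "AE x in M. (\<lambda>j. cutoff (real j) x) \<longlonglongrightarrow> 1"
    proof (intro AE_I2 tendsto_eventually)
      fix x show "\<forall>\<^sub>F j in sequentially. cutoff (real j) x = 1"
        using eventually_ge_at_top[of "nat \<lceil>\<bar>x\<bar>\<rceil>"]
      proof eventually_elim
        case (elim j)
        then have "\<bar>x\<bar> \<le> real j" by linarith
        then show ?case by (simp add: cutoff_def)
      qed
    qed
  qed (use cutoff_bounds integrable_cutoff in auto)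
  then show ?thesis by (simp add: borel_UNIV)
qed

text \<open>
  No mass can escape to infinity: the mass far out is the total mass minus the integral of a cut-off, and
  both of these converge. Hence a bounded test function may be replaced by its product with a
  cut-off at a small cost that is uniform in \<open>n\<close>.
\<close>

lemma vague_mass_imp_weak:
  fixes M :: "nat \<Rightarrow> real measure"
  assumes fin: "\<And>n. finite_borel_measure (M n)" "finite_borel_measure N"
    and mass: "(\<lambda>n. measure (M n) UNIV) \<longlonglongrightarrow> measure N UNIV"
    and vague: "\<And>\<phi>::real \<Rightarrow> real. \<lbrakk>continuous_on UNIV \<phi>; \<exists>R. \<forall>x. \<bar>x\<bar> \<ge> R \<longrightarrow> \<phi> x = 0\<rbrakk>
       \<Longrightarrow> (\<lambda>n. integral\<^sup>L (M n) \<phi>) \<longlonglongrightarrow> integral\<^sup>L N \<phi>"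
    and \<phi>: "bdd_cont \<phi>"
  shows "(\<lambda>n. integral\<^sup>L (M n) \<phi>) \<longlonglongrightarrow> integral\<^sup>L N \<phi>"
proof -
  interpret M: finite_borel_measure "M n" for n by fact
  interpret N: finite_borel_measure N by fact
  have c\<phi>: "continuous_on UNIV \<phi>" using \<phi> by (simp add: bdd_cont_def)
  obtain B where B: "\<And>x. \<bar>\<phi> x\<bar> \<le> B" "B > 0"
    using \<phi> unfolding bdd_cont_def bounded_pos by auto
  have ccut: "continuous_on UNIV (cutoff R)" for R by (rule continuous_cutoff)
  have cut01: "0 \<le> cutoff R x" "cutoff R x \<le> 1" for R x by (rule cutoff_bounds)+
  have intcut: "integrable (M n) (cutoff R)" "integrable N (cutoff R)" for n R
    by (rule M.integrable_cutoff N.integrable_cutoff)+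
  have int\<phi>cut: "integrable (M n) (\<lambda>x. \<phi> x * cutoff R x)" "integrable N (\<lambda>x. \<phi> x * cutoff R x)" for n R
  proof -
    have "norm (\<phi> x * cutoff R x) \<le> B" for x
      using mult_mono[OF B(1)[of x] cut01(2)[of R x]] cut01(1)[of R x] B(2) by (simp add: abs_mult)
    then show "integrable (M n) (\<lambda>x. \<phi> x * cutoff R x)" "integrable N (\<lambda>x. \<phi> x * cutoff R x)"
      using ccut c\<phi> by (auto intro!: M.integrable_bounded_continuous N.integrable_bounded_continuous continuous_intros)
  qed
  have int\<phi>: "integrable (M n) \<phi>" "integrable N \<phi>" for n
    using c\<phi> B by (auto intro!: M.integrable_bounded_continuous N.integrable_bounded_continuous)
  have supp: "\<exists>R'. \<forall>x. \<bar>x\<bar> \<ge> R' \<longrightarrow> \<phi> x * cutoff R x = 0" "\<exists>R'. \<forall>x. \<bar>x\<bar> \<ge> R' \<longrightarrow> cutoff R x = 0" for R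
    by (auto intro!: exI[of _ "R+1"] simp: cutoff_def)
  have est: "\<bar>integral\<^sup>L L \<phi> - (\<integral>x. \<phi> x * cutoff R x \<partial>L)\<bar> \<le> B * (measure L UNIV - integral\<^sup>L L (cutoff R))"
    if "L = N \<or> (\<exists>n. L = M n)" for L R
  proof -
    interpret L: finite_borel_measure L using that fin by auto
    have i: "integrable L \<phi>" "integrable L (\<lambda>x. \<phi> x * cutoff R x)" "integrable L (cutoff R)"
      using that int\<phi> int\<phi>cut intcut by auto
    have "\<bar>integral\<^sup>L L \<phi> - (\<integral>x. \<phi> x * cutoff R x \<partial>L)\<bar> = \<bar>\<integral>x. \<phi> x * (1 - cutoff R x) \<partial>L\<bar>"
      using i by (simp add: algebra_simps)
    also have "\<dots> \<le> (\<integral>x. \<bar>\<phi> x * (1 - cutoff R x)\<bar> \<partial>L)"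
      by (rule integral_abs_bound)
    also have "\<dots> \<le> (\<integral>x. B * (1 - cutoff R x) \<partial>L)"
    proof (rule integral_mono)
      show "integrable L (\<lambda>x. \<bar>\<phi> x * (1 - cutoff R x)\<bar>)"
        using i by (intro integrable_abs) (simp add: right_diff_distrib)
      show "integrable L (\<lambda>x. B * (1 - cutoff R x))" using i by auto
      show "\<bar>\<phi> x * (1 - cutoff R x)\<bar> \<le> B * (1 - cutoff R x)" for x
        using B(1)[of x] cut01[of R x] by (simp add: abs_mult mult_right_mono)
    qed
    also have "\<dots> = B * (measure L UNIV - integral\<^sup>L L (cutoff R))"
      using i by (simp add: L.borel_UNIV)
    finally show ?thesis .
  qed
  show ?thesis
  proof (rule LIMSEQ_I)
    fix \<epsilon> :: real assume \<epsilon>: "\<epsilon> > 0"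
    note N.integral_cutoff_tendsto_mass
    then have "(\<lambda>k. B * (measure N UNIV - integral\<^sup>L N (cutoff (real k)))) \<longlonglongrightarrow> B * (measure N UNIV - measure N UNIV)"
      by (intro tendsto_intros)
    then obtain k where k: "B * (measure N UNIV - integral\<^sup>L N (cutoff (real k))) < \<epsilon>/4"
      using order_tendstoD(2)[of _ _ sequentially "\<epsilon>/4"] \<epsilon> by (force simp: eventually_sequentially)
    let ?R = "real k"
    have "(\<lambda>n. B * (measure (M n) UNIV - integral\<^sup>L (M n) (cutoff ?R)))
        \<longlonglongrightarrow> B * (measure N UNIV - integral\<^sup>L N (cutoff ?R))"
      by (intro tendsto_intros mass vague ccut supp)
    then have e1: "\<forall>\<^sub>F n in sequentially. B * (measure (M n) UNIV - integral\<^sup>L (M n) (cutoff ?R)) < \<epsilon>/4"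
      using k by (rule order_tendstoD(2))
    have "(\<lambda>n. \<integral>x. \<phi> x * cutoff ?R x \<partial>(M n)) \<longlonglongrightarrow> (\<integral>x. \<phi> x * cutoff ?R x \<partial>N)"
      by (intro vague supp continuous_intros ccut c\<phi>)
    then have e2: "\<forall>\<^sub>F n in sequentially. norm ((\<integral>x. \<phi> x * cutoff ?R x \<partial>(M n)) - (\<integral>x. \<phi> x * cutoff ?R x \<partial>N)) < \<epsilon>/4"
      using \<epsilon> by (auto dest!: tendstoD[of _ _ _ "\<epsilon>/4"] simp: dist_norm)
    have "\<forall>\<^sub>F n in sequentially. norm (integral\<^sup>L (M n) \<phi> - integral\<^sup>L N \<phi>) < \<epsilon>"
      using e1 e2
    proof eventually_elim
      case (elim n)
      have "\<bar>integral\<^sup>L (M n) \<phi> - (\<integral>x. \<phi> x * cutoff ?R x \<partial>(M n))\<bar> < \<epsilon>/4"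
        using est[of "M n" ?R] elim by fastforce
      moreover have "\<bar>integral\<^sup>L N \<phi> - (\<integral>x. \<phi> x * cutoff ?R x \<partial>N)\<bar> < \<epsilon>/4"
        using est[of N ?R] k by fastforce
      ultimately show ?case using elim(2) unfolding real_norm_def by linarith
    qed
    then show "\<exists>no. \<forall>n\<ge>no. norm (integral\<^sup>L (M n) \<phi> - integral\<^sup>L N \<phi>) < \<epsilon>"
      by (simp add: eventually_sequentially)
  qed
qed

section \<open>Cauchy transforms\<close>

lemma UHP_not_real: "z \<in> UHP \<Longrightarrow> z - of_real x \<noteq> 0"
  by (auto simp: UHP_def complex_eq_iff)

lemma open_UHP: "open UHP"
  unfolding UHP_def by (rule open_halfspace_Im_gt)

lemma Im_le_norm_diff_real: "Im z \<le> norm (z - of_real x)"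
  using abs_Im_le_cmod[of "z - of_real x"] by simp

lemma norm_resolvent_le:
  assumes "z \<in> UHP"
  shows "norm (1 / (z - of_real x)) \<le> 1 / Im z"
  using assms Im_le_norm_diff_real[of z x] by (auto simp: UHP_def norm_divide intro!: divide_left_mono mult_pos_pos)

lemma continuous_on_resolvent:
  assumes "z \<in> UHP"
  shows "continuous_on S (\<lambda>x::real. 1 / (z - of_real x))"
  using UHP_not_real[OF assms] by (intro continuous_intros) auto

lemma norm_resolvent_diff_le:
  assumes "z \<in> UHP" "w \<in> UHP"
  shows "norm (1 / (z - of_real x) - 1 / (w - of_real x)) \<le> norm (z - w) / (Im z * Im w)"
proof -
  have "1 / (z - of_real x) - 1 / (w - of_real x)
      = (w - z) * ((1 / (z - of_real x)) * (1 / (w - of_real x)))"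
    using UHP_not_real[OF assms(1), of x] UHP_not_real[OF assms(2), of x] by (simp add: field_simps)
  also have "norm \<dots> \<le> norm (z - w) * ((1 / Im z) * (1 / Im w))"
    unfolding norm_mult norm_minus_commute[of w z]
    by (intro mult_left_mono mult_mono norm_resolvent_le assms)
       (use assms in \<open>auto simp: UHP_def\<close>)
  finally show ?thesis by simp
qed

context finite_borel_measure
begin

lemma integrable_resolvent:
  assumes "z \<in> UHP"
  shows "integrable M (\<lambda>x. 1 / (z - of_real x))"
  by (rule integrable_bounded_continuous[OF continuous_on_resolvent norm_resolvent_le]) (fact assms)+

lemma norm_cauchy_G_le:
  assumes "z \<in> UHP"
  shows "norm (cauchy_G M z) \<le> measure M UNIV / Im z"
  using norm_integral_le_mass[OF continuous_on_resolvent norm_resolvent_le, OF assms assms]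
  by (simp add: cauchy_G_def)

lemma norm_cauchy_G_diff_le:
  assumes "z \<in> UHP" "w \<in> UHP"
  shows "norm (cauchy_G M z - cauchy_G M w) \<le> measure M UNIV * norm (z - w) / (Im z * Im w)"
proof -
  have "norm (\<integral>x. 1 / (z - of_real x) - 1 / (w - of_real x) \<partial>M) \<le> (norm (z - w) / (Im z * Im w)) * measure M UNIV"
    by (rule norm_integral_le_mass) (intro continuous_on_diff continuous_on_resolvent norm_resolvent_diff_le assms)+
  then show ?thesis
    by (simp add: cauchy_G_def Bochner_Integration.integral_diff integrable_resolvent assms mult.commute)
qed

lemma cauchy_G_has_field_derivative:
  assumes z: "z \<in> UHP"
  shows "(cauchy_G M has_field_derivative (\<integral>x. - 1 / (z - of_real x)\<^sup>2 \<partial>M)) (at z)"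
  unfolding has_field_derivative_iff tendsto_at_iff_sequentially comp_def
proof (intro allI impI)
  fix w :: "nat \<Rightarrow> complex" assume w: "\<forall>i. w i \<in> UNIV - {z}" "w \<longlonglongrightarrow> z"
  have Imz: "Im z > 0" using z by (simp add: UHP_def)
  have "\<forall>\<^sub>F i in sequentially. Im (w i) > Im z / 2"
    using order_tendstoD(1)[OF tendsto_Im[OF w(2)], of "Im z / 2"] Imz by auto
  then obtain K where K: "\<And>i. i \<ge> K \<Longrightarrow> Im (w i) > Im z / 2"
    by (auto simp: eventually_sequentially)
  then have "0 < Im (w (i + K))" for i using K[OF le_add2[of K i]] Imz by linarith
  then have wU: "w (i + K) \<in> UHP" for i by (simp add: UHP_def)
  have eq: "(cauchy_G M (w (i + K)) - cauchy_G M z) / (w (i + K) - z)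
      = (\<integral>x. (1 / (w (i + K) - of_real x)) * (- 1 / (z - of_real x)) \<partial>M)" for i
  proof -
    have "(cauchy_G M (w (i + K)) - cauchy_G M z) / (w (i + K) - z)
       = (\<integral>x. (1 / (w (i + K) - of_real x) - 1 / (z - of_real x)) / (w (i + K) - z) \<partial>M)"
      by (simp add: cauchy_G_def Bochner_Integration.integral_diff integrable_resolvent z wU)
    also have "\<dots> = (\<integral>x. (1 / (w (i + K) - of_real x)) * (- 1 / (z - of_real x)) \<partial>M)"
    proof (rule Bochner_Integration.integral_cong[OF refl])
      fix x
      have nz: "w (i+K) - of_real x \<noteq> 0" "z - of_real x \<noteq> 0" "w (i+K) - z \<noteq> 0"
        using UHP_not_real[OF z, of x] UHP_not_real[OF wU, of i x] w(1) by auto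
      have "1 / (w (i + K) - of_real x) - 1 / (z - of_real x) =
          (w (i+K) - z) * ((1 / (w (i + K) - of_real x)) * (- 1 / (z - of_real x)))"
        using nz by (simp add: divide_simps)
      then show "(1 / (w (i + K) - of_real x) - 1 / (z - of_real x)) / (w (i + K) - z)
          = (1 / (w (i + K) - of_real x)) * (- 1 / (z - of_real x))"
        using nz(3) by simp
    qed
    finally show ?thesis .
  qed
  have "(\<lambda>i. (\<integral>x. (1 / (w (i + K) - of_real x)) * (- 1 / (z - of_real x)) \<partial>M))
     \<longlonglongrightarrow> (\<integral>x. - 1 / (z - of_real x)\<^sup>2 \<partial>M)"
  proof (rule integral_dominated_convergence[where w="\<lambda>_. (2 / Im z) * (1 / Im z)"])
    have m: "(\<lambda>x. 1 / (u - of_real x)) \<in> borel_measurable M" if "u \<in> UHP" for u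
      using integrable_resolvent[OF that] by simp
    show "(\<lambda>x. - 1 / (z - of_real x)\<^sup>2) \<in> borel_measurable M"
      using borel_measurable_times[OF m[OF z] m[OF z]] by (simp add: power2_eq_square borel_measurable_uminus_eq)
    show "(\<lambda>x. (1 / (w (i + K) - of_real x)) * (- 1 / (z - of_real x))) \<in> borel_measurable M" for i
      using borel_measurable_times[OF m[OF wU[of i]] borel_measurable_uminus[OF m[OF z]]] by simp
    show "AE x in M. (\<lambda>i. (1 / (w (i + K) - of_real x)) * (- 1 / (z - of_real x)))
        \<longlonglongrightarrow> - 1 / (z - of_real x)\<^sup>2"
    proof (rule AE_I2)
      fix x
      have "(\<lambda>i. (1 / (w (i + K) - of_real x)) * (- 1 / (z - of_real x)))
         \<longlonglongrightarrow> (1 / (z - of_real x)) * (- 1 / (z - of_real x))"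
        using UHP_not_real[OF z, of x] LIMSEQ_ignore_initial_segment[OF w(2), of K]
        by (intro tendsto_intros) auto
      then show "(\<lambda>i. (1 / (w (i + K) - of_real x)) * (- 1 / (z - of_real x)))
        \<longlonglongrightarrow> - 1 / (z - of_real x)\<^sup>2" by (simp add: power2_eq_square)
    qed
    show "AE x in M. norm ((1 / (w (i + K) - of_real x)) * (- 1 / (z - of_real x))) \<le> (2 / Im z) * (1 / Im z)" for i
    proof (rule AE_I2)
      fix x
      have "norm (1 / (w (i+K) - of_real x)) \<le> 1 / Im (w (i+K))" by (rule norm_resolvent_le[OF wU])
      also have "\<dots> \<le> 2 / Im z" using K[of "i+K"] Imz by (simp add: field_simps)
      finally show "norm ((1 / (w (i + K) - of_real x)) * (- 1 / (z - of_real x))) \<le> (2 / Im z) * (1 / Im z)"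
        unfolding norm_mult using norm_resolvent_le[OF z, of x] Imz
        by (intro mult_mono) (auto simp: norm_divide)
    qed
  qed auto
  then show "(\<lambda>i. (cauchy_G M (w i) - cauchy_G M z) / (w i - z)) \<longlonglongrightarrow> (\<integral>x. - 1 / (z - of_real x)\<^sup>2 \<partial>M)"
    unfolding eq[symmetric] by (rule LIMSEQ_offset)
qed

lemma holomorphic_cauchy_G: "cauchy_G M holomorphic_on UHP"
  using cauchy_G_has_field_derivative open_UHP
  by (meson holomorphic_on_open)

lemma Im_cauchy_G:
  assumes z: "z \<in> UHP"
  shows "Im (cauchy_G M z) = - (\<integral>x. Im z / ((x - Re z)\<^sup>2 + (Im z)\<^sup>2) \<partial>M)"
proof -
  have "Im (cauchy_G M z) = (\<integral>x. Im (1 / (z - of_real x)) \<partial>M)"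
    unfolding cauchy_G_def using integrable_resolvent[OF z] by simp
  also have "\<dots> = (\<integral>x. - (Im z / ((x - Re z)\<^sup>2 + (Im z)\<^sup>2)) \<partial>M)"
    by (simp add: Im_divide power2_commute)
  finally show ?thesis by simp
qed

text \<open>
  The behaviour along the imaginary axis is what identifies masses, and with them the constants of
  Nevanlinna representations.
\<close>

lemma cauchy_G_asymptotic:
  "((\<lambda>y. \<i> * of_real y * cauchy_G M (\<i> * of_real y)) \<longlongrightarrow> of_real (measure M UNIV)) at_top"
proof -
  have "((\<lambda>y. (\<integral>x. \<i> * of_real y * (1 / (\<i> * of_real y - of_real x)) \<partial>M)) \<longlongrightarrow> (\<integral>x. 1 \<partial>M :: complex)) at_top"
  proof (rule integral_dominated_convergence_at_top[where w="\<lambda>_. 1"])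
    show "AE x in M. ((\<lambda>y. \<i> * of_real y * (1 / (\<i> * of_real y - of_real x))) \<longlongrightarrow> (1::complex)) at_top"
    proof (rule AE_I2)
      fix x
      have inv: "((\<lambda>y::real. complex_of_real (inverse y)) \<longlongrightarrow> of_real 0) at_top"
        by (intro tendsto_of_real tendsto_inverse_0_at_top filterlim_ident)
      have "((\<lambda>y. 1 / (1 + \<i> * of_real x * of_real (inverse y))) \<longlongrightarrow> 1 / (1 + \<i> * of_real x * of_real 0)) at_top"
        by (intro tendsto_intros inv) simp
      then have lim: "((\<lambda>y. 1 / (1 + \<i> * of_real x * of_real (inverse y))) \<longlongrightarrow> 1) at_top" by simp
      show "((\<lambda>y. \<i> * of_real y * (1 / (\<i> * of_real y - of_real x))) \<longlongrightarrow> (1::complex)) at_top"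
      proof (rule Lim_transform_eventually[OF lim])
        show "\<forall>\<^sub>F y in at_top. 1 / (1 + \<i> * of_real x * of_real (inverse y)) = \<i> * of_real y * (1 / (\<i> * of_real y - of_real x))"
          using eventually_gt_at_top[of 0]
        proof eventually_elim
          case (elim y)
          have "\<i> * of_real y - of_real x = \<i> * of_real y * (1 + \<i> * of_real x * of_real (inverse y))"
            using elim by (simp add: field_simps complex_eq_iff)
          then show ?case using elim by simp
        qed
      qed
    qed
    show "\<forall>\<^sub>F y in at_top. AE x in M. norm (\<i> * complex_of_real y * (1 / (\<i> * of_real y - of_real x))) \<le> 1"
      using eventually_gt_at_top[of 0]
    proof eventually_elim
      case (elim y)
      then have "\<i> * of_real y \<in> UHP" by (simp add: UHP_def)
      from norm_resolvent_le[OF this] elim show ?case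
        by (intro AE_I2) (simp add: norm_mult norm_divide field_simps)
    qed
    show "(\<lambda>x. \<i> * of_real y * (1 / (\<i> * of_real y - of_real x))) \<in> borel_measurable M" for y
      by (simp add: measurable_cong_sets[OF M_is_borel refl])
  qed (auto simp: measurable_cong_sets[OF M_is_borel refl])
  moreover have "(\<integral>x. 1 \<partial>M) = complex_of_real (measure M UNIV)"
    by (simp add: borel_UNIV scaleR_conv_of_real)
  ultimately show ?thesis
    by (simp only: cauchy_G_def integral_mult_right_zero)
qed

end

text \<open>
  Convolution with the Cauchy distribution of scale \<open>y\<close>, that is with the normalised Poisson
  kernel at height \<open>y\<close>.
\<close>

definition poisson_smooth :: "(real \<Rightarrow> real) \<Rightarrow> real \<Rightarrow> real \<Rightarrow> real" where
  "poisson_smooth \<phi> y x = (LINT v|lborel. \<phi> v * (y / ((x - v)\<^sup>2 + y\<^sup>2)) / pi)"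

lemma cauchy_density:
  shows integrable_cauchy_density: "integrable lborel (\<lambda>u::real. 1 / (1 + u\<^sup>2))"
    and integral_cauchy_density: "(LINT u|lborel. 1 / (1 + u\<^sup>2)) = pi"
  using integrable_inverse_1_plus_square LBINT_inverse_1_plus_square
  by (simp_all add: set_integrable_def interval_lebesgue_integral_def set_lebesgue_integral_def divide_inverse)

lemma poisson_smooth_altdef:
  assumes y: "y > 0"
  shows "poisson_smooth \<phi> y x = (LINT u|lborel. \<phi> (x + y * u) * (1 / (1 + u\<^sup>2))) / pi"
proof -
  have "(LINT v|lborel. \<phi> v * (y / ((x - v)\<^sup>2 + y\<^sup>2)) / pi)
     = \<bar>y\<bar> *\<^sub>R (LINT u|lborel. \<phi> (x + y * u) * (y / ((x - (x + y * u))\<^sup>2 + y\<^sup>2)) / pi)"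
    using y by (intro lborel_integral_real_affine) auto
  also have "\<dots> = (LINT u|lborel. y * (\<phi> (x + y * u) * (y / ((x - (x + y * u))\<^sup>2 + y\<^sup>2)) / pi))"
    using y by (simp only: integral_mult_right_zero abs_of_pos real_scaleR_def)
  also have "\<dots> = (LINT u|lborel. \<phi> (x + y * u) * (1 / (1 + u\<^sup>2)) / pi)"
  proof (rule Bochner_Integration.integral_cong[OF refl])
    fix u :: real
    obtain A where A: "1 + u\<^sup>2 = A" "A > 0" by (simp add: add_pos_nonneg)
    have "(x - (x + y * u))\<^sup>2 + y\<^sup>2 = y * y * (1 + u\<^sup>2)" by (simp add: power2_eq_square algebra_simps)
    then show "y * (\<phi> (x + y * u) * (y / ((x - (x + y * u))\<^sup>2 + y\<^sup>2)) / pi) = \<phi> (x + y * u) * (1 / (1 + u\<^sup>2)) / pi"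
      using y A(2) unfolding A(1) by simp
  qed
  finally show ?thesis by (simp only: poisson_smooth_def integral_divide_zero)
qed

text \<open>
  Along a sequence of counterexamples \<open>x k\<close> with heights tending to \<open>0\<close>, the
  substitution \<open>v = x k + y u\<close> leaves an integral against the fixed Cauchy density whose integrand tends
  to \<open>0\<close> by uniform continuity.
\<close>

lemma poisson_smooth_uniform_limit:
  assumes \<phi>: "uniformly_continuous_on UNIV \<phi>" and B: "\<And>x. \<bar>\<phi> x\<bar> \<le> B" and e: "e > 0"
  shows "\<exists>y>0. \<forall>x. \<bar>poisson_smooth \<phi> y x - \<phi> x\<bar> \<le> e"
proof (rule ccontr)
  assume "\<not> ?thesis"
  then have "\<forall>y>0. \<exists>x. \<not> \<bar>poisson_smooth \<phi> y x - \<phi> x\<bar> \<le> e" by blast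
  then have "\<forall>k::nat. \<exists>x. \<not> \<bar>poisson_smooth \<phi> (1 / (1 + real k)) x - \<phi> x\<bar> \<le> e" by auto
  then obtain x where x: "\<And>k::nat. \<not> \<bar>poisson_smooth \<phi> (1 / (1 + real k)) (x k) - \<phi> (x k)\<bar> \<le> e"
    by metis
  let ?y = "\<lambda>k::nat. 1 / (1 + real k)"
  have c\<phi>: "continuous_on UNIV \<phi>" using \<phi> by (rule uniformly_continuous_imp_continuous)
  have [measurable]: "\<phi> \<in> borel_measurable borel" using c\<phi> by (rule borel_measurable_continuous_onI)
  have bd: "\<bar>\<phi> v * (1 / (1 + u\<^sup>2))\<bar> \<le> B * (1 / (1 + u\<^sup>2))" for u v :: real
    using B[of v] by (simp add: abs_mult divide_right_mono)
  have int: "integrable lborel (\<lambda>u. \<phi> (a + b * u) * (1 / (1 + u\<^sup>2)))" for a b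
    by (rule Bochner_Integration.integrable_bound[where f="\<lambda>u. B * (1 / (1 + u\<^sup>2))"])
       (use bd in \<open>auto intro!: integrable_mult_right integrable_cauchy_density order.trans[OF bd] simp del: times_divide_eq_right\<close>)
  have int0: "integrable lborel (\<lambda>u. \<phi> a * (1 / (1 + u\<^sup>2)))" for a
    using integrable_cauchy_density by (rule integrable_mult_right)
  have eq: "poisson_smooth \<phi> (?y k) (x k) - \<phi> (x k) =
     (LINT u|lborel. (\<phi> (x k + ?y k * u) - \<phi> (x k)) * (1 / (1 + u\<^sup>2))) / pi" for k
  proof -
    have "(LINT u|lborel. (\<phi> (x k + ?y k * u) - \<phi> (x k)) * (1 / (1 + u\<^sup>2)))
      = (LINT u|lborel. \<phi> (x k + ?y k * u) * (1 / (1 + u\<^sup>2))) - (LINT u|lborel. \<phi> (x k) * (1 / (1 + u\<^sup>2)))"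
      unfolding left_diff_distrib by (rule Bochner_Integration.integral_diff[OF int int0])
    also have "(LINT u|lborel. \<phi> (x k) * (1 / (1 + u\<^sup>2))) = \<phi> (x k) * pi"
      using integral_cauchy_density by (subst integral_mult_right_zero) simp
    finally show ?thesis by (simp add: poisson_smooth_altdef diff_divide_distrib del: times_divide_eq_right)
  qed
  have "(\<lambda>k. LINT u|lborel. (\<phi> (x k + ?y k * u) - \<phi> (x k)) * (1 / (1 + u\<^sup>2))) \<longlonglongrightarrow> (LINT u|(lborel::real measure). 0)"
  proof (rule integral_dominated_convergence[where w="\<lambda>u. (2 * B) * (1 / (1 + u\<^sup>2))"])
    show "integrable lborel (\<lambda>u. (2 * B) * (1 / (1 + u\<^sup>2)))"
      using integrable_cauchy_density by (rule integrable_mult_right)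
    show "AE u in lborel. norm ((\<phi> (x k + ?y k * u) - \<phi> (x k)) * (1 / (1 + u\<^sup>2))) \<le> (2 * B) * (1 / (1 + u\<^sup>2))" for k
    proof (rule AE_I2)
      fix u :: real
      have "\<bar>\<phi> (x k + ?y k * u) - \<phi> (x k)\<bar> \<le> 2 * B"
        using B[of "x k + ?y k * u"] B[of "x k"] by linarith
      then show "norm ((\<phi> (x k + ?y k * u) - \<phi> (x k)) * (1 / (1 + u\<^sup>2))) \<le> (2 * B) * (1 / (1 + u\<^sup>2))"
        unfolding real_norm_def abs_mult by (intro mult_mono) auto
    qed
    show "AE u in lborel. (\<lambda>k. (\<phi> (x k + ?y k * u) - \<phi> (x k)) * (1 / (1 + u\<^sup>2))) \<longlonglongrightarrow> 0"
    proof (rule AE_I2)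
      fix u :: real
      have "(\<lambda>k. ?y k * u) \<longlonglongrightarrow> 0 * u"
        by (intro tendsto_mult tendsto_const) (use LIMSEQ_inverse_real_of_nat in \<open>simp add: divide_inverse add.commute\<close>)
      then have "(\<lambda>k. \<bar>?y k * u\<bar>) \<longlonglongrightarrow> 0"
        by (intro tendsto_rabs_zero) simp
      then have "(\<lambda>k. dist (x k + ?y k * u) (x k)) \<longlonglongrightarrow> 0"
        by (simp only: dist_norm add_diff_cancel_left' real_norm_def)
      then have "(\<lambda>k. dist (\<phi> (x k + ?y k * u)) (\<phi> (x k))) \<longlonglongrightarrow> 0"
        using \<phi> by (simp add: uniformly_continuous_on_sequentially)
      then have "(\<lambda>k. \<phi> (x k + ?y k * u) - \<phi> (x k)) \<longlonglongrightarrow> 0"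
        by (simp add: dist_norm tendsto_rabs_zero_iff)
      from tendsto_mult_right[OF this, of "1 / (1 + u\<^sup>2)"]
      show "(\<lambda>k. (\<phi> (x k + ?y k * u) - \<phi> (x k)) * (1 / (1 + u\<^sup>2))) \<longlonglongrightarrow> 0" by simp
    qed
  qed auto
  then have "(\<lambda>k. poisson_smooth \<phi> (?y k) (x k) - \<phi> (x k)) \<longlonglongrightarrow> 0 / pi"
    unfolding eq by (intro tendsto_divide) auto
  then have "(\<lambda>k. \<bar>poisson_smooth \<phi> (?y k) (x k) - \<phi> (x k)\<bar>) \<longlonglongrightarrow> 0"
    by (simp add: tendsto_rabs_zero)
  then have "\<forall>\<^sub>F k in sequentially. \<bar>poisson_smooth \<phi> (?y k) (x k) - \<phi> (x k)\<bar> < e"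
    using e by (rule order_tendstoD(2))
  then show False using x by (auto simp: eventually_sequentially not_le) (metis le_refl not_less_iff_gr_or_eq)
qed

text \<open>
  The Poisson kernel is minus the imaginary part of the resolvent, so integrating first over the measure
  produces its Cauchy transform on the line at height \<open>y\<close>.
\<close>

lemma (in finite_borel_measure) integral_poisson_smooth:
  assumes y: "y > 0" and \<phi>: "integrable lborel \<phi>"
  shows "(\<integral>x. poisson_smooth \<phi> y x \<partial>M)
    = - (LINT v|lborel. \<phi> v * Im (cauchy_G M (Complex v y))) / pi"
proof -
  note [measurable_cong] = M_is_borel
  have [measurable]: "\<phi> \<in> borel_measurable borel" using \<phi> by simp
  interpret pair_sigma_finite M lborel ..
  define f where "f x v = \<phi> v * (y / ((x - v)\<^sup>2 + y\<^sup>2)) / pi" for x v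
  have [measurable]: "case_prod f \<in> borel_measurable (M \<Otimes>\<^sub>M lborel)"
    unfolding f_def by measurable
  have bd: "norm (f x v) \<le> norm (\<phi> v) * (1 / y) / pi" for x v
  proof -
    have "y / ((x - v)\<^sup>2 + y\<^sup>2) \<le> y / y\<^sup>2"
      using y by (intro divide_left_mono) (auto intro!: mult_pos_pos add_nonneg_pos)
    then have "\<bar>\<phi> v\<bar> * (y / ((x - v)\<^sup>2 + y\<^sup>2)) \<le> \<bar>\<phi> v\<bar> * (1 / y)"
      using y by (intro mult_left_mono) (auto simp: power2_eq_square)
    from divide_right_mono[OF this, of pi] show ?thesis
      using y by (simp add: f_def abs_mult)
  qed
  have int_bd: "integrable lborel (\<lambda>v. norm (\<phi> v) * (1 / y) / pi)"
    using \<phi> by simp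
  have int_f: "integrable lborel (f x)" for x
  proof (rule Bochner_Integration.integrable_bound[OF int_bd])
    show "f x \<in> borel_measurable lborel" unfolding f_def by measurable
    show "AE v in lborel. norm (f x v) \<le> norm (norm (\<phi> v) * (1 / y) / pi)"
      using order_trans[OF bd abs_ge_self] by (intro AE_I2) (simp only: real_norm_def)
  qed
  have pair: "integrable (M \<Otimes>\<^sub>M lborel) (case_prod f)"
  proof (rule Fubini_integrable)
    show "integrable M (\<lambda>x. LINT v|lborel. norm (case_prod f (x, v)))"
    proof (rule integrable_const_bound[where B="LINT v|lborel. norm (\<phi> v) * (1 / y) / pi"])
      show "AE x in M. norm (LINT v|lborel. norm (case_prod f (x, v))) \<le> (LINT v|lborel. norm (\<phi> v) * (1 / y) / pi)"
        using integral_mono[OF integrable_norm[OF int_f] int_bd bd] by (intro AE_I2) simp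
    qed measurable
  qed (use int_f in auto)
  have "(\<integral>x. poisson_smooth \<phi> y x \<partial>M) = (\<integral>x. (LINT v|lborel. f x v) \<partial>M)"
    by (simp add: poisson_smooth_def f_def)
  also have "\<dots> = (LINT v|lborel. (\<integral>x. f x v \<partial>M))"
    using Fubini_integral[OF pair] by simp
  also have "\<dots> = (LINT v|lborel. \<phi> v * - Im (cauchy_G M (Complex v y)) / pi)"
  proof (rule Bochner_Integration.integral_cong[OF refl])
    fix v
    have "Complex v y \<in> UHP" using y by (simp add: UHP_def)
    from Im_cauchy_G[OF this]
    show "(\<integral>x. f x v \<partial>M) = \<phi> v * - Im (cauchy_G M (Complex v y)) / pi"
      unfolding f_def by (simp only: integral_divide_zero integral_mult_right_zero complex.sel minus_minus)
  qed
  finally show ?thesis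
    by (simp only: integral_divide_zero mult_minus_right Bochner_Integration.integral_minus)
qed

text \<open>
  Smoothing a test function with a narrow Poisson kernel changes it little, uniformly on the line; and
  integrals of smoothed functions only involve the imaginary part of the Cauchy transform on a
  horizontal line, where convergence is assumed.
\<close>

theorem cauchy_G_continuity:
  fixes M :: "nat \<Rightarrow> real measure"
  assumes fin: "\<And>n. finite_borel_measure (M n)" "finite_borel_measure N"
    and mass: "(\<lambda>n. measure (M n) UNIV) \<longlonglongrightarrow> measure N UNIV"
    and G: "\<And>z. z \<in> UHP \<Longrightarrow> (\<lambda>n. cauchy_G (M n) z) \<longlonglongrightarrow> cauchy_G N z"
    and \<phi>: "bdd_cont \<phi>"
  shows "(\<lambda>n. integral\<^sup>L (M n) \<phi>) \<longlonglongrightarrow> integral\<^sup>L N \<phi>"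
proof (rule vague_mass_imp_weak[OF fin mass _ \<phi>])
  fix \<phi> :: "real \<Rightarrow> real"
  assume c\<phi>: "continuous_on UNIV \<phi>" and "\<exists>R. \<forall>x. \<bar>x\<bar> \<ge> R \<longrightarrow> \<phi> x = 0"
  then obtain R where R: "\<And>x. \<bar>x\<bar> \<ge> R \<Longrightarrow> \<phi> x = 0" by blast
  interpret M: finite_borel_measure "M n" for n by fact
  interpret N: finite_borel_measure N by fact
  have [measurable]: "\<phi> \<in> borel_measurable borel" using c\<phi> by (rule borel_measurable_continuous_onI)

  obtain B where B: "\<And>x. \<bar>\<phi> x\<bar> \<le> B"
    using bdd_cont_if_compact_support[OF c\<phi> R] unfolding bdd_cont_def bounded_iff by auto
  have int: "integrable lborel \<phi>"
  proof -
    have "set_integrable lborel {-R..R} \<phi>"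
      by (rule borel_integrable_atLeastAtMost') (rule continuous_on_subset[OF c\<phi>], simp)
    moreover have "(\<lambda>x. indicator {-R..R} x *\<^sub>R \<phi> x) = \<phi>"
    proof (rule ext)
      fix x show "indicator {-R..R} x *\<^sub>R \<phi> x = \<phi> x"
        using R[of x] by (cases "x \<in> {-R..R}") auto
    qed
    ultimately show ?thesis by (simp add: set_integrable_def)
  qed
  have uc: "uniformly_continuous_on UNIV \<phi>"
    unfolding uniformly_continuous_on_def
  proof (intro allI impI)
    fix e :: real assume e: "e > 0"
    have "uniformly_continuous_on {-R-1..R+1} \<phi>"
      by (intro compact_uniformly_continuous continuous_on_subset[OF c\<phi>]) auto
    then obtain d where d: "d > 0" "\<And>x x'. x \<in> {-R-1..R+1} \<Longrightarrow> x' \<in> {-R-1..R+1} \<Longrightarrow> dist x' x < d \<Longrightarrow> dist (\<phi> x') (\<phi> x) < e"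
      using e unfolding uniformly_continuous_on_def by metis
    show "\<exists>d>0. \<forall>x\<in>UNIV. \<forall>x'\<in>UNIV. dist x' x < d \<longrightarrow> dist (\<phi> x') (\<phi> x) < e"
    proof (intro exI conjI ballI impI)
      show "min d 1 > 0" using d(1) by simp
      fix x x' :: real assume xx: "dist x' x < min d 1"
      show "dist (\<phi> x') (\<phi> x) < e"
      proof (cases "x \<in> {-R-1..R+1} \<and> x' \<in> {-R-1..R+1}")
        case True then show ?thesis using d(2) xx by simp
      next
        case False
        then have "\<bar>x\<bar> \<ge> R" "\<bar>x'\<bar> \<ge> R" using xx by (auto simp: dist_real_def)
        then show ?thesis using R e by simp
      qed
    qed
  qed
  obtain C where C: "\<And>n. measure (M n) UNIV \<le> C" "C \<ge> 0"
  proof -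
    have "Bseq (\<lambda>n. measure (M n) UNIV)" using mass by (intro convergent_imp_Bseq) (auto simp: convergent_def)
    then show ?thesis using that unfolding Bseq_def by (metis abs_le_D1 less_eq_real_def real_norm_def)
  qed
  have smooth: "(\<lambda>n. \<integral>x. poisson_smooth \<phi> y x \<partial>(M n)) \<longlonglongrightarrow> (\<integral>x. poisson_smooth \<phi> y x \<partial>N)" if y: "y > 0" for y
    unfolding M.integral_poisson_smooth[OF y int] N.integral_poisson_smooth[OF y int]
  proof (intro tendsto_intros)
    have U: "Complex v y \<in> UHP" for v using y by (simp add: UHP_def)
    have meas: "(\<lambda>v. Im (cauchy_G L (Complex v y))) \<in> borel_measurable borel" if "finite_borel_measure L" for L
    proof -
      interpret L: finite_borel_measure L by fact
      have "continuous_on UNIV (\<lambda>v. Complex v y)" unfolding Complex_eq by (intro continuous_intros)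
      then have "continuous_on UNIV (\<lambda>v. Im (cauchy_G L (Complex v y)))"
        using U by (intro continuous_on_Im continuous_on_compose2[OF holomorphic_on_imp_continuous_on[OF L.holomorphic_cauchy_G]]) auto
      then show ?thesis by (rule borel_measurable_continuous_onI)
    qed
    note [measurable] = meas[OF fin(1)] meas[OF fin(2)]
    show "(\<lambda>n. LINT v|lborel. \<phi> v * Im (cauchy_G (M n) (Complex v y))) \<longlonglongrightarrow> (LINT v|lborel. \<phi> v * Im (cauchy_G N (Complex v y)))"
    proof (rule integral_dominated_convergence[where w="\<lambda>v. \<bar>\<phi> v\<bar> * (C / y)"])
      show "integrable lborel (\<lambda>v. \<bar>\<phi> v\<bar> * (C / y))" using int by simp
      show "AE v in lborel. (\<lambda>n. \<phi> v * Im (cauchy_G (M n) (Complex v y))) \<longlonglongrightarrow> \<phi> v * Im (cauchy_G N (Complex v y))"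
        by (intro AE_I2 tendsto_intros G U)
      show "AE v in lborel. norm (\<phi> v * Im (cauchy_G (M n) (Complex v y))) \<le> \<bar>\<phi> v\<bar> * (C / y)" for n
      proof (rule AE_I2)
        fix v
        have "\<bar>Im (cauchy_G (M n) (Complex v y))\<bar> \<le> norm (cauchy_G (M n) (Complex v y))" by (rule abs_Im_le_cmod)
        also have "\<dots> \<le> measure (M n) UNIV / y" using M.norm_cauchy_G_le[OF U] by simp
        also have "\<dots> \<le> C / y" using C y by (simp add: divide_right_mono)
        finally show "norm (\<phi> v * Im (cauchy_G (M n) (Complex v y))) \<le> \<bar>\<phi> v\<bar> * (C / y)"
          by (simp only: real_norm_def abs_mult mult_left_mono abs_ge_zero)
      qed
    qed measurable
  qed simp
  show "(\<lambda>n. integral\<^sup>L (M n) \<phi>) \<longlonglongrightarrow> integral\<^sup>L N \<phi>"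
  proof (rule LIMSEQ_I)
    fix \<epsilon> :: real assume \<epsilon>: "\<epsilon> > 0"
    define K where "K = max C (measure N UNIV) + 1"
    have K: "K > 0" "measure (M n) UNIV \<le> K" "measure N UNIV \<le> K" for n
      using C(1)[of n] C(2) by (auto simp: K_def)
    obtain y where y: "y > 0" and close: "\<And>x. \<bar>poisson_smooth \<phi> y x - \<phi> x\<bar> \<le> \<epsilon> / (4 * K)"
      using poisson_smooth_uniform_limit[OF uc B, of "\<epsilon> / (4 * K)"] \<epsilon> K by auto
    have est: "\<bar>(\<integral>x. poisson_smooth \<phi> y x \<partial>L) - integral\<^sup>L L \<phi>\<bar> \<le> \<epsilon>/4"
      if L: "L = N \<or> (\<exists>n. L = M n)" for L
    proof -
      interpret L: finite_borel_measure L using L fin by auto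
      note [measurable_cong] = L.M_is_borel
      have massL: "measure L UNIV \<le> K" using L K by auto
      have [measurable]: "poisson_smooth \<phi> y \<in> borel_measurable L"
        unfolding poisson_smooth_def by measurable
      have i\<phi>: "integrable L \<phi>" using B by (intro L.integrable_const_bound[where B=B]) auto
      have ip: "integrable L (poisson_smooth \<phi> y)"
      proof (rule L.integrable_const_bound[where B="B + \<epsilon> / (4 * K)"])
        show "AE x in L. norm (poisson_smooth \<phi> y x) \<le> B + \<epsilon> / (4 * K)"
        proof (rule AE_I2)
          fix x show "norm (poisson_smooth \<phi> y x) \<le> B + \<epsilon> / (4 * K)"
            using close[of x] B[of x] unfolding real_norm_def by linarith
        qed
      qed simp
      have "\<bar>(\<integral>x. poisson_smooth \<phi> y x \<partial>L) - integral\<^sup>L L \<phi>\<bar> = \<bar>\<integral>x. poisson_smooth \<phi> y x - \<phi> x \<partial>L\<bar>"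
        using i\<phi> ip by simp
      also have "\<dots> \<le> (\<integral>x. \<bar>poisson_smooth \<phi> y x - \<phi> x\<bar> \<partial>L)" by (rule integral_abs_bound)
      also have "\<dots> \<le> (\<integral>x. \<epsilon> / (4 * K) \<partial>L)"
        using i\<phi> ip close by (intro integral_mono) auto
      also have "\<dots> = measure L UNIV * (\<epsilon> / (4 * K))" by (simp add: L.borel_UNIV)
      also have "\<dots> \<le> K * (\<epsilon> / (4 * K))" using massL \<epsilon> K by (intro mult_right_mono) auto
      also have "\<dots> = \<epsilon> / 4" using K(1) by simp
      finally show ?thesis .
    qed
    have "\<forall>\<^sub>F n in sequentially. dist (\<integral>x. poisson_smooth \<phi> y x \<partial>(M n)) (\<integral>x. poisson_smooth \<phi> y x \<partial>N) < \<epsilon> / 4"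
      using tendstoD[OF smooth[OF y], of "\<epsilon>/4"] \<epsilon> by simp
    then have "\<forall>\<^sub>F n in sequentially. norm (integral\<^sup>L (M n) \<phi> - integral\<^sup>L N \<phi>) < \<epsilon>"
    proof eventually_elim
      case (elim n)
      have "\<bar>(\<integral>x. poisson_smooth \<phi> y x \<partial>(M n)) - integral\<^sup>L (M n) \<phi>\<bar> \<le> \<epsilon>/4"
        "\<bar>(\<integral>x. poisson_smooth \<phi> y x \<partial>N) - integral\<^sup>L N \<phi>\<bar> \<le> \<epsilon>/4"
        by (rule est, blast)+
      then show ?case using elim \<epsilon> unfolding dist_real_def real_norm_def by linarith
    qed
    then show "\<exists>no. \<forall>n\<ge>no. norm (integral\<^sup>L (M n) \<phi> - integral\<^sup>L N \<phi>) < \<epsilon>"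
      by (simp add: eventually_sequentially)
  qed
qed

section \<open>The Poisson formula and Nevanlinna representations\<close>

lemma integrable_poisson_kernel:
  assumes "y > 0"
  shows "integrable lborel (\<lambda>x::real. y / ((x - a)\<^sup>2 + y\<^sup>2))"
proof -
  have "integrable lborel (\<lambda>x. 1 / (1 + (- a / y + (1 / y) * x)\<^sup>2))"
    using integrable_cauchy_density assms by (intro lborel_integrable_real_affine) auto
  then have "integrable lborel (\<lambda>x. (1 / y) * (1 / (1 + (- a / y + (1 / y) * x)\<^sup>2)))"
    by (rule integrable_mult_right)
  moreover have "(1 / y) * (1 / (1 + (- a / y + (1 / y) * x)\<^sup>2)) = y / ((x - a)\<^sup>2 + y\<^sup>2)" for x
  proof -
    have "- a / y + (1 / y) * x = (x - a) / y" using assms by (simp add: field_simps)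
    then have "1 + (- a / y + (1 / y) * x)\<^sup>2 = ((x - a)\<^sup>2 + y\<^sup>2) / y\<^sup>2"
      using assms by (simp add: field_simps)
    then show ?thesis using assms by (simp add: power2_eq_square)
  qed
  ultimately show ?thesis by simp
qed

text \<open>
  The Poisson formula follows from the Cauchy integral formula on large rectangles standing on the real
  axis, applied with the kernel \<open>1 / (w - z) - 1 / (w - cnj z)\<close>: this kernel decays
  quadratically, so that the three upper sides contribute nothing in the limit, and on the real axis it is
  the Poisson kernel.
\<close>

theorem poisson_formula_half_plane:
  assumes \<epsilon>: "\<epsilon> > 0" and holh: "h holomorphic_on {w. Im w > - \<epsilon>}"
    and bnd: "\<And>w. Im w \<ge> 0 \<Longrightarrow> norm (h w) \<le> B" and z: "z \<in> UHP"
  shows "(CLINT x|lborel. h (of_real x) * of_real (Im z / ((x - Re z)\<^sup>2 + (Im z)\<^sup>2))) = of_real pi * h z"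
proof -
  define y where "y = Im z"
  have y: "y > 0" using z by (simp add: y_def UHP_def)
  \<comment> \<open>a convex neighbourhood of the closed half-plane that avoids the pole \<open>cnj z\<close>\<close>
  define S where "S = {w. Im w > - min \<epsilon> y}"
  define \<Phi> where "\<Phi> w = (h w * ((z - cnj z) / (w - cnj z))) / (w - z)" for w
  have S: "convex S" "open S" "z \<in> S"
    using y \<epsilon> by (auto simp: S_def convex_halfspace_Im_gt open_halfspace_Im_gt y_def)
  have nz: "w - cnj z \<noteq> 0" if "w \<in> S" for w
    using that y by (auto simp: S_def y_def complex_eq_iff)
  have hol: "(\<lambda>w. h w * ((z - cnj z) / (w - cnj z))) holomorphic_on S"
  proof (intro holomorphic_intros)
    show "h holomorphic_on S" by (rule holomorphic_on_subset[OF holh]) (auto simp: S_def)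
  qed (use nz in auto)
  have B0: "B \<ge> 0" using bnd[of 0] by (simp add: order_trans[OF norm_ge_zero])
  have \<Phi>real: "\<Phi> (of_real x) = 2 * \<i> * (h (of_real x) * of_real (y / ((x - Re z)\<^sup>2 + y\<^sup>2)))" for x
  proof -
    have "(of_real x - cnj z) * (of_real x - z) = of_real ((x - Re z)\<^sup>2 + y\<^sup>2)"
      by (simp add: complex_eq_iff y_def power2_eq_square algebra_simps)
    moreover have "z - cnj z = 2 * \<i> * of_real y" by (simp add: complex_eq_iff y_def)
    ultimately show ?thesis by (simp add: \<Phi>_def mult.assoc)
  qed
  have \<Phi>bound: "norm (\<Phi> w) \<le> B * (2 * y) / (n - norm z)\<^sup>2"
    if w: "Im w \<ge> 0" "norm w \<ge> n" and n: "n > norm z" for w n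
  proof -
    have "norm (w - z) \<ge> n - norm z" "norm (w - cnj z) \<ge> n - norm z"
      using norm_triangle_ineq2[of w z] norm_triangle_ineq2[of w "cnj z"] w by auto
    then have "(n - norm z)\<^sup>2 \<le> norm (w - cnj z) * norm (w - z)"
      unfolding power2_eq_square using n by (intro mult_mono) auto
    moreover have "norm (z - cnj z) = 2 * y"
      using y by (simp add: complex_diff_cnj y_def norm_mult)
    moreover have "norm (\<Phi> w) = norm (h w) * norm (z - cnj z) / (norm (w - cnj z) * norm (w - z))"
      by (simp add: \<Phi>_def norm_mult norm_divide)
    ultimately show ?thesis
      using bnd[OF w(1)] n y B0 by (auto intro!: frac_le mult_right_mono)
  qed
  define V where "V = 2 * of_real pi * \<i> * h z"
  note V = V_def
  have rect: "norm (V - integral {-n..n} (\<lambda>x. \<Phi> (of_real x))) \<le> 4 * n * (B * (2 * y) / (n - norm z)\<^sup>2)"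
    if n: "n > norm z" for n :: real
  proof -
    have n0: "n > 0" using n norm_ge_zero[of z] by linarith
    define a1 a2 a3 a4 where "a1 = Complex (-n) 0" and "a2 = Complex n 0" and "a3 = Complex n n" and "a4 = Complex (-n) n"
    have rp: "rectpath a1 a3 = linepath a1 a2 +++ linepath a2 a3 +++ linepath a3 a4 +++ linepath a4 a1"
      by (simp add: rectpath_def Let_def a1_def a2_def a3_def a4_def)
    have zbox: "z \<in> box a1 a3"
      using abs_Re_le_cmod[of z] abs_Im_le_cmod[of z] n y by (auto simp: in_box_complex_iff a1_def a3_def y_def)
    have img: "path_image (rectpath a1 a3) = cbox a1 a3 - box a1 a3"
      using n0 by (intro path_image_rectpath_cbox_minus_box) (auto simp: a1_def a3_def)
    have imgS: "path_image (rectpath a1 a3) \<subseteq> S - {z}"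
      unfolding img using zbox y \<epsilon> by (auto simp: in_cbox_complex_iff S_def a1_def)
    have "((\<lambda>w. (h w * ((z - cnj z) / (w - cnj z))) / (w - z)) has_contour_integral
        (2 * pi * \<i> * winding_number (rectpath a1 a3) z * (h z * ((z - cnj z) / (z - cnj z))))) (rectpath a1 a3)"
      using S imgS by (intro Cauchy_integral_formula_convex_simple[OF S(1) hol]) (auto simp: interior_open)
    then have I: "(\<Phi> has_contour_integral V) (rectpath a1 a3)"
      using winding_number_rectpath[OF zbox] nz[OF S(3)] V unfolding \<Phi>_def by simp
    have cont: "continuous_on (path_image (rectpath a1 a3)) \<Phi>"
      unfolding \<Phi>_def using imgS nz
      by (intro continuous_intros continuous_on_subset[OF holomorphic_on_imp_continuous_on[OF holh]]) (force simp: S_def)+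
    have pi: "path_image (rectpath a1 a3) = closed_segment a1 a2 \<union> (closed_segment a2 a3 \<union> (closed_segment a3 a4 \<union> closed_segment a4 a1))"
      unfolding rp by (simp add: path_image_join)
    have ci: "\<Phi> contour_integrable_on linepath a1 a2" "\<Phi> contour_integrable_on linepath a2 a3"
       "\<Phi> contour_integrable_on linepath a3 a4" "\<Phi> contour_integrable_on linepath a4 a1"
      by (intro contour_integrable_continuous_linepath continuous_on_subset[OF cont]; simp add: pi; blast)+
    let ?I = "\<lambda>a b. contour_integral (linepath a b) \<Phi>"
    have hc: "(\<Phi> has_contour_integral ?I a1 a2) (linepath a1 a2)" "(\<Phi> has_contour_integral ?I a2 a3) (linepath a2 a3)"
      "(\<Phi> has_contour_integral ?I a3 a4) (linepath a3 a4)" "(\<Phi> has_contour_integral ?I a4 a1) (linepath a4 a1)"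
      by (intro has_contour_integral_integral ci)+
    have "(\<Phi> has_contour_integral (?I a1 a2 + (?I a2 a3 + (?I a3 a4 + ?I a4 a1)))) (rectpath a1 a3)"
      unfolding rp by (intro has_contour_integral_join hc) (auto intro!: valid_path_join)
    from has_contour_integral_unique[OF I this]
    have Vsum: "V - ?I a1 a2 = ?I a2 a3 + ?I a3 a4 + ?I a4 a1" by simp
    have bot: "?I a1 a2 = integral {-n..n} (\<lambda>x. \<Phi> (of_real x))"
      using n0 by (subst contour_integral_linepath_Reals_eq) (auto simp: a1_def a2_def complex_is_Real_iff)
    define C where "C = B * (2 * y) / (n - norm z)\<^sup>2"
    have C0: "C \<ge> 0" using B0 y by (simp add: C_def)
    have nle: "n \<le> norm w" if "Re w = n \<or> Re w = -n \<or> Im w = n" for w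
      using that abs_Re_le_cmod[of w] abs_Im_le_cmod[of w] by auto
    have len: "norm (a3 - a2) = n" "norm (a4 - a3) = 2 * n" "norm (a1 - a4) = n"
      using n0 by (simp_all add: a1_def a2_def a3_def a4_def cmod_def real_sqrt_mult)
    have "norm (?I a2 a3) \<le> C * n" unfolding len(1)[symmetric]
    proof (rule has_contour_integral_bound_linepath[OF hc(2) C0])
      fix w assume "w \<in> closed_segment a2 a3"
      then have "Re w = n" "Im w \<ge> 0"
        using n0 by (auto simp: closed_segment_same_Re a2_def a3_def closed_segment_eq_real_ivl)
      then show "norm (\<Phi> w) \<le> C" using n nle unfolding C_def by (intro \<Phi>bound) auto
    qed
    moreover have "norm (?I a3 a4) \<le> C * (2 * n)" unfolding len(2)[symmetric]
    proof (rule has_contour_integral_bound_linepath[OF hc(3) C0])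
      fix w assume "w \<in> closed_segment a3 a4"
      then have "Im w = n" by (simp add: closed_segment_same_Im a3_def a4_def)
      then show "norm (\<Phi> w) \<le> C" using n nle n0 unfolding C_def by (intro \<Phi>bound) auto
    qed
    moreover have "norm (?I a4 a1) \<le> C * n" unfolding len(3)[symmetric]
    proof (rule has_contour_integral_bound_linepath[OF hc(4) C0])
      fix w assume "w \<in> closed_segment a4 a1"
      then have "Re w = -n" "Im w \<ge> 0"
        using n0 by (auto simp: closed_segment_same_Re a4_def a1_def closed_segment_eq_real_ivl)
      then show "norm (\<Phi> w) \<le> C" using n nle unfolding C_def by (intro \<Phi>bound) auto
    qed
    moreover have "norm (?I a2 a3 + ?I a3 a4 + ?I a4 a1) \<le> norm (?I a2 a3) + norm (?I a3 a4) + norm (?I a4 a1)"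
      by (intro norm_triangle_le add_mono order_refl norm_triangle_ineq)
    ultimately have "norm (V - ?I a1 a2) \<le> C * n + C * (2 * n) + C * n"
      unfolding Vsum by linarith
    also have "\<dots> = 4 * n * (B * (2 * y) / (n - norm z)\<^sup>2)" by (simp add: C_def)
    finally show ?thesis unfolding bot .
  qed
  define F where "F x = \<Phi> (of_real x)" for x :: real
  have cF: "continuous_on UNIV F"
  proof -
    have "continuous_on UNIV (\<lambda>x::real. h (of_real x))"
      using \<epsilon> by (intro continuous_on_compose2[OF holomorphic_on_imp_continuous_on[OF holh]] continuous_intros) auto
    moreover have "(x - Re z)\<^sup>2 + y\<^sup>2 \<noteq> 0" for x using y by (simp add: sum_power2_eq_zero_iff)
    ultimately show ?thesis unfolding F_def \<Phi>real by (intro continuous_intros) auto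
  qed
  have [measurable]: "F \<in> borel_measurable borel" using cF by (rule borel_measurable_continuous_onI)
  have Fbd: "norm (F x) \<le> 2 * B * (y / ((x - Re z)\<^sup>2 + y\<^sup>2))" for x
  proof -
    have "norm (F x) = 2 * norm (h (of_real x)) * (y / ((x - Re z)\<^sup>2 + y\<^sup>2))"
      unfolding F_def \<Phi>real norm_mult norm_of_real using y by simp
    also have "\<dots> \<le> 2 * B * (y / ((x - Re z)\<^sup>2 + y\<^sup>2))"
      using bnd[of "of_real x"] y by (intro mult_right_mono) auto
    finally show ?thesis .
  qed
  have int: "integrable lborel (\<lambda>x. 2 * B * (y / ((x - Re z)\<^sup>2 + y\<^sup>2)))"
    by (intro integrable_mult_right integrable_poisson_kernel y)
  have L1: "(\<lambda>k::nat. LINT x:{- real k..real k}|lborel. F x) \<longlonglongrightarrow> (LINT x|lborel. F x)"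
    unfolding set_lebesgue_integral_def
  proof (rule integral_dominated_convergence[OF _ _ int])
    show "AE x in lborel. (\<lambda>k. indicator {- real k..real k} x *\<^sub>R F x) \<longlonglongrightarrow> F x"
    proof (intro AE_I2 tendsto_eventually)
      fix x :: real show "\<forall>\<^sub>F k in sequentially. indicator {- real k..real k} x *\<^sub>R F x = F x"
        using eventually_ge_at_top[of "nat \<lceil>\<bar>x\<bar>\<rceil>"]
      proof eventually_elim
        case (elim k)
        then have "\<bar>x\<bar> \<le> real k" by linarith
        then show ?case by (simp add: indicator_def abs_le_iff)
      qed
    qed
    show "AE x in lborel. norm (indicator {- real k..real k} x *\<^sub>R F x) \<le> 2 * B * (y / ((x - Re z)\<^sup>2 + y\<^sup>2))" for k
      using Fbd B0 y by (auto simp: indicator_def)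
  qed auto
  have L2: "(\<lambda>k::nat. LINT x:{- real k..real k}|lborel. F x) \<longlonglongrightarrow> V"
  proof (rule Lim_transform2[OF tendsto_const])
    have eq: "(LINT x:{- real k..real k}|lborel. F x) = integral {- real k..real k} F" for k
      by (intro set_borel_integral_eq_integral borel_integrable_atLeastAtMost' continuous_on_subset[OF cF]) auto
    have lim: "(\<lambda>k::nat. 4 * real k * (B * (2 * y) / (real k - norm z)\<^sup>2)) \<longlonglongrightarrow> 0"
      by real_asymp
    show "(\<lambda>k::nat. V - (LINT x:{- real k..real k}|lborel. F x)) \<longlonglongrightarrow> 0"
    proof (rule Lim_null_comparison[OF _ lim])
      show "\<forall>\<^sub>F k in sequentially. norm (V - (LINT x:{- real k..real k}|lborel. F x)) \<le> 4 * real k * (B * (2 * y) / (real k - norm z)\<^sup>2)"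
        using filterlim_at_top_dense[THEN iffD1, OF filterlim_real_sequentially, rule_format, of "norm z"]
      proof eventually_elim
        case (elim k)
        show ?case unfolding eq using rect[OF elim] unfolding F_def .
      qed
    qed
  qed
  have "(LINT x|lborel. F x) = V" by (rule LIMSEQ_unique[OF L1 L2])
  then have "2 * \<i> * (CLINT x|lborel. h (of_real x) * of_real (y / ((x - Re z)\<^sup>2 + y\<^sup>2))) = 2 * \<i> * (of_real pi * h z)"
    unfolding F_def \<Phi>real integral_mult_right_zero V by simp
  then show ?thesis unfolding y_def by simp
qed

text \<open>
  The difference is real-valued, so its image is not open and it must be constant; the constant is
  the limit along the imaginary axis.
\<close>

lemma holomorphic_UHP_eq_if_Im_eq:
  assumes f: "f holomorphic_on UHP" "((\<lambda>y. f (\<i> * of_real y)) \<longlongrightarrow> 0) at_top"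
    and g: "g holomorphic_on UHP" "((\<lambda>y. g (\<i> * of_real y)) \<longlongrightarrow> 0) at_top"
    and Im: "\<And>z. z \<in> UHP \<Longrightarrow> Im (f z) = Im (g z)" and z: "z \<in> UHP"
  shows "f z = g z"
proof -
  define d where "d z = f z - g z" for z
  have hol: "d holomorphic_on UHP" unfolding d_def by (intro holomorphic_intros f g)
  have dreal: "Im (d z) = 0" if "z \<in> UHP" for z using Im[OF that] by (simp add: d_def)
  have conn: "connected UHP" unfolding UHP_def by (intro convex_connected convex_halfspace_Im_gt)
  have "d constant_on UHP"
  proof (rule ccontr)
    assume nc: "\<not> d constant_on UHP"
    have "open (d ` UHP)"
      by (rule open_mapping_thm[OF hol open_UHP conn open_UHP order_refl nc])
    moreover have "d \<i> \<in> d ` UHP" by (simp add: UHP_def)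
    ultimately obtain e where e: "e > 0" "ball (d \<i>) e \<subseteq> d ` UHP"
      unfolding open_contains_ball by blast
    have "d \<i> + \<i> * of_real (e/2) \<in> ball (d \<i>) e" using e(1) by (simp add: dist_norm norm_mult)
    then obtain w where w: "w \<in> UHP" "d w = d \<i> + \<i> * of_real (e/2)" using e(2) by (metis imageE subsetD)
    then have "Im (d w) = Im (d \<i>) + e / 2" by simp
    then show False using dreal[OF w(1)] dreal[of \<i>] e(1) by (simp add: UHP_def)
  qed
  then obtain c where c: "\<And>z. z \<in> UHP \<Longrightarrow> d z = c" unfolding constant_on_def by blast
  have "((\<lambda>y. d (\<i> * of_real y)) \<longlongrightarrow> 0 - 0) at_top"
    unfolding d_def by (intro tendsto_diff f g)
  moreover have "\<forall>\<^sub>F y in at_top. d (\<i> * of_real y) = c"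
    using eventually_gt_at_top[of 0] by eventually_elim (simp add: c UHP_def)
  ultimately have "((\<lambda>y::real. c) \<longlongrightarrow> 0 - 0) at_top"
    by (rule Lim_transform_eventually)
  then have "c = 0" by (simp add: tendsto_const_iff)
  then show ?thesis using c[OF z] by (simp add: d_def)
qed

lemma density_const_finite_borel_measure:
  assumes M: "finite_borel_measure M" and c: "c \<ge> 0"
  shows "finite_borel_measure (density M (\<lambda>_. ennreal c))"
    and "measure (density M (\<lambda>_. ennreal c)) UNIV = c * measure M UNIV"
    and "\<And>f :: real \<Rightarrow> complex. f \<in> borel_measurable borel \<Longrightarrow>
      integral\<^sup>L (density M (\<lambda>_. ennreal c)) f = of_real c * integral\<^sup>L M f"
proof -
  interpret M: finite_borel_measure M by fact
  have e: "emeasure (density M (\<lambda>_. ennreal c)) UNIV = ennreal (c * measure M UNIV)"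
    using c by (simp add: emeasure_density_const M.M_is_borel M.emeasure_eq_measure ennreal_mult)
  show "finite_borel_measure (density M (\<lambda>_. ennreal c))"
    by (intro finite_borel_measure.intro finite_measureI finite_borel_measure_axioms.intro)
       (use e in \<open>simp_all add: M.borel_UNIV M.M_is_borel\<close>)
  show "measure (density M (\<lambda>_. ennreal c)) UNIV = c * measure M UNIV"
    using c by (simp add: measure_def e)
  fix f :: "real \<Rightarrow> complex" assume f: "f \<in> borel_measurable borel"
  then have f: "f \<in> borel_measurable M" by (simp add: measurable_cong_sets[OF M.M_is_borel refl])
  show "integral\<^sup>L (density M (\<lambda>_. ennreal c)) f = of_real c * integral\<^sup>L M f"
    using integral_density[OF f, of "\<lambda>_. c"] c by (simp add: scaleR_conv_of_real)
qed

text \<open>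
  Points with \<open>\<bar>x\<bar> \<ge> y\<close> have \<open>1 - y\<^sup>2 / (x\<^sup>2 + y\<^sup>2) \<ge> 1 / 2\<close>, and the integral of
  \<open>y\<^sup>2 / (x\<^sup>2 + y\<^sup>2)\<close> is \<open>- y Im G(iy)\<close>.
\<close>

lemma tail_le_cauchy_G:
  assumes M: "finite_borel_measure M" and y: "y > 0"
  shows "measure M {x. \<bar>x\<bar> \<ge> y} \<le> 2 * (measure M UNIV + y * Im (cauchy_G M (\<i> * of_real y)))"
proof -
  interpret M: finite_borel_measure M by fact
  note [measurable_cong] = M.M_is_borel
  have U: "\<i> * of_real y \<in> UHP" using y by (simp add: UHP_def)
  have y2: "x\<^sup>2 + y\<^sup>2 > 0" for x using y by (simp add: add_nonneg_pos)
  have int: "integrable M (\<lambda>x. y\<^sup>2 / (x\<^sup>2 + y\<^sup>2))"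
    by (rule M.integrable_const_bound[where B=1]) (use y2 in \<open>auto simp: divide_le_eq\<close>)
  have yIm: "y * Im (cauchy_G M (\<i> * of_real y)) = - (\<integral>x. y\<^sup>2 / (x\<^sup>2 + y\<^sup>2) \<partial>M)"
    unfolding M.Im_cauchy_G[OF U] mult_minus_right integral_mult_right_zero[symmetric]
    by (simp add: power2_eq_square)
  have "measure M {x. \<bar>x\<bar> \<ge> y} = (\<integral>x. indicator {x. \<bar>x\<bar> \<ge> y} x \<partial>M)"
    by (simp add: M.borel_UNIV)
  also have "\<dots> \<le> (\<integral>x. 2 * (1 - y\<^sup>2 / (x\<^sup>2 + y\<^sup>2)) \<partial>M)"
  proof (rule integral_mono)
    show "integrable M (indicator {x. \<bar>x\<bar> \<ge> y} :: real \<Rightarrow> real)"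
      by (rule M.integrable_const_bound[where B=1]) (auto simp: indicator_def)
    show "integrable M (\<lambda>x. 2 * (1 - y\<^sup>2 / (x\<^sup>2 + y\<^sup>2)))"
      by (intro integrable_mult_right Bochner_Integration.integrable_diff int) simp
    fix x
    show "indicator {x. \<bar>x\<bar> \<ge> y} x \<le> 2 * (1 - y\<^sup>2 / (x\<^sup>2 + y\<^sup>2))"
    proof (cases "\<bar>x\<bar> \<ge> y")
      case True
      then have "y\<^sup>2 \<le> x\<^sup>2" using y abs_le_square_iff[of y x] by simp
      then show ?thesis using y2[of x] True by (simp add: field_simps)
    next
      case False then show ?thesis using y2[of x] by (simp add: divide_le_eq)
    qed
  qed
  also have "\<dots> = 2 * (measure M UNIV + y * Im (cauchy_G M (\<i> * of_real y)))"
    unfolding yIm integral_mult_right_zero using int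
    by (subst Bochner_Integration.integral_diff) (simp_all add: M.borel_UNIV)
  finally show ?thesis .
qed

text \<open>
  These functions turn out to be the Cauchy transforms of measures of mass \<open>v\<close>. The example of
  interest is \<open>z - a - F(z)\<close>, with \<open>F\<close> the reciprocal Cauchy transform of a law with mean
  \<open>a\<close> and variance \<open>v\<close>.
\<close>

locale decaying_nevanlinna =
  fixes H :: "complex \<Rightarrow> complex" and v :: real
  assumes holomorphic: "H holomorphic_on UHP"
    and Im_nonpos: "\<And>z. z \<in> UHP \<Longrightarrow> Im (H z) \<le> 0"
    and bounded: "\<And>\<epsilon>. \<epsilon> > 0 \<Longrightarrow> \<exists>B. \<forall>z. Im z \<ge> \<epsilon> \<longrightarrow> norm (H z) \<le> B"
    and asymptotic: "((\<lambda>y. \<i> * of_real y * H (\<i> * of_real y)) \<longlongrightarrow> of_real v) at_top"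
begin

lemma tendsto_y_Im: "((\<lambda>y. y * Im (H (\<i> * of_real y))) \<longlongrightarrow> - v) at_top"
  using tendsto_minus[OF tendsto_Re[OF asymptotic]] by simp

lemma v_nonneg: "v \<ge> 0"
proof -
  have "- v \<le> 0"
  proof (rule tendsto_upperbound[OF tendsto_y_Im])
    show "\<forall>\<^sub>F y in at_top. y * Im (H (\<i> * of_real y)) \<le> 0"
      using eventually_gt_at_top[of 0]
      by eventually_elim (use Im_nonpos in \<open>auto simp: UHP_def intro!: mult_nonneg_nonpos\<close>)
  qed simp
  then show ?thesis by simp
qed

lemma tendsto_0: "((\<lambda>y. H (\<i> * of_real y)) \<longlongrightarrow> 0) at_top"
proof -
  have inv: "((\<lambda>y::real. complex_of_real (inverse y)) \<longlongrightarrow> of_real 0) at_top"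
    by (intro tendsto_of_real tendsto_inverse_0_at_top filterlim_ident)
  have "((\<lambda>y. (\<i> * of_real y * H (\<i> * of_real y)) * (- \<i> * of_real (inverse y))) \<longlongrightarrow> of_real v * (- \<i> * of_real 0)) at_top"
    by (intro tendsto_mult asymptotic tendsto_const inv)
  then have lim: "((\<lambda>y. (\<i> * of_real y * H (\<i> * of_real y)) * (- \<i> * of_real (inverse y))) \<longlongrightarrow> 0) at_top" by simp
  show ?thesis
    by (rule Lim_transform_eventually[OF lim])
       (use eventually_gt_at_top[of 0] in \<open>eventually_elim; simp add: ac_simps\<close>)
qed

text \<open>
  Above height \<open>\<epsilon>\<close> the representing measure has the explicit density
  \<open>- Im H(x + i\<epsilon>) / \<pi>\<close>. Its mass is the limit of \<open>- n Im H(i(n + \<epsilon>))\<close>, since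
  the kernels \<open>n\<^sup>2 / (x\<^sup>2 + n\<^sup>2)\<close> increase to \<open>1\<close>.
\<close>

lemma representation_above:
  assumes \<epsilon>: "\<epsilon> > 0"
  shows "\<exists>\<rho>. finite_borel_measure \<rho> \<and> measure \<rho> UNIV = v \<and> (\<forall>z\<in>UHP. H (z + \<i> * of_real \<epsilon>) = cauchy_G \<rho> z)"
proof -
  define h where "h z = H (z + \<i> * of_real \<epsilon>)" for z
  have holh: "h holomorphic_on {w. Im w > - \<epsilon>}"
    unfolding h_def using \<epsilon>
    by (intro holomorphic_on_compose_gen[OF _ holomorphic, unfolded o_def] holomorphic_intros) (auto simp: UHP_def)
  obtain B where B: "\<And>z. Im z \<ge> \<epsilon> \<Longrightarrow> norm (H z) \<le> B" using bounded[OF \<epsilon>] by blast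
  have hB: "norm (h w) \<le> B" if "Im w \<ge> 0" for w using that by (auto simp: h_def intro!: B)
  have ch: "continuous_on UNIV (\<lambda>x::real. h (of_real x))"
    using \<epsilon> by (intro continuous_on_compose2[OF holomorphic_on_imp_continuous_on[OF holh]] continuous_intros) auto
  then have [measurable]: "(\<lambda>x::real. h (of_real x)) \<in> borel_measurable borel" by (rule borel_measurable_continuous_onI)
  define g where "g x = - Im (h (of_real x)) / pi" for x
  have g0: "g x \<ge> 0" for x
    using Im_nonpos[of "of_real x + \<i> * of_real \<epsilon>"] \<epsilon> pi_gt_zero by (simp add: g_def h_def UHP_def divide_nonpos_pos)
  have [measurable]: "g \<in> borel_measurable borel" unfolding g_def by measurable
  have P: "(LINT x|lborel. g x * (Im z / ((x - Re z)\<^sup>2 + (Im z)\<^sup>2))) = - Im (h z)"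
    and intP: "integrable lborel (\<lambda>x. g x * (Im z / ((x - Re z)\<^sup>2 + (Im z)\<^sup>2)))" if z: "z \<in> UHP" for z
  proof -
    let ?p = "\<lambda>x. Im z / ((x - Re z)\<^sup>2 + (Im z)\<^sup>2)"
    have y: "Im z > 0" using z by (simp add: UHP_def)
    have int: "integrable lborel (\<lambda>x. h (of_real x) * of_real (?p x))"
    proof (rule Bochner_Integration.integrable_bound)
      show "integrable lborel (\<lambda>x. B * ?p x)" by (intro integrable_mult_right integrable_poisson_kernel y)
      show "AE x in lborel. norm (h (of_real x) * of_real (?p x)) \<le> norm (B * ?p x)"
      proof (rule AE_I2)
        fix x :: real
        have "norm (h (of_real x)) \<le> \<bar>B\<bar>" using hB[of "of_real x"] by simp
        then show "norm (h (of_real x) * of_real (?p x)) \<le> norm (B * ?p x)"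
          unfolding norm_mult norm_of_real real_norm_def abs_mult by (intro mult_right_mono) auto
      qed
    qed simp
    have eq: "g x * ?p x = - (Im (h (of_real x) * of_real (?p x)) / pi)" for x by (simp add: g_def)
    show "integrable lborel (\<lambda>x. g x * ?p x)" unfolding eq
      by (intro Bochner_Integration.integrable_minus integrable_divide integrable_Im int)
    have "(LINT x|lborel. Im (h (of_real x) * of_real (?p x))) = pi * Im (h z)"
      using poisson_formula_half_plane[OF \<epsilon> holh hB z] int by (subst integral_Im) auto
    then show "(LINT x|lborel. g x * ?p x) = - Im (h z)"
      unfolding eq Bochner_Integration.integral_minus integral_divide_zero by simp
  qed
  define \<rho> where "\<rho> = density lborel (\<lambda>x. ennreal (g x))"
  have mass: "(\<integral>\<^sup>+x. ennreal (g x) \<partial>lborel) = ennreal v"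
  proof (rule LIMSEQ_unique)
    define p where "p n x = real (Suc n) ^ 2 / (x\<^sup>2 + real (Suc n) ^ 2)" for n :: nat and x :: real
    have p01: "0 \<le> p n x" for n x by (simp add: p_def)
    have palt: "p n x = 1 - x\<^sup>2 / (x\<^sup>2 + real (Suc n) ^ 2)" for n x
    proof -
      have "x\<^sup>2 + real (Suc n) ^ 2 > 0" by (intro add_nonneg_pos) auto
      then show ?thesis unfolding p_def by (simp add: field_simps)
    qed
    show "(\<lambda>n. \<integral>\<^sup>+x. ennreal (g x * p n x) \<partial>lborel) \<longlonglongrightarrow> (\<integral>\<^sup>+x. ennreal (g x) \<partial>lborel)"
    proof (rule nn_integral_LIMSEQ)
      show "incseq (\<lambda>n x. ennreal (g x * p n x))"
      proof (intro incseq_SucI le_funI ennreal_leI mult_left_mono g0)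
        fix n x
        have "real (Suc n) ^ 2 \<le> real (Suc (Suc n)) ^ 2" by (intro power_mono) auto
        then show "p n x \<le> p (Suc n) x"
          unfolding palt by (intro diff_left_mono divide_left_mono mult_pos_pos add_nonneg_pos add_left_mono) auto
      qed
      show "(\<lambda>n. ennreal (g x * p n x)) \<longlonglongrightarrow> ennreal (g x)" for x
      proof (intro tendsto_ennrealI)
        have "(\<lambda>n. p n x) \<longlonglongrightarrow> 1" unfolding p_def by real_asymp
        from tendsto_mult_left[OF this, of "g x"] show "(\<lambda>n. g x * p n x) \<longlonglongrightarrow> g x" by simp
      qed
    qed (auto simp: p_def)
    have val: "(\<integral>\<^sup>+x. ennreal (g x * p n x) \<partial>lborel) = ennreal (- (real (Suc n) * Im (H (\<i> * of_real (real (Suc n) + \<epsilon>)))))" for n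
    proof -
      let ?z = "\<i> * of_real (real (Suc n))"
      have U: "?z \<in> UHP" by (simp add: UHP_def)
      have eq: "g x * p n x = real (Suc n) * (g x * (Im ?z / ((x - Re ?z)\<^sup>2 + (Im ?z)\<^sup>2)))" for x
        by (simp add: p_def power2_eq_square)
      have "integrable lborel (\<lambda>x. g x * p n x)" unfolding eq by (intro integrable_mult_right intP U)
      then have "(\<integral>\<^sup>+x. ennreal (g x * p n x) \<partial>lborel) = ennreal (LINT x|lborel. g x * p n x)"
        using g0 p01 by (intro nn_integral_eq_integral) auto
      also have "(LINT x|lborel. g x * p n x) = real (Suc n) * (- Im (h ?z))"
        unfolding eq integral_mult_right_zero P[OF U] ..
      finally show ?thesis by (simp add: h_def algebra_simps)
    qed
    have seq: "filterlim (\<lambda>n. real (Suc n) + \<epsilon>) at_top sequentially" by real_asymp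
    have "(\<lambda>n. (real (Suc n) / (real (Suc n) + \<epsilon>)) * ((real (Suc n) + \<epsilon>) * Im (H (\<i> * of_real (real (Suc n) + \<epsilon>))))) \<longlonglongrightarrow> 1 * (- v)"
      by (intro tendsto_mult filterlim_compose[OF tendsto_y_Im seq]) real_asymp
    moreover have "(real (Suc n) / (real (Suc n) + \<epsilon>)) * ((real (Suc n) + \<epsilon>) * Im (H (\<i> * of_real (real (Suc n) + \<epsilon>))))
        = real (Suc n) * Im (H (\<i> * of_real (real (Suc n) + \<epsilon>)))" for n
    proof -
      have "real (Suc n) + \<epsilon> \<noteq> 0" using \<epsilon> by (simp add: add_nonneg_eq_0_iff)
      then show ?thesis by (metis mult.assoc nonzero_eq_divide_eq)
    qed
    ultimately have "(\<lambda>n. real (Suc n) * Im (H (\<i> * of_real (real (Suc n) + \<epsilon>)))) \<longlonglongrightarrow> - v" by simp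
    from tendsto_minus[OF this]
    show "(\<lambda>n. \<integral>\<^sup>+x. ennreal (g x * p n x) \<partial>lborel) \<longlonglongrightarrow> ennreal v"
      unfolding val by (intro tendsto_ennrealI) simp
  qed
  have em: "emeasure \<rho> UNIV = ennreal v"
    unfolding \<rho>_def using mass by (simp add: emeasure_density)
  have fin: "finite_borel_measure \<rho>"
    by (intro finite_borel_measure.intro finite_measureI finite_borel_measure_axioms.intro)
       (use em in \<open>simp_all add: \<rho>_def\<close>)
  interpret \<rho>: finite_borel_measure \<rho> by fact
  have "H (z + \<i> * of_real \<epsilon>) = cauchy_G \<rho> z" if z: "z \<in> UHP" for z
  proof -
    have "h z = cauchy_G \<rho> z"
    proof (rule holomorphic_UHP_eq_if_Im_eq[OF _ _ _ _ _ z])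
      show "h holomorphic_on UHP" by (rule holomorphic_on_subset[OF holh]) (use \<epsilon> in \<open>auto simp: UHP_def\<close>)
      have "filterlim (\<lambda>y. y + \<epsilon>) at_top at_top" by real_asymp
      from filterlim_compose[OF tendsto_0 this]
      show "((\<lambda>y. h (\<i> * of_real y)) \<longlongrightarrow> 0) at_top" by (simp add: h_def algebra_simps)
      show "cauchy_G \<rho> holomorphic_on UHP" by (rule \<rho>.holomorphic_cauchy_G)
      have lim: "((\<lambda>y. measure \<rho> UNIV / y) \<longlongrightarrow> 0) at_top" by real_asymp
      show "((\<lambda>y. cauchy_G \<rho> (\<i> * of_real y)) \<longlongrightarrow> 0) at_top"
      proof (rule Lim_null_comparison[OF _ lim])
        show "\<forall>\<^sub>F y in at_top. norm (cauchy_G \<rho> (\<i> * of_real y)) \<le> measure \<rho> UNIV / y"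
          using eventually_gt_at_top[of 0]
        proof eventually_elim
          case (elim y)
          then show ?case using \<rho>.norm_cauchy_G_le[of "\<i> * of_real y"] by (simp add: UHP_def)
        qed
      qed
      fix w assume w: "w \<in> UHP"
      show "Im (h w) = Im (cauchy_G \<rho> w)"
        unfolding \<rho>.Im_cauchy_G[OF w] unfolding \<rho>_def using P[OF w] g0
        by (subst integral_density) auto
    qed
    then show ?thesis by (simp add: h_def)
  qed
  moreover have "measure \<rho> UNIV = v" using em v_nonneg by (simp add: measure_def)
  ultimately show ?thesis using fin by blast
qed

text \<open>
  Letting \<open>\<epsilon>\<close> tend to zero, Helly's theorem applies: the tails are controlled uniformly in
  \<open>\<epsilon>\<close> by the common asymptotics at infinity.
\<close>

theorem representation:
  "\<exists>\<rho>. finite_borel_measure \<rho> \<and> measure \<rho> UNIV = v \<and> (\<forall>z\<in>UHP. H z = cauchy_G \<rho> z)"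
proof -
  define \<epsilon> where "\<epsilon> k = 1 / real (Suc k)" for k
  have \<epsilon>: "\<epsilon> k > 0" "\<epsilon> k \<le> 1" for k by (auto simp: \<epsilon>_def)
  have "\<forall>k. \<exists>\<rho>. finite_borel_measure \<rho> \<and> measure \<rho> UNIV = v \<and> (\<forall>z\<in>UHP. H (z + \<i> * of_real (\<epsilon> k)) = cauchy_G \<rho> z)"
    using representation_above \<epsilon> by blast
  then obtain \<rho> where \<rho>: "\<And>k. finite_borel_measure (\<rho> k)" "\<And>k. measure (\<rho> k) UNIV = v"
    "\<And>k z. z \<in> UHP \<Longrightarrow> H (z + \<i> * of_real (\<epsilon> k)) = cauchy_G (\<rho> k) z" by metis
  have limH: "(\<lambda>k. H (z + \<i> * of_real (\<epsilon> k))) \<longlonglongrightarrow> H z" if z: "z \<in> UHP" for z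
  proof -
    have "\<epsilon> \<longlonglongrightarrow> 0" unfolding \<epsilon>_def by real_asymp
    then have "(\<lambda>k. z + \<i> * of_real (\<epsilon> k)) \<longlonglongrightarrow> z + \<i> * of_real 0"
      by (intro tendsto_intros)
    moreover have "isCont H z"
      using holomorphic_on_imp_continuous_on[OF holomorphic] z open_UHP by (simp add: continuous_on_eq_continuous_at)
    ultimately show ?thesis by (intro isCont_tendsto_compose[of z H]) auto
  qed
  show ?thesis
  proof (cases "v = 0")
    case True
    have "H z = cauchy_G (\<rho> 0) z" if z: "z \<in> UHP" for z
    proof -
      have zero: "cauchy_G (\<rho> k) z = 0" for k
        using finite_borel_measure.norm_cauchy_G_le[OF \<rho>(1) z] \<rho>(2) True by simp
      then have "(\<lambda>k. 0) \<longlonglongrightarrow> H z" using limH[OF z] \<rho>(3)[OF z] by simp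
      then show ?thesis using zero by (simp add: LIMSEQ_const_iff)
    qed
    then show ?thesis using \<rho>(1,2) by blast
  next
    case False
    then have v: "v > 0" using v_nonneg by simp
    define M where "M k = density (\<rho> k) (\<lambda>_. ennreal (1 / v))" for k
    have M: "finite_borel_measure (M k)" "measure (M k) UNIV = 1" for k
      using density_const_finite_borel_measure(1,2)[OF \<rho>(1), of "1/v" k] \<rho>(2)[of k] v by (auto simp: M_def)
    have Mreal: "real_distribution (M k)" for k
    proof -
      interpret finite_borel_measure "M k" by (rule M)
      have "emeasure (M k) (space (M k)) = 1" using M(2)[of k] by (simp add: borel_UNIV emeasure_eq_measure)
      then show ?thesis by (intro real_distribution.intro prob_spaceI real_distribution_axioms.intro M_is_borel)
    qed
    have GM: "of_real v * cauchy_G (M k) z = H (z + \<i> * of_real (\<epsilon> k))" if z: "z \<in> UHP" for k z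
      using density_const_finite_borel_measure(3)[OF \<rho>(1), of "1/v" "\<lambda>x. 1 / (z - of_real x)" k] v \<rho>(3)[OF z, of k]
      by (simp add: M_def cauchy_G_def)
    have "tight M"
      unfolding tight_def
    proof (intro conjI allI impI Mreal)
      fix \<delta> :: real assume \<delta>: "\<delta> > 0"
      \<comment> \<open>the tails beyond \<open>y\<close> will have mass at most \<open>4 \<eta> / v\<close>\<close>
      define \<eta> where "\<eta> = min (v / 2) (\<delta> * v / 8)"
      have \<eta>: "\<eta> > 0" "\<eta> < v" "4 * \<eta> / v < \<delta>" using v \<delta> by (auto simp: \<eta>_def min_def field_simps)
      have "\<forall>\<^sub>F u in at_top. u * Im (H (\<i> * of_real u)) < - v + \<eta>"
        using \<eta>(1) by (intro order_tendstoD(2)[OF tendsto_y_Im]) simp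
      then obtain Y where Y: "\<And>u. u \<ge> Y \<Longrightarrow> u * Im (H (\<i> * of_real u)) < - v + \<eta>"
        by (auto simp: eventually_at_top_linorder)
      define y where "y = max 1 (max Y (v / \<eta>))"
      have y: "y \<ge> 1" "y \<ge> Y" "y \<ge> v / \<eta>" by (auto simp: y_def)
      then have vy: "v / (y + 1) \<le> \<eta>" using \<eta> v by (simp add: field_simps) 
      have "measure (M k) {-y<..y} > 1 - \<delta>" for k
      proof -
        interpret Mk: real_distribution "M k" by (rule Mreal)
        have U: "\<i> * of_real y \<in> UHP" using y by (simp add: UHP_def)
        define u where "u = y + \<epsilon> k"
        have u: "u \<ge> Y" "u > 0" "u \<le> y + 1" using \<epsilon>[of k] y by (auto simp: u_def)
        have eq: "\<i> * of_real y + \<i> * of_real (\<epsilon> k) = \<i> * of_real u" by (simp add: u_def algebra_simps)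
        have "v * (y * Im (cauchy_G (M k) (\<i> * of_real y))) = y * Im (H (\<i> * of_real u))"
          using arg_cong[OF GM[OF U, of k], of Im] unfolding eq by (simp add: mult.left_commute)
        also have "\<dots> = (y / u) * (u * Im (H (\<i> * of_real u)))" using u by simp
        also have "\<dots> \<le> (y / u) * (- v + \<eta>)"
          using Y[OF u(1)] u y by (intro mult_left_mono) auto
        also have "\<dots> \<le> (y / (y + 1)) * (- v + \<eta>)"
          using u y \<eta> by (intro mult_right_mono_neg divide_left_mono) auto
        also have "\<dots> = - v + \<eta> + (v - \<eta>) / (y + 1)" using y by (simp add: field_simps)
        also have "\<dots> \<le> - v + \<eta> + v / (y + 1)" using \<eta> y by (intro add_left_mono divide_right_mono) auto
        also have "\<dots> \<le> - v + 2 * \<eta>" using vy by simp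
        finally have "1 + y * Im (cauchy_G (M k) (\<i> * of_real y)) \<le> 2 * \<eta> / v" using v by (simp add: field_simps)
        then have "measure (M k) {x. \<bar>x\<bar> \<ge> y} \<le> 4 * \<eta> / v"
          using tail_le_cauchy_G[OF M(1)[of k], of y] y unfolding M(2) by simp
        then have "measure (M k) {x. \<bar>x\<bar> \<ge> y} < \<delta>" using \<eta> by linarith
        moreover have "1 - measure (M k) {-y<..y} = measure (M k) (UNIV - {-y<..y})"
          using Mk.prob_compl[of "{-y<..y}"] by simp
        moreover have "\<dots> \<le> measure (M k) {x. \<bar>x\<bar> \<ge> y}"
          by (intro Mk.finite_measure_mono) auto
        ultimately show ?thesis by linarith
      qed
      then show "\<exists>a b. a < b \<and> (\<forall>n. 1 - \<delta> < measure (M n) {a<..b})"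
        using y(1) by (intro exI[of _ "-y"] exI[of _ y]) auto
    qed
    then obtain r M' where r: "strict_mono (r :: nat \<Rightarrow> nat)" and M': "real_distribution M'"
      and w: "weak_conv_m (M \<circ> id \<circ> r) M'"
      using tight_imp_convergent_subsubsequence[of M id] by (auto simp: strict_mono_id)
    interpret M': real_distribution M' by fact
    define N where "N = density M' (\<lambda>_. ennreal v)"
    have N: "finite_borel_measure N" "measure N UNIV = v"
      using density_const_finite_borel_measure(1,2)[OF M'.finite_borel_measure_M, of v] v M'.prob_space by (auto simp: N_def)
    have "H z = cauchy_G N z" if z: "z \<in> UHP" for z
    proof -
      have "(\<lambda>k. cauchy_G (M (r k)) z) \<longlonglongrightarrow> cauchy_G M' z"
        unfolding cauchy_G_def
      proof (rule weak_conv_imp_integral_bdd_continuous_conv[where \<mu>="\<lambda>k. M (r k)"])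
        show "weak_conv_m (\<lambda>k. M (r k)) M'" using w by (simp add: o_def)
        show "isCont (\<lambda>x. 1 / (z - complex_of_real x)) x" for x
          using continuous_on_resolvent[OF z, of UNIV] by (simp add: continuous_on_eq_continuous_at)
        show "norm (1 / (z - complex_of_real x)) \<le> 1 / Im z" for x by (rule norm_resolvent_le[OF z])
      qed (use Mreal M' in auto)
      then have "(\<lambda>k. of_real v * cauchy_G (M (r k)) z) \<longlonglongrightarrow> of_real v * cauchy_G M' z"
        by (intro tendsto_intros)
      moreover have "(\<lambda>k. of_real v * cauchy_G (M (r k)) z) \<longlonglongrightarrow> H z"
        using LIMSEQ_subseq_LIMSEQ[OF limH[OF z] r] unfolding GM[OF z] by (simp add: o_def)
      ultimately have "H z = of_real v * cauchy_G M' z" by (rule LIMSEQ_unique[rotated])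
      also have "\<dots> = cauchy_G N z"
        using density_const_finite_borel_measure(3)[OF M'.finite_borel_measure_M, of v "\<lambda>x. 1 / (z - of_real x)"] v
        by (simp add: N_def cauchy_G_def)
      finally show ?thesis .
    qed
    then show ?thesis using N by blast
  qed
qed

end

section \<open>Reciprocal Cauchy transforms of laws with finite variance\<close>

text \<open>
  The square of the mean of \<open>1 / \<bar>z - x\<bar>\<close> is at most the mean of its square, and the latter
  is \<open>- Im G(z) / Im z\<close>.
\<close>

lemma (in real_distribution) Im_cauchy_G_le:
  assumes z: "z \<in> UHP"
  shows "Im z * (norm (cauchy_G M z))\<^sup>2 \<le> - Im (cauchy_G M z)" and "Im (cauchy_G M z) < 0"
proof -
  have y: "Im z > 0" using z by (simp add: UHP_def)
  let ?r = "\<lambda>x. norm (1 / (z - of_real x))"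
  have n2: "(?r x)\<^sup>2 = 1 / ((x - Re z)\<^sup>2 + (Im z)\<^sup>2)" for x
    by (simp add: norm_divide power_divide cmod_power2 power2_commute)
  have int1: "integrable M ?r" using integrable_resolvent[OF z] by simp
  have int2: "integrable M (\<lambda>x. (?r x)\<^sup>2)"
  proof (rule integrable_const_bound[where B="(1 / Im z)\<^sup>2"])
    show "AE x in M. norm ((?r x)\<^sup>2) \<le> (1 / Im z)\<^sup>2"
      using norm_resolvent_le[OF z] by (intro AE_I2) (simp only: real_norm_def abs_power2 power_mono norm_ge_zero)
  qed (use int1 in auto)
  have Im: "- Im (cauchy_G M z) = Im z * (\<integral>x. (?r x)\<^sup>2 \<partial>M)"
    unfolding Im_cauchy_G[OF z] n2 integral_mult_right_zero[symmetric] by simp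
  have "(norm (cauchy_G M z))\<^sup>2 \<le> (\<integral>x. ?r x \<partial>M)\<^sup>2"
    unfolding cauchy_G_def by (intro power_mono integral_norm_bound) auto
  also have "\<dots> \<le> (\<integral>x. (?r x)\<^sup>2 \<partial>M)"
    using variance_eq[OF int1 int2] variance_positive[of ?r] by linarith
  finally show "Im z * (norm (cauchy_G M z))\<^sup>2 \<le> - Im (cauchy_G M z)"
    unfolding Im using y by simp
  have "(\<integral>x. (?r x)\<^sup>2 \<partial>M) > 0"
  proof -
    have pos: "(?r x)\<^sup>2 > 0" for x using UHP_not_real[OF z, of x] by (simp add: norm_divide)
    have "(\<integral>x. (?r x)\<^sup>2 \<partial>M) \<noteq> 0"
    proof
      assume "(\<integral>x. (?r x)\<^sup>2 \<partial>M) = 0"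
      then have "AE x in M. (?r x)\<^sup>2 = 0" using int2 by (subst (asm) integral_nonneg_eq_0_iff_AE) auto
      then have "AE x in M. False" using pos by (auto elim!: eventually_mono)
      then show False by simp
    qed
    moreover have "(\<integral>x. (?r x)\<^sup>2 \<partial>M) \<ge> 0" by simp
    ultimately show ?thesis by linarith
  qed
  then have "- Im (cauchy_G M z) > 0" unfolding Im using y by simp
  then show "Im (cauchy_G M z) < 0" by simp
qed

lemma (in real_distribution) cauchy_G_nonzero: "z \<in> UHP \<Longrightarrow> cauchy_G M z \<noteq> 0"
  using Im_cauchy_G_le(2)[of z] by auto

lemma (in real_distribution) Im_cauchy_F_ge:
  assumes z: "z \<in> UHP"
  shows "Im z \<le> Im (cauchy_F M z)"
proof -
  have "Im (cauchy_F M z) = - Im (cauchy_G M z) / (norm (cauchy_G M z))\<^sup>2"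
    by (simp add: cauchy_F_def Im_divide cmod_power2)
  moreover have "Im z \<le> - Im (cauchy_G M z) / (norm (cauchy_G M z))\<^sup>2"
    using Im_cauchy_G_le(1)[OF z] cauchy_G_nonzero[OF z] by (subst le_divide_eq) auto
  ultimately show ?thesis by (simp only:)
qed

text \<open>
  With \<open>a\<close> the mean and \<open>\<eta>\<close> the Cauchy transform of
  \<open>(x - a)\<^sup>2 M(dx)\<close>, a measure of mass \<open>Var M\<close>, one has
  \<open>(z - a) G(z) = 1 + \<eta>(z) / (z - a)\<close>. Therefore
  \<open>z - a - F(z) = \<eta>(z) / (1 + \<eta>(z) / (z - a))\<close>, which inherits the
  behaviour of \<open>\<eta>\<close> at infinity.
\<close>

theorem (in real_distribution) nevanlinna_rep_cauchy_F:
  assumes sq: "integrable M (\<lambda>x. x\<^sup>2)"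
  shows "\<exists>\<rho>. nevanlinna_rep (cauchy_F M) (expectation (\<lambda>x. x)) \<rho> \<and> measure \<rho> UNIV = Var M"
proof -
  define a where "a = expectation (\<lambda>x. x)"
  have i1: "integrable M (\<lambda>x. x)" by (rule square_integrable_imp_integrable[where f="\<lambda>x. x", OF _ sq]) simp
  have isq: "integrable M (\<lambda>x. (x - a)\<^sup>2)"
  proof -
    have "integrable M (\<lambda>x. (x\<^sup>2 + a\<^sup>2) - (2 * a) * x)"
      by (rule Bochner_Integration.integrable_diff[OF Bochner_Integration.integrable_add[OF sq integrable_const]
            integrable_mult_right[OF i1]])
    then show ?thesis by (simp add: power2_diff mult.commute mult.left_commute)
  qed
  define N where "N = density M (\<lambda>x. ennreal ((x - a)\<^sup>2))"
  have emN: "emeasure N UNIV = ennreal (Var M)"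
    using isq by (simp add: N_def emeasure_density nn_integral_eq_integral Var_def a_def)
  have N: "finite_borel_measure N"
    by (intro finite_borel_measure.intro finite_measureI finite_borel_measure_axioms.intro)
       (use emN in \<open>simp_all add: N_def\<close>)
  interpret N: finite_borel_measure N by fact
  have Var0: "Var M \<ge> 0" unfolding Var_def by (rule variance_positive)
  have massN: "measure N UNIV = Var M" using emN Var0 by (simp add: measure_def)
  define \<eta> where "\<eta> = cauchy_G N"
  have za: "z - of_real a \<noteq> 0" if "z \<in> UHP" for z using UHP_not_real[OF that] .
  have intN: "\<eta> z = (\<integral>x. of_real ((x - a)\<^sup>2) * (1 / (z - of_real x)) \<partial>M)"
    and intN_integrable: "integrable M (\<lambda>x. of_real ((x - a)\<^sup>2) * (1 / (z - of_real x)))" if z: "z \<in> UHP" for z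
  proof -
    have m: "(\<lambda>x. 1 / (z - complex_of_real x)) \<in> borel_measurable M" using integrable_resolvent[OF z] by simp
    show "\<eta> z = (\<integral>x. of_real ((x - a)\<^sup>2) * (1 / (z - of_real x)) \<partial>M)"
      unfolding \<eta>_def cauchy_G_def N_def by (subst integral_density[OF m]) (auto simp: scaleR_conv_of_real)
    have "integrable N (\<lambda>x. 1 / (z - complex_of_real x))" by (rule N.integrable_resolvent[OF z])
    then show "integrable M (\<lambda>x. of_real ((x - a)\<^sup>2) * (1 / (z - of_real x)))"
      unfolding N_def by (subst (asm) integrable_density[OF m]) (auto simp: scaleR_conv_of_real)
  qed
  have key: "(z - a) * cauchy_G M z = 1 + \<eta> z / (z - a)" if z: "z \<in> UHP" for z
  proof -
    have "(z - a) * ((z - a) * cauchy_G M z) = (\<integral>x. (z - a) * ((z - a) * (1 / (z - of_real x))) \<partial>M)"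
      unfolding cauchy_G_def integral_mult_right_zero ..
    also have "\<dots> = (\<integral>x. (z - a) + (of_real (x - a) + of_real ((x - a)\<^sup>2) * (1 / (z - of_real x))) \<partial>M)"
    proof (rule Bochner_Integration.integral_cong[OF refl])
      fix x
      define w where "w = z - of_real x"
      define p where "p = complex_of_real (x - a)"
      have "w \<noteq> 0" using UHP_not_real[OF z] by (simp add: w_def)
      then have "(p + w) * ((p + w) * (1 / w)) = (p + w) + (p + p\<^sup>2 * (1 / w))"
        by (simp add: field_simps power2_eq_square)
      moreover have "z - a = p + w" by (simp add: p_def w_def)
      ultimately show "(z - a) * ((z - a) * (1 / (z - of_real x)))
         = (z - a) + (of_real (x - a) + of_real ((x - a)\<^sup>2) * (1 / (z - of_real x)))"
        by (simp only: of_real_power p_def[symmetric] w_def[symmetric])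
    qed
    also have "\<dots> = (z - a) + (of_real (expectation (\<lambda>x. x) - a) + \<eta> z)"
    proof -
      have "integrable M (\<lambda>x. complex_of_real (x - a))" using i1 by (intro integrable_of_real) auto
      moreover have "(\<integral>x. complex_of_real (x - a) \<partial>M) = of_real (expectation (\<lambda>x. x) - a)"
        using i1 prob_space by (subst integral_complex_of_real) simp
      moreover have "(\<integral>x. (z - a) + (of_real (x - a) + of_real ((x - a)\<^sup>2) * (1 / (z - of_real x))) \<partial>M)
        = (\<integral>x. z - a \<partial>M) + ((\<integral>x. of_real (x - a) \<partial>M) + (\<integral>x. of_real ((x - a)\<^sup>2) * (1 / (z - of_real x)) \<partial>M))"
        using Bochner_Integration.integral_add[OF integrable_const
            Bochner_Integration.integrable_add[OF calculation(1) intN_integrable[OF z]], of "z - a"]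
        unfolding Bochner_Integration.integral_add[OF calculation(1) intN_integrable[OF z]] .
      moreover have "(\<integral>x. z - a \<partial>M) = z - a" using prob_space by simp
      ultimately show ?thesis by (simp only: intN[OF z])
    qed
    also have "\<dots> = (z - a) * (1 + \<eta> z / (z - a))" using za[OF z] by (simp add: a_def distrib_left)
    finally show ?thesis using za[OF z] by simp
  qed
  define H where "H z = z - of_real a - cauchy_F M z" for z
  have H: "H z = \<eta> z / (1 + \<eta> z / (z - a))" if z: "z \<in> UHP" for z
  proof -
    have g: "cauchy_G M z \<noteq> 0" by (rule cauchy_G_nonzero[OF z])
    have "H z = ((z - a) * ((z - a) * cauchy_G M z) - (z - a)) / ((z - a) * cauchy_G M z)"
    proof -
      have "(z - a) * ((z - a) * cauchy_G M z) / ((z - a) * cauchy_G M z) = z - a" using g za[OF z] by simp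
      moreover have "(z - a) / ((z - a) * cauchy_G M z) = cauchy_F M z" using za[OF z] by (simp add: cauchy_F_def)
      ultimately show ?thesis by (simp only: diff_divide_distrib H_def)
    qed
    also have "(z - a) * ((z - a) * cauchy_G M z) - (z - a) = \<eta> z"
      unfolding key[OF z] distrib_left using za[OF z] by simp
    finally show ?thesis unfolding key[OF z] .
  qed
  have holH: "H holomorphic_on UHP"
    unfolding H_def cauchy_F_def using cauchy_G_nonzero
    by (intro holomorphic_intros holomorphic_cauchy_G) auto
  interpret H: decaying_nevanlinna H "Var M"
  proof
    show "H holomorphic_on UHP" by fact
    show "Im (H z) \<le> 0" if "z \<in> UHP" for z using Im_cauchy_F_ge[OF that] by (simp add: H_def)
    show "\<exists>B. \<forall>z. Im z \<ge> \<epsilon> \<longrightarrow> norm (H z) \<le> B" if \<epsilon>: "\<epsilon> > 0" for \<epsilon>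
    proof -
      define R where "R = 2 * (Var M / \<epsilon>)"
      have R0: "R \<ge> 0" using Var0 \<epsilon> by (simp add: R_def)
      have far: "norm (H z) \<le> R" if z: "Im z \<ge> \<epsilon>" "norm (z - a) > R" for z
      proof -
        have U: "z \<in> UHP" using z \<epsilon> by (simp add: UHP_def)
        have "norm (\<eta> z) \<le> Var M / Im z" unfolding \<eta>_def using N.norm_cauchy_G_le[OF U] massN by simp
        also have "\<dots> \<le> Var M / \<epsilon>" using Var0 z \<epsilon> by (intro divide_left_mono) auto
        finally have e: "norm (\<eta> z) \<le> R / 2" by (simp add: R_def)
        have "norm (\<eta> z / (z - a)) \<le> 1/2"
          unfolding norm_divide using e z R0 by (simp add: divide_le_eq)
        then have "norm (1 + \<eta> z / (z - a)) \<ge> 1 / 2"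
          using norm_triangle_ineq4[of "1 + \<eta> z / (z - a)" "\<eta> z / (z - a)"] by simp
        then have "norm (H z) \<le> (R / 2) / (1 / 2)"
          unfolding H[OF U] norm_divide using e R0 by (intro frac_le) auto
        then show ?thesis by simp
      qed
      let ?K = "cball (of_real a) R \<inter> {z. Im z \<ge> \<epsilon>}"
      have "compact ?K" by (intro compact_Int_closed compact_cball closed_halfspace_Im_ge)
      moreover have "continuous_on ?K H"
        by (rule continuous_on_subset[OF holomorphic_on_imp_continuous_on[OF holH]]) (use \<epsilon> in \<open>auto simp: UHP_def\<close>)
      ultimately have "bounded (H ` ?K)" by (intro compact_imp_bounded compact_continuous_image)
      then obtain C where C: "\<And>z. z \<in> ?K \<Longrightarrow> norm (H z) \<le> C" unfolding bounded_iff by (metis image_eqI)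
      have "norm (H z) \<le> max R C" if "Im z \<ge> \<epsilon>" for z
        using far[OF that] C[of z] that by (cases "norm (z - a) > R") (auto simp: dist_norm norm_minus_commute max_def)
      then show ?thesis by blast
    qed
    have e0: "((\<lambda>y. \<eta> (\<i> * of_real y) / (\<i> * of_real y - of_real a)) \<longlongrightarrow> 0) at_top"
    proof (rule Lim_null_comparison)
      show "((\<lambda>y. Var M / y\<^sup>2) \<longlongrightarrow> 0) at_top" by real_asymp
      show "\<forall>\<^sub>F y in at_top. norm (\<eta> (\<i> * of_real y) / (\<i> * of_real y - of_real a)) \<le> Var M / y\<^sup>2"
        using eventually_gt_at_top[of 0]
      proof eventually_elim
        case (elim y)
        then have U: "\<i> * of_real y \<in> UHP" by (simp add: UHP_def)
        have "norm (\<eta> (\<i> * of_real y)) \<le> Var M / y"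
          using N.norm_cauchy_G_le[OF U] by (simp add: \<eta>_def massN)
        moreover have "norm (\<i> * of_real y - of_real a) \<ge> y" using Im_le_norm_diff_real[of "\<i> * of_real y" a] by simp
        ultimately have "norm (\<eta> (\<i> * of_real y)) / norm (\<i> * of_real y - of_real a) \<le> (Var M / y) / y"
          using elim Var0 by (intro frac_le) auto
        then show ?case by (simp add: norm_divide power2_eq_square)
      qed
    qed
    have "((\<lambda>y. (\<i> * of_real y * \<eta> (\<i> * of_real y)) / (1 + \<eta> (\<i> * of_real y) / (\<i> * of_real y - of_real a))) \<longlongrightarrow> of_real (Var M) / (1 + 0)) at_top"
      unfolding massN[symmetric] using N.cauchy_G_asymptotic unfolding \<eta>_def[symmetric]
      by (intro tendsto_divide tendsto_add tendsto_const e0) auto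
    then have lim: "((\<lambda>y. (\<i> * of_real y * \<eta> (\<i> * of_real y)) / (1 + \<eta> (\<i> * of_real y) / (\<i> * of_real y - of_real a))) \<longlongrightarrow> of_real (Var M)) at_top"
      by simp
    show "((\<lambda>y. \<i> * of_real y * H (\<i> * of_real y)) \<longlongrightarrow> of_real (Var M)) at_top"
    proof (rule Lim_transform_eventually[OF lim])
      show "\<forall>\<^sub>F y in at_top. (\<i> * of_real y * \<eta> (\<i> * of_real y)) / (1 + \<eta> (\<i> * of_real y) / (\<i> * of_real y - of_real a))
         = \<i> * of_real y * H (\<i> * of_real y)"
        using eventually_gt_at_top[of 0] by eventually_elim (simp add: H UHP_def)
    qed
  qed
  obtain \<rho> where \<rho>: "finite_borel_measure \<rho>" "measure \<rho> UNIV = Var M" "\<And>z. z \<in> UHP \<Longrightarrow> H z = cauchy_G \<rho> z"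
    using H.representation by blast
  have "cauchy_F M z = z - of_real a + (CLINT x|\<rho>. 1 / (of_real x - z))" if z: "z \<in> UHP" for z
  proof -
    have "(CLINT x|\<rho>. 1 / (of_real x - z)) = (CLINT x|\<rho>. - (1 / (z - of_real x)))"
      by (simp add: minus_divide_right)
    also have "\<dots> = - cauchy_G \<rho> z" by (simp add: cauchy_G_def)
    finally show ?thesis using \<rho>(3)[OF z] by (simp add: H_def algebra_simps)
  qed
  then show ?thesis using \<rho>(1,2) unfolding nevanlinna_rep_def a_def by blast
qed

lemma nevanlinna_rep_cauchy_G:
  "nevanlinna_rep f a \<rho> \<longleftrightarrow> finite_borel_measure \<rho> \<and> (\<forall>z\<in>UHP. f z = z - of_real a - cauchy_G \<rho> z)"
proof -
  have "(CLINT x|\<rho>. 1 / (of_real x - z)) = - cauchy_G \<rho> z" for z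
  proof -
    have "(CLINT x|\<rho>. 1 / (of_real x - z)) = (CLINT x|\<rho>. - (1 / (z - of_real x)))"
      by (simp add: minus_divide_right)
    then show ?thesis by (simp add: cauchy_G_def)
  qed
  then show ?thesis by (simp add: nevanlinna_rep_def)
qed

text \<open>
  A representation gives \<open>f(iy) = iy - b - \<rho>(\<real>) / (iy) + \<dots>\<close>, and the coefficients of such an
  expansion are unique.
\<close>

lemma nevanlinna_rep_asymptotic:
  assumes rep: "nevanlinna_rep f b \<rho>"
    and lim: "((\<lambda>y. \<i> * of_real y * (f (\<i> * of_real y) - \<i> * of_real y + of_real a)) \<longlongrightarrow> - of_real k) at_top"
  shows "b = a" "measure \<rho> UNIV = k"
proof -
  have \<rho>: "finite_borel_measure \<rho>" and f: "\<And>z. z \<in> UHP \<Longrightarrow> f z = z - of_real b - cauchy_G \<rho> z"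
    using rep by (auto simp: nevanlinna_rep_cauchy_G)
  interpret finite_borel_measure \<rho> by fact
  have lim2: "((\<lambda>y. \<i> * of_real y * (f (\<i> * of_real y) - \<i> * of_real y + of_real b)) \<longlongrightarrow> - of_real (measure \<rho> UNIV)) at_top"
  proof (rule Lim_transform_eventually[OF tendsto_minus[OF cauchy_G_asymptotic]])
    show "\<forall>\<^sub>F y in at_top. - (\<i> * of_real y * cauchy_G \<rho> (\<i> * of_real y)) = \<i> * of_real y * (f (\<i> * of_real y) - \<i> * of_real y + of_real b)"
      using eventually_gt_at_top[of 0]
    proof eventually_elim
      case (elim y)
      then have "\<i> * of_real y \<in> UHP" by (simp add: UHP_def)
      from f[OF this] have "f (\<i> * of_real y) - \<i> * of_real y + of_real b = - cauchy_G \<rho> (\<i> * of_real y)"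
        by (simp only:) simp
      then show ?case by (simp only: mult_minus_right)
    qed
  qed
  have "((\<lambda>y::real. \<i> * of_real y * of_real (a - b)) \<longlongrightarrow> - of_real k - (- of_real (measure \<rho> UNIV))) at_top"
  proof (rule Lim_transform_eventually[OF tendsto_diff[OF lim lim2]], intro always_eventually allI)
    fix y :: real
    have "w * (u + of_real a) - w * (u + of_real b) = w * of_real (a - b)" for u w :: complex
      by (simp add: right_diff_distrib distrib_left)
    then show "\<i> * of_real y * (f (\<i> * of_real y) - \<i> * of_real y + of_real a) -
      \<i> * of_real y * (f (\<i> * of_real y) - \<i> * of_real y + of_real b) = \<i> * of_real y * of_real (a - b)" .
  qed
  from tendsto_Im[OF this] have l: "((\<lambda>y. y * (a - b)) \<longlongrightarrow> 0) at_top" by simp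
  have "((\<lambda>y. inverse y * (y * (a - b))) \<longlongrightarrow> 0 * 0) at_top"
    by (intro tendsto_mult l tendsto_inverse_0_at_top filterlim_ident)
  moreover have "\<forall>\<^sub>F y in at_top. inverse y * (y * (a - b)) = a - b"
    using eventually_gt_at_top[of 0] by eventually_elim simp
  ultimately have "((\<lambda>y::real. a - b) \<longlongrightarrow> 0 * 0) at_top" by (rule Lim_transform_eventually)
  then show ab: "b = a" by (simp add: tendsto_const_iff)
  have "- complex_of_real k = - of_real (measure \<rho> UNIV)"
    by (rule tendsto_unique[OF _ lim]) (use lim2 ab in auto)
  then show "measure \<rho> UNIV = k" by simp
qed

lemma nevanlinna_rep_unique:
  assumes "nevanlinna_rep f a \<rho>" "nevanlinna_rep f b \<sigma>"
  shows "a = b" "measure \<rho> UNIV = measure \<sigma> UNIV"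
proof -
  interpret finite_borel_measure \<sigma> using assms by (simp add: nevanlinna_rep_def)
  have "((\<lambda>y. \<i> * of_real y * (f (\<i> * of_real y) - \<i> * of_real y + of_real b)) \<longlongrightarrow> - of_real (measure \<sigma> UNIV)) at_top"
  proof (rule Lim_transform_eventually[OF tendsto_minus[OF cauchy_G_asymptotic]])
    show "\<forall>\<^sub>F y in at_top. - (\<i> * of_real y * cauchy_G \<sigma> (\<i> * of_real y)) = \<i> * of_real y * (f (\<i> * of_real y) - \<i> * of_real y + of_real b)"
      using eventually_gt_at_top[of 0]
    proof eventually_elim
      case (elim y)
      then have "\<i> * of_real y \<in> UHP" by (simp add: UHP_def)
      then have "f (\<i> * of_real y) - \<i> * of_real y + of_real b = - cauchy_G \<sigma> (\<i> * of_real y)"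
        using assms(2) unfolding nevanlinna_rep_cauchy_G by (simp only:) simp
      then show ?case by (simp only: mult_minus_right)
    qed
  qed
  from nevanlinna_rep_asymptotic[OF assms(1) this] show "a = b" "measure \<rho> UNIV = measure \<sigma> UNIV" .
qed

lemma nev_r_eq_mass:
  assumes "nevanlinna_rep f a \<rho>"
  shows "nev_r f = measure \<rho> UNIV"
proof -
  have "\<exists>\<rho> a. nevanlinna_rep f a \<rho>" using assms by blast
  then have "\<exists>a. nevanlinna_rep f a (nev_measure f)"
    unfolding nev_measure_def by (rule someI_ex)
  then obtain b where "nevanlinna_rep f b (nev_measure f)" ..
  from nevanlinna_rep_unique(2)[OF this assms] show ?thesis by (simp add: nev_r_def)
qed

lemma nev_r_eq_Var:
  assumes M: "real_distribution M" "integrable M (\<lambda>x. x\<^sup>2)" and f: "\<And>z. z \<in> UHP \<Longrightarrow> cauchy_F M z = f z"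
  shows "nev_r f = Var M"
proof -
  interpret real_distribution M by fact
  obtain \<rho> where \<rho>: "nevanlinna_rep (cauchy_F M) (expectation (\<lambda>x. x)) \<rho>" "measure \<rho> UNIV = Var M"
    using nevanlinna_rep_cauchy_F[OF M(2)] by blast
  from \<rho>(1) have "nevanlinna_rep f (expectation (\<lambda>x. x)) \<rho>" using f by (simp add: nevanlinna_rep_def)
  from nev_r_eq_mass[OF this] \<rho>(2) show ?thesis by simp
qed

lemma P2_nevanlinna_rep:
  assumes "f \<in> P2"
  shows "\<exists>a \<rho>. nevanlinna_rep f a \<rho>"
proof -
  obtain M where M: "real_distribution M" "integrable M (\<lambda>x. x\<^sup>2)" "\<And>z. z \<in> UHP \<Longrightarrow> f z = cauchy_F M z"
    using assms by (auto simp: P2_def)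
  interpret real_distribution M by fact
  obtain \<rho> where "nevanlinna_rep (cauchy_F M) (expectation (\<lambda>x. x)) \<rho>"
    using nevanlinna_rep_cauchy_F[OF M(2)] by blast
  then have "nevanlinna_rep f (expectation (\<lambda>x. x)) \<rho>" using M(3) by (simp add: nevanlinna_rep_def)
  then show ?thesis by blast
qed

lemma P2_Im_ge:
  assumes "f \<in> P2" "z \<in> UHP"
  shows "Im z \<le> Im (f z)"
  using assms real_distribution.Im_cauchy_F_ge by (auto simp: P2_def)

section \<open>Evolution families\<close>

lemma nn_integral_add_measure:
  fixes L M N :: "real measure"
  assumes [measurable_cong]: "sets L = sets borel" "sets M = sets borel" "sets N = sets borel"
    and add: "\<And>B. B \<in> sets borel \<Longrightarrow> emeasure L B = emeasure M B + emeasure N B"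
    and u: "u \<in> borel_measurable borel"
  shows "(\<integral>\<^sup>+x. u x \<partial>L) = (\<integral>\<^sup>+x. u x \<partial>M) + (\<integral>\<^sup>+x. u x \<partial>N)"
  using u
proof (induction u rule: borel_measurable_induct)
  case (cong f g)
  then have "f = g" by (simp add: fun_eq_iff)
  then show ?case using cong by simp
next
  case (set A)
  then show ?case using assms(1-3) by (simp add: add)
next
  case (mult u c)
  note [measurable] = mult(2)
  from mult show ?case by (simp add: nn_integral_cmult distrib_left)
next
  case (add u v)
  note [measurable] = add(1,4)
  from add show ?case by (simp add: nn_integral_add ac_simps)
next
  case (seq U)
  note [measurable] = seq(1)
  have inc: "incseq (\<lambda>i. \<integral>\<^sup>+x. U i x \<partial>K)" for K :: "real measure"
    using \<open>incseq U\<close> by (auto simp: incseq_def le_fun_def intro!: nn_integral_mono)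
  have "(\<integral>\<^sup>+x. (SUP i. U i) x \<partial>K) = (SUP i. \<integral>\<^sup>+x. U i x \<partial>K)" if [measurable_cong]: "sets K = sets borel" for K
    unfolding SUP_apply by (rule nn_integral_monotone_convergence_SUP) (use \<open>incseq U\<close> in auto)
  then show ?case
    using seq assms(1-3) inc by (simp add: ennreal_SUP_add)
qed

lemma integral_add_measure:
  fixes L M N :: "real measure" and \<phi> :: "real \<Rightarrow> complex"
  assumes fin: "finite_borel_measure L" "finite_borel_measure M" "finite_borel_measure N"
    and add: "\<And>B. B \<in> sets borel \<Longrightarrow> measure L B = measure M B + measure N B"
    and \<phi>: "\<phi> \<in> borel_measurable borel" "\<And>x. norm (\<phi> x) \<le> B"
  shows "integral\<^sup>L L \<phi> = integral\<^sup>L M \<phi> + integral\<^sup>L N \<phi>"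
proof -
  interpret L: finite_borel_measure L by fact
  interpret M: finite_borel_measure M by fact
  interpret N: finite_borel_measure N by fact
  note [measurable_cong] = L.M_is_borel M.M_is_borel N.M_is_borel
  note [measurable] = \<phi>(1)
  have em: "emeasure L B = emeasure M B + emeasure N B" if "B \<in> sets borel" for B
    using add[OF that] by (simp add: L.emeasure_eq_measure M.emeasure_eq_measure N.emeasure_eq_measure)
  have real: "integral\<^sup>L L \<psi> = integral\<^sup>L M \<psi> + integral\<^sup>L N \<psi>"
    if [measurable]: "\<psi> \<in> borel_measurable borel" and bd: "\<And>x. \<bar>\<psi> x\<bar> \<le> B" for \<psi> :: "real \<Rightarrow> real"
  proof -
    have nonneg: "0 \<le> \<psi> x + B" for x using bd[of x] by linarith
    have int: "integrable K \<psi>" "integrable K (\<lambda>x. \<psi> x + B)" if "finite_borel_measure K" for K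
    proof -
      interpret K: finite_borel_measure K by fact
      note [measurable_cong] = K.M_is_borel
      show "integrable K \<psi>" by (rule K.integrable_const_bound[where B=B]) (use bd in auto)
      then show "integrable K (\<lambda>x. \<psi> x + B)" by simp
    qed
    have nn: "(\<integral>\<^sup>+x. ennreal (\<psi> x + B) \<partial>K) = ennreal (integral\<^sup>L K \<psi> + B * measure K UNIV)"
      and pos: "0 \<le> integral\<^sup>L K \<psi> + B * measure K UNIV" if K: "finite_borel_measure K" for K
    proof -
      interpret K: finite_borel_measure K by fact
      have eq: "(\<integral>x. \<psi> x + B \<partial>K) = integral\<^sup>L K \<psi> + B * measure K UNIV"
        using int(1)[OF K] by (simp add: K.borel_UNIV)
      show "(\<integral>\<^sup>+x. ennreal (\<psi> x + B) \<partial>K) = ennreal (integral\<^sup>L K \<psi> + B * measure K UNIV)"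
        unfolding eq[symmetric] using int(2)[OF K] nonneg by (intro nn_integral_eq_integral) auto
      show "0 \<le> integral\<^sup>L K \<psi> + B * measure K UNIV"
        unfolding eq[symmetric] using nonneg by (intro integral_nonneg_AE) auto
    qed
    have "(\<integral>\<^sup>+x. ennreal (\<psi> x + B) \<partial>L) = (\<integral>\<^sup>+x. ennreal (\<psi> x + B) \<partial>M) + (\<integral>\<^sup>+x. ennreal (\<psi> x + B) \<partial>N)"
      by (rule nn_integral_add_measure[OF L.M_is_borel M.M_is_borel N.M_is_borel em]) auto
    then have "integral\<^sup>L L \<psi> + B * measure L UNIV =
       (integral\<^sup>L M \<psi> + B * measure M UNIV) + (integral\<^sup>L N \<psi> + B * measure N UNIV)"
      unfolding nn[OF fin(1)] nn[OF fin(2)] nn[OF fin(3)]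
      using pos[OF fin(1)] pos[OF fin(2)] pos[OF fin(3)] by (simp flip: ennreal_plus)
    then show ?thesis using add[of UNIV] by (simp add: distrib_left)
  qed
  have int: "integrable K \<phi>" if "finite_borel_measure K" for K
  proof -
    interpret K: finite_borel_measure K by fact
    note [measurable_cong] = K.M_is_borel
    show ?thesis by (rule K.integrable_const_bound[where B=B]) (use \<phi> in auto)
  qed
  have "\<bar>Re (\<phi> x)\<bar> \<le> B" "\<bar>Im (\<phi> x)\<bar> \<le> B" for x
    using abs_Re_le_cmod[of "\<phi> x"] abs_Im_le_cmod[of "\<phi> x"] \<phi>(2)[of x] by linarith+
  then have "(\<integral>x. Re (\<phi> x) \<partial>L) = (\<integral>x. Re (\<phi> x) \<partial>M) + (\<integral>x. Re (\<phi> x) \<partial>N)"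
    "(\<integral>x. Im (\<phi> x) \<partial>L) = (\<integral>x. Im (\<phi> x) \<partial>M) + (\<integral>x. Im (\<phi> x) \<partial>N)"
    by (intro real; simp)+
  then show ?thesis
    using int[OF fin(1)] int[OF fin(2)] int[OF fin(3)] by (simp add: complex_eq_iff)
qed

locale generator =
  fixes I :: "real set" and m :: "real \<Rightarrow> real" and \<kappa> :: "real \<Rightarrow> real measure"
  assumes time: "time_interval I" and gen: "reduced_generator I m \<kappa>"
begin

text \<open>
  Increments of \<open>k\<close> are the variances of both hemigroups and the Nevanlinna masses of the maps
  \<open>f (s, t)\<close>; together with \<open>m\<close> they control all moduli of continuity.
\<close>

definition k :: "real \<Rightarrow> real" where "k t = measure (\<kappa> t) UNIV"

lemma zero_in_I: "0 \<in> I" and I_nonneg: "t \<in> I \<Longrightarrow> 0 \<le> t"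
  and I_between: "s \<in> I \<Longrightarrow> t \<in> I \<Longrightarrow> s \<le> r \<Longrightarrow> r \<le> t \<Longrightarrow> r \<in> I"
  using time by (auto simp: time_interval_def)

lemma m_0: "m 0 = 0" and continuous_m: "continuous_on I m"
  and finite_\<kappa>: "t \<in> I \<Longrightarrow> finite_borel_measure (\<kappa> t)"
  and \<kappa>_0: "\<kappa> 0 = null_measure borel"
  and mono_\<kappa>: "B \<in> sets borel \<Longrightarrow> mono_on I (\<lambda>t. measure (\<kappa> t) B)"
  and continuous_\<kappa>: "B \<in> sets borel \<Longrightarrow> continuous_on I (\<lambda>t. measure (\<kappa> t) B)"
  using gen by (auto simp: reduced_generator_def)

lemma continuous_k: "continuous_on I k"
  unfolding k_def using continuous_\<kappa>[of UNIV] by simp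

lemma k_mono: "s \<in> I \<Longrightarrow> t \<in> I \<Longrightarrow> s \<le> t \<Longrightarrow> k s \<le> k t"
  unfolding k_def using mono_\<kappa>[of UNIV] by (auto simp: mono_on_def)

lemma k_nonneg: "0 \<le> k t" by (simp add: k_def)

lemma k_0: "k 0 = 0" by (simp add: k_def \<kappa>_0)

end

locale evolution_family = generator +
  fixes f :: "real \<times> real \<Rightarrow> complex \<Rightarrow> complex"
  assumes REF: "P2_REF_of I m \<kappa> f"
begin

lemma f_P2: "s \<in> I \<Longrightarrow> t \<in> I \<Longrightarrow> s \<le> t \<Longrightarrow> f (s, t) \<in> P2"
  and f_id: "s \<in> I \<Longrightarrow> z \<in> UHP \<Longrightarrow> f (s, s) z = z"
  and f_comp: "s \<in> I \<Longrightarrow> t \<in> I \<Longrightarrow> u \<in> I \<Longrightarrow> s \<le> t \<Longrightarrow> t \<le> u \<Longrightarrow> z \<in> UHP \<Longrightarrow>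
    f (s, t) (f (t, u) z) = f (s, u) z"
  using REF by (auto simp: P2_REF_of_def I2le_def)

lemma Im_f_ge: "s \<in> I \<Longrightarrow> t \<in> I \<Longrightarrow> s \<le> t \<Longrightarrow> z \<in> UHP \<Longrightarrow> Im z \<le> Im (f (s, t) z)"
  by (rule P2_Im_ge[OF f_P2])

lemma f_UHP: "s \<in> I \<Longrightarrow> t \<in> I \<Longrightarrow> s \<le> t \<Longrightarrow> z \<in> UHP \<Longrightarrow> f (s, t) z \<in> UHP"
  using Im_f_ge[of s t z] by (simp add: UHP_def)

lemma continuous_f_time:
  assumes "z \<in> UHP" "t \<in> I" "s \<in> I"
  shows "continuous_on {s..t} (\<lambda>r. f (r, t) z)"
proof -
  have "continuous_on (I2le I) (\<lambda>\<tau>. f \<tau> z)"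
    unfolding continuous_on_def
  proof
    fix \<tau> assume "\<tau> \<in> I2le I"
    then have "uniform_limit {z} f (f \<tau>) (at \<tau> within I2le I)"
      using REF assms(1) unfolding P2_REF_of_def by (meson compact_sing empty_subsetI insert_subset)
    then show "((\<lambda>\<tau>. f \<tau> z) \<longlongrightarrow> f \<tau> z) (at \<tau> within I2le I)"
      by (rule tendsto_uniform_limitI) simp
  qed
  then show ?thesis
    by (rule continuous_on_compose2)
       (use I_between[OF assms(3,2)] assms(2) in \<open>auto intro!: continuous_intros simp: I2le_def\<close>)
qed

text \<open>
  A space-time measure of the generator for which the integral equation of the evolution family holds.
\<close>

definition ST :: "(real \<times> real) measure" where
  "ST = (SOME K. space_time_measure I \<kappa> K \<and>
        (\<forall>s\<in>I. \<forall>t\<in>I. s \<le> t \<longrightarrow> (\<forall>z\<in>UHP.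
           f (s, t) z = z - of_real (m t) + of_real (m s) +
             (CLINT p:UNIV \<times> {s..t}|K. 1 / (of_real (fst p) - f (snd p, t) z)))))"

lemma ST: "space_time_measure I \<kappa> ST"
  and f_eq: "s \<in> I \<Longrightarrow> t \<in> I \<Longrightarrow> s \<le> t \<Longrightarrow> z \<in> UHP \<Longrightarrow>
    f (s, t) z = z - of_real (m t) + of_real (m s) +
      (CLINT p:UNIV \<times> {s..t}|ST. 1 / (of_real (fst p) - f (snd p, t) z))"
proof -
  have "\<exists>K. space_time_measure I \<kappa> K \<and>
        (\<forall>s\<in>I. \<forall>t\<in>I. s \<le> t \<longrightarrow> (\<forall>z\<in>UHP.
           f (s, t) z = z - of_real (m t) + of_real (m s) +
             (CLINT p:UNIV \<times> {s..t}|K. 1 / (of_real (fst p) - f (snd p, t) z))))"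
    using REF unfolding P2_REF_of_def by blast
  from someI_ex[OF this] show "space_time_measure I \<kappa> ST"
    "s \<in> I \<Longrightarrow> t \<in> I \<Longrightarrow> s \<le> t \<Longrightarrow> z \<in> UHP \<Longrightarrow>
    f (s, t) z = z - of_real (m t) + of_real (m s) +
      (CLINT p:UNIV \<times> {s..t}|ST. 1 / (of_real (fst p) - f (snd p, t) z))"
    unfolding ST_def[symmetric] by blast+
qed

lemma sets_ST: "sets ST = sets (restrict_space borel (UNIV \<times> I))"
  using ST by (simp add: space_time_measure_def)

lemma slab_sets:
  assumes "B \<in> sets borel" "J \<in> sets borel" "J \<subseteq> I"
  shows "B \<times> J \<in> sets ST"
proof -
  have "B \<times> J \<in> sets (borel \<Otimes>\<^sub>M borel)" using assms by (intro pair_measureI) auto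
  then have "B \<times> J \<in> sets borel" unfolding borel_prod .
  moreover have "B \<times> J = (UNIV \<times> I) \<inter> (B \<times> J)" using assms by auto
  ultimately show ?thesis unfolding sets_ST sets_restrict_space by blast
qed

text \<open>
  By continuity in time the measure does not charge sets of constant time, so that closed time intervals
  have the same measure as half-open ones.
\<close>

lemma emeasure_slab:
  assumes B: "B \<in> sets borel" and st: "s \<in> I" "t \<in> I" "s \<le> t"
  shows "emeasure ST (B \<times> {s..t}) = ennreal (measure (\<kappa> t) B - measure (\<kappa> s) B)"
proof -
  have incr: "emeasure ST (B \<times> {r<..u}) = ennreal (measure (\<kappa> u) B - measure (\<kappa> r) B)"
    if "r \<in> I" "u \<in> I" "r \<le> u" for r u
    using ST B that by (simp add: space_time_measure_def)
  have zero: "emeasure ST (B \<times> {s}) = 0"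
  proof (cases "s = 0")
    case True
    have "emeasure ST (B \<times> {0}) \<le> emeasure ST (UNIV \<times> {0})"
      by (intro emeasure_mono slab_sets) (auto simp: zero_in_I)
    then show ?thesis using ST True by (simp add: space_time_measure_def)
  next
    case False
    then have s: "s > 0" using I_nonneg[OF st(1)] by simp
    define r where "r n = s * (1 - 1 / real (Suc n))" for n
    have r: "0 \<le> r n" "r n < s" for n using s by (auto simp: r_def field_simps)
    then have rI: "r n \<in> I" for n using I_between[OF zero_in_I st(1)] less_imp_le by blast
    have "r \<longlonglongrightarrow> s" unfolding r_def by real_asymp
    then have "(\<lambda>n. measure (\<kappa> (r n)) B) \<longlonglongrightarrow> measure (\<kappa> s) B"
      using continuous_\<kappa>[OF B] rI st(1) unfolding continuous_on_sequentially o_def by blast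
    then have "(\<lambda>n. ennreal (measure (\<kappa> s) B - measure (\<kappa> (r n)) B)) \<longlonglongrightarrow> ennreal (measure (\<kappa> s) B - measure (\<kappa> s) B)"
      by (intro tendsto_ennrealI tendsto_intros)
    moreover have "emeasure ST (B \<times> {s}) \<le> ennreal (measure (\<kappa> s) B - measure (\<kappa> (r n)) B)" for n
    proof -
      have "emeasure ST (B \<times> {s}) \<le> emeasure ST (B \<times> {r n<..s})"
      proof (intro emeasure_mono slab_sets B)
        show "{r n<..s} \<subseteq> I" using I_between[OF rI[of n] st(1)] by auto
      qed (use r in auto)
      then show ?thesis using incr[OF rI[of n] st(1)] r(2)[of n] by simp
    qed
    ultimately have "emeasure ST (B \<times> {s}) \<le> ennreal (measure (\<kappa> s) B - measure (\<kappa> s) B)"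
      by (intro LIMSEQ_le_const) auto
    then show ?thesis by simp
  qed
  have "B \<times> {s..t} = (B \<times> {s}) \<union> (B \<times> {s<..t})" using st by auto
  moreover have "emeasure ST ((B \<times> {s}) \<union> (B \<times> {s<..t})) = emeasure ST (B \<times> {s}) + emeasure ST (B \<times> {s<..t})"
    by (rule plus_emeasure[symmetric]) (use st I_between[OF st(1,2)] in \<open>auto intro!: slab_sets B\<close>)
  ultimately show ?thesis using zero incr[OF st] by simp
qed

lemma slab_subset: "s \<in> I \<Longrightarrow> t \<in> I \<Longrightarrow> {s..t} \<subseteq> I"
  by (meson I_between atLeastAtMost_iff subsetI)

lemma slab_integrable_bound:
  fixes h :: "real \<times> real \<Rightarrow> complex"
  assumes st: "s \<in> I" "t \<in> I" "s \<le> t"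
    and c: "continuous_on (UNIV \<times> {s..t}) h" and B: "\<And>p. p \<in> UNIV \<times> {s..t} \<Longrightarrow> norm (h p) \<le> B"
  shows "set_integrable ST (UNIV \<times> {s..t}) h"
    and "norm (CLINT p:UNIV \<times> {s..t}|ST. h p) \<le> B * (k t - k s)"
proof -
  let ?A = "UNIV \<times> {s..t} :: (real \<times> real) set"
  have A: "?A \<in> sets ST" by (intro slab_sets slab_subset st) auto
  have Ab: "?A \<in> sets borel"
    by (intro borel_closed closed_Times) auto
  have em: "emeasure ST ?A = ennreal (k t - k s)" unfolding k_def by (rule emeasure_slab) (use st in auto)
  have meas: "(\<lambda>p. indicator ?A p *\<^sub>R h p) \<in> borel_measurable ST"
    using borel_measurable_continuous_on_indicator[OF Ab c]
    unfolding measurable_cong_sets[OF sets_ST refl] by (rule measurable_restrict_space1)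
  have int1: "integrable ST (\<lambda>p. B * indicator ?A p)"
    by (rule integrable_mult_right, rule integrable_real_indicator) (use A em in simp_all)
  have bd: "norm (indicator ?A p *\<^sub>R h p) \<le> B * indicator ?A p" for p
  proof (cases "p \<in> ?A")
    case True then show ?thesis using B[OF True] by (simp only: indicator_simps scaleR_one mult_1_right)
  next
    case False then show ?thesis unfolding indicator_simps(2)[OF False] by simp
  qed
  show "set_integrable ST ?A h"
    unfolding set_integrable_def
  proof (rule Bochner_Integration.integrable_bound[OF int1])
    show "AE p in ST. norm (indicator ?A p *\<^sub>R h p) \<le> norm (B * indicator ?A p)"
      by (intro AE_I2 order_trans[OF bd]) (simp only: real_norm_def abs_ge_self)
  qed (rule meas)
  then have int: "integrable ST (\<lambda>p. indicator ?A p *\<^sub>R h p)" by (simp add: set_integrable_def)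
  have "norm (CLINT p:?A|ST. h p) \<le> (LINT p|ST. norm (indicator ?A p *\<^sub>R h p))"
    unfolding set_lebesgue_integral_def by (rule integral_norm_bound)
  also have "\<dots> \<le> (LINT p|ST. B * indicator ?A p)"
    by (rule integral_mono[OF integrable_norm[OF int] int1 bd])
  also have "\<dots> = B * measure ST ?A" using A by simp
  also have "\<dots> = B * (k t - k s)" using em k_mono[OF st] by (simp add: measure_def)
  finally show "norm (CLINT p:?A|ST. h p) \<le> B * (k t - k s)" .
qed

text \<open>
  The projection of a slab to the space axis is the measure by which \<open>\<kappa> t\<close> exceeds
  \<open>\<kappa> s\<close>.
\<close>

lemma slab_integral_space:
  fixes \<phi> :: "real \<Rightarrow> complex"
  assumes st: "s \<in> I" "t \<in> I" "s \<le> t" and \<phi>: "continuous_on UNIV \<phi>" "\<And>x. norm (\<phi> x) \<le> B"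
  shows "(CLINT p:UNIV \<times> {s..t}|ST. \<phi> (fst p)) = integral\<^sup>L (\<kappa> t) \<phi> - integral\<^sup>L (\<kappa> s) \<phi>"
proof -
  let ?A = "UNIV \<times> {s..t} :: (real \<times> real) set"
  have A[measurable]: "?A \<in> sets ST" by (intro slab_sets slab_subset st) auto
  have [measurable]: "\<phi> \<in> borel_measurable borel" using \<phi>(1) by (rule borel_measurable_continuous_onI)
  have "fst \<in> borel_measurable (restrict_space borel (UNIV \<times> I))"
    by (intro measurable_restrict_space1 borel_measurable_continuous_onI continuous_intros)
  then have fst[measurable]: "fst \<in> borel_measurable ST"
    by (simp add: measurable_cong_sets[OF sets_ST refl])
  define D where "D = distr (density ST (\<lambda>p. ennreal (indicator ?A p))) borel fst"
  have fstD: "fst \<in> borel_measurable (density ST (\<lambda>p. ennreal (indicator ?A p)))" by simp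
  have space: "space ST = UNIV \<times> I" using sets_eq_imp_space_eq[OF sets_ST] by (simp add: space_restrict_space)
  have emD: "emeasure D B = ennreal (measure (\<kappa> t) B - measure (\<kappa> s) B)" if B: "B \<in> sets borel" for B
  proof -
    have Bs: "fst -` B \<inter> space ST \<in> sets ST" using fst B by (rule measurable_sets)
    have "emeasure D B = emeasure (density ST (\<lambda>p. ennreal (indicator ?A p))) (fst -` B \<inter> space ST)"
      unfolding D_def using B by (subst emeasure_distr[OF fstD]) auto
    also have "\<dots> = (\<integral>\<^sup>+p. ennreal (indicator ?A p) * indicator (fst -` B \<inter> space ST) p \<partial>ST)"
      using Bs by (subst emeasure_density) auto
    also have "\<dots> = (\<integral>\<^sup>+p. indicator (B \<times> {s..t}) p \<partial>ST)"
      using slab_subset[OF st(1,2)] unfolding space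
      by (intro nn_integral_cong) (auto simp: indicator_def)
    also have "\<dots> = emeasure ST (B \<times> {s..t})"
      by (rule nn_integral_indicator) (intro slab_sets B slab_subset st; simp)
    finally show ?thesis using emeasure_slab[OF B st] by simp
  qed
  have le: "measure (\<kappa> s) B \<le> measure (\<kappa> t) B" if "B \<in> sets borel" for B
    using mono_\<kappa>[OF that] st by (auto simp: mono_on_def)
  have D: "finite_borel_measure D"
    by (intro finite_borel_measure.intro finite_measureI finite_borel_measure_axioms.intro)
       (use emD[of UNIV] in \<open>simp_all add: D_def\<close>)
  have add: "measure (\<kappa> t) B = measure (\<kappa> s) B + measure D B" if "B \<in> sets borel" for B
    using emD[OF that] le[OF that] by (simp add: measure_def)
  have "(CLINT p:?A|ST. \<phi> (fst p)) = integral\<^sup>L (density ST (\<lambda>p. ennreal (indicator ?A p))) (\<lambda>p. \<phi> (fst p))"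
    unfolding set_lebesgue_integral_def by (subst integral_density) auto
  also have "\<dots> = integral\<^sup>L D \<phi>"
    unfolding D_def by (rule integral_distr[symmetric]) simp_all
  also have "\<dots> = integral\<^sup>L (\<kappa> t) \<phi> - integral\<^sup>L (\<kappa> s) \<phi>"
    using integral_add_measure[OF finite_\<kappa>[OF st(2)] finite_\<kappa>[OF st(1)] D add, of \<phi> B] \<phi>(2) by simp
  finally show ?thesis .
qed

end

text \<open>
  Grids are numbered downwards from \<open>t\<close>, because \<open>f (s, t)\<close> is built up by composing
  maps of earlier and earlier time intervals on the left.
\<close>

lemma fine_grid:
  assumes st: "s \<le> t" and d: "(d::real) > 0"
  obtains p :: "nat \<Rightarrow> real" and N where "p 0 = t" "p N = s" "\<And>i. i \<le> N \<Longrightarrow> p i \<in> {s..t}"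
    "\<And>i. p (Suc i) \<le> p i" "\<And>i. p i - p (Suc i) < d"
proof -
  obtain N :: nat where N: "(t - s) / d < real N" using reals_Archimedean2 by blast
  have "0 \<le> (t - s) / d" using st d by simp
  then have N0: "real N > 0" using N by linarith
  define h where "h = (t - s) / real N"
  have h: "0 \<le> h" "h < d" "real N * h = t - s"
    using st N d N0 by (auto simp: h_def field_simps)
  have "t - real i * h \<in> {s..t}" if "i \<le> N" for i
  proof -
    have "real i * h \<le> real N * h" using that h(1) by (intro mult_right_mono) auto
    then show ?thesis using h by simp
  qed
  then show thesis using h by (intro that[of "\<lambda>i. t - real i * h" N]) (auto simp: algebra_simps)
qed

context evolution_family
begin

lemma continuous_f_slab:
  assumes st: "s \<in> I" "t \<in> I" and z: "z \<in> UHP"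
  shows "continuous_on (UNIV \<times> {s..t}) (\<lambda>p::real \<times> real. f (snd p, t) z)"
  by (rule continuous_on_compose2[OF continuous_f_time[OF z st(2,1)]]) (auto intro!: continuous_intros)

lemma f_kernel_bound:
  assumes st: "s \<in> I" "t \<in> I" and z: "z \<in> UHP" and p: "p \<in> UNIV \<times> {s..t}"
  shows "f (snd p, t) z \<in> UHP" "norm (1 / (of_real (fst p) - f (snd p, t) z)) \<le> 1 / Im z"
proof -
  have r: "snd p \<in> I" "snd p \<le> t" using p I_between[OF st, of "snd p"] by auto
  show U: "f (snd p, t) z \<in> UHP" by (rule f_UHP[OF r(1) st(2) r(2) z])
  have "norm (1 / (of_real (fst p) - f (snd p, t) z)) = norm (1 / (f (snd p, t) z - of_real (fst p)))"
    by (simp add: norm_divide norm_minus_commute)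
  also have "\<dots> \<le> 1 / Im (f (snd p, t) z)" by (rule norm_resolvent_le[OF U])
  also have "\<dots> \<le> 1 / Im z"
    using Im_f_ge[OF r(1) st(2) r(2) z] z by (intro divide_left_mono mult_pos_pos) (auto simp: UHP_def)
  finally show "norm (1 / (of_real (fst p) - f (snd p, t) z)) \<le> 1 / Im z" .
qed

lemma continuous_f_kernel:
  assumes st: "s \<in> I" "t \<in> I" and z: "z \<in> UHP"
  shows "continuous_on (UNIV \<times> {s..t}) (\<lambda>p::real \<times> real. 1 / (of_real (fst p) - f (snd p, t) z))"
proof (intro continuous_on_divide continuous_on_diff continuous_f_slab[OF st z] continuous_intros ballI)
  fix p :: "real \<times> real" assume "p \<in> UNIV \<times> {s..t}"
  then show "complex_of_real (fst p) - f (snd p, t) z \<noteq> 0"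
    using UHP_not_real[OF f_kernel_bound(1)[OF st z], of p "fst p"] by simp
qed

lemma f_displacement:
  assumes st: "s \<in> I" "t \<in> I" "s \<le> t" and z: "z \<in> UHP"
  shows "norm (f (s, t) z - z + of_real (m t - m s)) \<le> (k t - k s) / Im z"
proof -
  have "f (s, t) z - z + of_real (m t - m s) = (CLINT p:UNIV \<times> {s..t}|ST. 1 / (of_real (fst p) - f (snd p, t) z))"
    by (subst f_eq[OF st z]) simp
  then show ?thesis
    using slab_integrable_bound(2)[OF st continuous_f_kernel[OF st(1,2) z] f_kernel_bound(2)[OF st(1,2) z]] by simp
qed

lemma norm_f_diff_le:
  assumes st: "s \<in> I" "t \<in> I" "s \<le> t" and z: "z \<in> UHP"
  shows "norm (f (s, t) z - z) \<le> \<bar>m t - m s\<bar> + (k t - k s) / Im z"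
  using f_displacement[OF st z] norm_triangle_ineq4[of "f (s, t) z - z + of_real (m t - m s)" "of_real (m t - m s)"]
  unfolding norm_of_real by simp

text \<open>
  Replacing \<open>f (r, t) z\<close> by \<open>z\<close> in the integral equation leaves a function of space alone,
  whose integral over the slab is an increment of Cauchy transforms.
\<close>

lemma euler_step:
  assumes st: "s \<in> I" "t \<in> I" "s \<le> t" and z: "z \<in> UHP"
    and D: "\<And>r. r \<in> {s..t} \<Longrightarrow> norm (f (r, t) z - z) \<le> D"
  shows "norm (f (s, t) z - z + of_real (m t - m s) + (cauchy_G (\<kappa> t) z - cauchy_G (\<kappa> s) z))
    \<le> D / (Im z)\<^sup>2 * (k t - k s)"
proof -
  let ?h = "\<lambda>p. 1 / (of_real (fst p) - f (snd p, t) z)" and ?g = "\<lambda>x::real. - (1 / (z - of_real x))"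
  have y: "Im z > 0" using z by (simp add: UHP_def)
  have g: "continuous_on UNIV ?g" "norm (?g x) \<le> 1 / Im z" for x
    using norm_resolvent_le[OF z, of x] by (auto intro!: continuous_on_minus continuous_on_resolvent[OF z])
  have gs: "continuous_on (UNIV \<times> {s..t}) (\<lambda>p::real \<times> real. ?g (fst p))"
    by (rule continuous_on_compose2[OF g(1)]) (auto intro!: continuous_intros)
  have h: "continuous_on (UNIV \<times> {s..t}) ?h" by (rule continuous_f_kernel[OF st(1,2) z])
  have "(CLINT p:UNIV \<times> {s..t}|ST. ?g (fst p)) = integral\<^sup>L (\<kappa> t) ?g - integral\<^sup>L (\<kappa> s) ?g"
    by (rule slab_integral_space[OF st g])
  also have "\<dots> = - (cauchy_G (\<kappa> t) z - cauchy_G (\<kappa> s) z)"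
    by (simp add: cauchy_G_def)
  finally have "f (s, t) z - z + of_real (m t - m s) + (cauchy_G (\<kappa> t) z - cauchy_G (\<kappa> s) z)
    = (CLINT p:UNIV \<times> {s..t}|ST. ?h p) - (CLINT p:UNIV \<times> {s..t}|ST. ?g (fst p))"
    by (subst f_eq[OF st z]) simp
  also have "\<dots> = (CLINT p:UNIV \<times> {s..t}|ST. ?h p - ?g (fst p))"
    by (intro set_integral_diff(2)[symmetric] slab_integrable_bound(1)[OF st h f_kernel_bound(2)[OF st(1,2) z]]
        slab_integrable_bound(1)[OF st gs g(2)])
  also have "norm \<dots> \<le> D / (Im z)\<^sup>2 * (k t - k s)"
  proof (rule slab_integrable_bound(2)[OF st continuous_on_diff[OF h gs]])
    fix p :: "real \<times> real" assume p: "p \<in> UNIV \<times> {s..t}"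
    let ?w = "f (snd p, t) z"
    have r: "snd p \<in> I" "snd p \<le> t" using p I_between[OF st(1,2), of "snd p"] by auto
    have U: "?w \<in> UHP" by (rule f_kernel_bound(1)[OF st(1,2) z p])
    have "1 / (of_real (fst p) - ?w) = - (1 / (?w - of_real (fst p)))" by (simp add: minus_divide_right)
    then have "?h p - ?g (fst p) = - (1 / (?w - of_real (fst p)) - 1 / (z - of_real (fst p)))" by simp
    then have "norm (?h p - ?g (fst p)) \<le> norm (?w - z) / (Im ?w * Im z)"
      using norm_resolvent_diff_le[OF U z, of "fst p"] by (simp only: norm_minus_cancel)
    also have "\<dots> \<le> D / (Im z * Im z)"
    proof (rule frac_le)
      show "norm (?w - z) \<le> D" using D[of "snd p"] p by auto
      then show "0 \<le> D" using norm_ge_zero order_trans by blast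
      show "0 < Im z * Im z" using y by simp
      show "Im z * Im z \<le> Im ?w * Im z"
        using Im_f_ge[OF r(1) st(2) r(2) z] y by simp
    qed
    finally show "norm (?h p - ?g (fst p)) \<le> D / (Im z)\<^sup>2" by (simp add: power2_eq_square)
  qed
  finally show ?thesis .
qed

text \<open>
  Since \<open>f (r, t) (iy)\<close> stays within a bounded distance of \<open>iy\<close>, the kernel of the integral
  equation is \<open>- 1 / (iy)\<close> to leading order.
\<close>

lemma f_asymptotic:
  assumes st: "s \<in> I" "t \<in> I" "s \<le> t"
  shows "((\<lambda>y. \<i> * of_real y * (f (s, t) (\<i> * of_real y) - \<i> * of_real y + of_real (m t - m s)))
    \<longlongrightarrow> - of_real (k t - k s)) at_top"
proof -
  let ?A = "UNIV \<times> {s..t} :: (real \<times> real) set"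
  let ?h = "\<lambda>y p. 1 / (of_real (fst p) - f (snd p, t) (\<i> * of_real y))"
  have A: "?A \<in> sets ST" by (intro slab_sets slab_subset st) auto
  have em: "emeasure ST ?A = ennreal (k t - k s)" unfolding k_def by (rule emeasure_slab) (use st in auto)
  have U: "\<i> * of_real y \<in> UHP" if "y > 0" for y :: real using that by (simp add: UHP_def)
  define F where "F y p = (if y > 0 then indicator ?A p *\<^sub>R (\<i> * of_real y * ?h y p) else 0)" for y p
  have F_pos: "F y p = indicator ?A p *\<^sub>R (\<i> * of_real y * ?h y p)" if "y > 0" for y p
    using that by (simp add: F_def)
  have lim: "((\<lambda>y. LINT p|ST. F y p) \<longlongrightarrow> (LINT p|ST. indicator ?A p *\<^sub>R (-1))) at_top"
  proof (rule integral_dominated_convergence_at_top[where w="indicator ?A"])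
    show "(\<lambda>p. indicator ?A p *\<^sub>R (-1::complex)) \<in> borel_measurable ST"
      using A by (intro borel_measurable_scaleR borel_measurable_indicator) auto
    show "integrable ST (indicator ?A :: _ \<Rightarrow> real)" by (rule integrable_real_indicator) (use A em in simp_all)
    show "\<forall>\<^sub>F y in at_top. AE p in ST. norm (F y p) \<le> indicator ?A p"
      using eventually_gt_at_top[of 0]
    proof eventually_elim
      case (elim y)
      show ?case
      proof (rule AE_I2)
        fix p show "norm (F y p) \<le> indicator ?A p"
        proof (cases "p \<in> ?A")
          case True
          have "norm (\<i> * of_real y * ?h y p) = y * norm (?h y p)" using elim by (simp add: norm_mult norm_divide)
          also have "\<dots> \<le> y * (1 / y)"
            using f_kernel_bound(2)[OF st(1,2) U[OF elim] True] elim by (intro mult_left_mono) auto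
          finally show ?thesis unfolding F_pos[OF elim] indicator_simps(1)[OF True] scaleR_one using elim by simp
        next
          case False then show ?thesis unfolding F_pos[OF elim] indicator_simps(2)[OF False] by simp
        qed
      qed
    qed
    show "AE p in ST. ((\<lambda>y. F y p) \<longlongrightarrow> indicator ?A p *\<^sub>R (-1)) at_top"
    proof (rule AE_I2)
      fix p show "((\<lambda>y. F y p) \<longlongrightarrow> indicator ?A p *\<^sub>R (-1)) at_top"
      proof (cases "p \<in> ?A")
        case True
        then have r: "snd p \<in> I" "snd p \<le> t" using I_between[OF st(1,2), of "snd p"] by auto
        define C where "C = \<bar>m t - m (snd p)\<bar> + (k t - k (snd p))"
        have kle: "k (snd p) \<le> k t" by (rule k_mono[OF r(1) st(2) r(2)])
        have "((\<lambda>y. \<i> * of_real y * ?h y p - (-1)) \<longlongrightarrow> 0) at_top"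
        proof (rule Lim_null_comparison)
          show "((\<lambda>y. (\<bar>fst p\<bar> + C) / y) \<longlongrightarrow> 0) at_top" by real_asymp
          show "\<forall>\<^sub>F y in at_top. norm (\<i> * of_real y * ?h y p - (-1)) \<le> (\<bar>fst p\<bar> + C) / y"
            using eventually_ge_at_top[of 1]
          proof eventually_elim
            case (elim y)
            then have y: "y > 0" by simp
            let ?w = "f (snd p, t) (\<i> * of_real y)"
            have w: "?w \<in> UHP" by (rule f_kernel_bound(1)[OF st(1,2) U[OF y] True])
            have nz: "of_real (fst p) - ?w \<noteq> 0" using UHP_not_real[OF w, of "fst p"] by simp
            have "norm (?w - \<i> * of_real y) \<le> \<bar>m t - m (snd p)\<bar> + (k t - k (snd p)) / y"
              using norm_f_diff_le[OF r(1) st(2) r(2) U[OF y]] by simp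
            also have "\<dots> \<le> C" unfolding C_def using kle elim by (simp add: divide_le_eq mult_le_cancel_left1)
            finally have "norm (of_real (fst p) - (?w - \<i> * of_real y)) \<le> \<bar>fst p\<bar> + C"
              using norm_triangle_ineq4[of "of_real (fst p)" "?w - \<i> * of_real y"] by simp
            moreover have "\<i> * of_real y * ?h y p - (-1) = (of_real (fst p) - (?w - \<i> * of_real y)) * ?h y p"
              using nz by (simp add: divide_simps)
            moreover have "norm (?h y p) \<le> 1 / y" using f_kernel_bound(2)[OF st(1,2) U[OF y] True] by simp
            ultimately have "norm (\<i> * of_real y * ?h y p - (-1)) \<le> (\<bar>fst p\<bar> + C) * (1 / y)"
              by (simp only: norm_mult) (intro mult_mono; simp add: order_trans[OF norm_ge_zero])
            then show ?case by simp
          qed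
        qed
        then have "((\<lambda>y. \<i> * of_real y * ?h y p) \<longlongrightarrow> -1) at_top" by (rule LIM_zero_cancel)
        then have "((\<lambda>y. F y p) \<longlongrightarrow> -1) at_top"
          by (rule Lim_transform_eventually)
             (use eventually_gt_at_top[of 0] in \<open>eventually_elim; simp only: F_pos indicator_simps(1)[OF True] scaleR_one\<close>)
        then show ?thesis unfolding indicator_simps(1)[OF True] scaleR_one .
      next
        case False
        then have "F y p = 0" for y by (cases "y > 0") (simp_all add: F_def indicator_simps(2)[OF False])
        then show ?thesis unfolding indicator_simps(2)[OF False] by simp
      qed
    qed
    show "(\<lambda>p. F y p) \<in> borel_measurable ST" for y
    proof (cases "y > 0")
      case True
      have "set_integrable ST ?A (?h y)"
        by (rule slab_integrable_bound(1)[OF st continuous_f_kernel[OF st(1,2) U[OF True]] f_kernel_bound(2)[OF st(1,2) U[OF True]]])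
      then have "(\<lambda>p. (\<i> * of_real y) * (indicator ?A p *\<^sub>R ?h y p)) \<in> borel_measurable ST"
        unfolding set_integrable_def by (intro borel_measurable_times borel_measurable_const) (rule borel_measurable_integrable)
      then show ?thesis unfolding F_pos[OF True] by (simp only: mult_scaleR_right)
    next
      case False
      then show ?thesis unfolding F_def by simp
    qed
  qed
  have "(LINT p|ST. indicator ?A p *\<^sub>R (-1::complex)) = - of_real (k t - k s)"
  proof -
    have "(LINT p|ST. indicator ?A p *\<^sub>R (-1::complex)) = measure ST ?A *\<^sub>R (-1)"
      using A em by (intro has_bochner_integral_integral_eq has_bochner_integral_indicator) simp_all
    moreover have "measure ST ?A = k t - k s" using em k_mono[OF st] by (simp add: measure_def)
    ultimately show ?thesis by (simp add: scaleR_conv_of_real)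
  qed
  note lim = lim[unfolded this]
  show ?thesis
  proof (rule Lim_transform_eventually[OF lim])
    show "\<forall>\<^sub>F y in at_top. (LINT p|ST. F y p)
        = \<i> * of_real y * (f (s, t) (\<i> * of_real y) - \<i> * of_real y + of_real (m t - m s))"
      using eventually_gt_at_top[of 0]
    proof eventually_elim
      case (elim y)
      have "f (s, t) (\<i> * of_real y) - \<i> * of_real y + of_real (m t - m s) = (CLINT p:?A|ST. ?h y p)"
        by (subst f_eq[OF st U[OF elim]]) simp
      then show ?case
        unfolding F_pos[OF elim] set_lebesgue_integral_def
        by (simp only: integral_mult_right_zero[symmetric] mult_scaleR_right)
    qed
  qed
qed

lemma f_rep:
  assumes st: "s \<in> I" "t \<in> I" "s \<le> t"
  shows "\<exists>\<rho>. nevanlinna_rep (f (s, t)) (m t - m s) \<rho> \<and> measure \<rho> UNIV = k t - k s"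
proof -
  obtain a \<rho> where "nevanlinna_rep (f (s, t)) a \<rho>" using P2_nevanlinna_rep[OF f_P2[OF st]] by blast
  from this nevanlinna_rep_asymptotic[OF this f_asymptotic[OF st]] show ?thesis by blast
qed

lemma nev_r_f:
  assumes st: "s \<in> I" "t \<in> I" "s \<le> t"
  shows "nev_r (f (s, t)) = k t - k s"
  using f_rep[OF st] nev_r_eq_mass by metis

text \<open>
  Taken from the Nevanlinna representation. The two consequences of interest are a Lipschitz bound with a
  constant close to \<open>1\<close>, and injectivity wherever the factor is below \<open>1\<close>.
\<close>

lemma f_increment:
  assumes st: "s \<in> I" "t \<in> I" "s \<le> t" and z: "z \<in> UHP" "w \<in> UHP" and y: "0 < y" "y \<le> Im z" "y \<le> Im w"
  shows "norm ((f (s, t) z - f (s, t) w) - (z - w)) \<le> (k t - k s) / y\<^sup>2 * norm (z - w)"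
proof -
  obtain \<rho> where rep: "nevanlinna_rep (f (s, t)) (m t - m s) \<rho>" and mass: "measure \<rho> UNIV = k t - k s"
    using f_rep[OF st] by blast
  interpret \<rho>: finite_borel_measure \<rho> using rep by (simp add: nevanlinna_rep_def)
  have f: "f (s, t) u = u - of_real (m t - m s) - cauchy_G \<rho> u" if "u \<in> UHP" for u
    using rep that unfolding nevanlinna_rep_cauchy_G by blast
  have "(f (s, t) z - f (s, t) w) - (z - w) = - (cauchy_G \<rho> z - cauchy_G \<rho> w)"
    unfolding f[OF z(1)] f[OF z(2)] by simp
  then have "norm ((f (s, t) z - f (s, t) w) - (z - w)) \<le> measure \<rho> UNIV * norm (z - w) / (Im z * Im w)"
    using \<rho>.norm_cauchy_G_diff_le[OF z] by (simp only: norm_minus_cancel)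
  also have "\<dots> \<le> measure \<rho> UNIV * norm (z - w) / (y * y)"
    using y by (intro divide_left_mono mult_mono) auto
  finally show ?thesis by (simp add: mass power2_eq_square)
qed

lemma f_lipschitz:
  assumes "s \<in> I" "t \<in> I" "s \<le> t" "z \<in> UHP" "w \<in> UHP" "0 < y" "y \<le> Im z" "y \<le> Im w"
  shows "norm (f (s, t) z - f (s, t) w) \<le> (1 + (k t - k s) / y\<^sup>2) * norm (z - w)"
  using f_increment[OF assms] norm_triangle_ineq[of "(f (s, t) z - f (s, t) w) - (z - w)" "z - w"]
  by (simp add: distrib_right)

text \<open>
  A time interval splits into finitely many pieces whose mass is below \<open>y\<^sup>2\<close>; on each of them the previous
  estimate separates points, and compositions of injective maps are injective.
\<close>

lemma f_injective:
  assumes st: "s \<in> I" "t \<in> I" "s \<le> t" and z: "z \<in> UHP" "w \<in> UHP" "z \<noteq> w"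
  shows "f (s, t) z \<noteq> f (s, t) w"
proof -
  define y where "y = min (Im z) (Im w)"
  have y: "0 < y" "y \<le> Im z" "y \<le> Im w" using z by (auto simp: y_def UHP_def)
  have "uniformly_continuous_on {s..t} k"
    by (intro compact_uniformly_continuous continuous_on_subset[OF continuous_k slab_subset[OF st(1,2)]]) auto
  then obtain d where d: "d > 0" "\<And>r u. r \<in> {s..t} \<Longrightarrow> u \<in> {s..t} \<Longrightarrow> dist u r < d \<Longrightarrow> dist (k u) (k r) < y\<^sup>2"
    unfolding uniformly_continuous_on_def using y(1) by (metis zero_less_power)
  obtain p N where p: "p 0 = t" "p N = s" "\<And>i. p (Suc i) \<le> p i" "\<And>i. p i - p (Suc i) < d"
    and pmem: "\<And>i. i \<le> N \<Longrightarrow> p i \<in> {s..t}"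
    using fine_grid[OF st(3) d(1)] by metis
  have "f (p i, t) z \<noteq> f (p i, t) w" if "i \<le> N" for i
    using that
  proof (induction i)
    case 0
    then show ?case using f_id[OF st(2)] z p(1) by simp
  next
    case (Suc i)
    have mem: "p i \<in> {s..t}" "p (Suc i) \<in> {s..t}" using pmem Suc.prems by auto
    then have I: "p i \<in> I" "p (Suc i) \<in> I" "p i \<le> t" using slab_subset[OF st(1,2)] by auto
    have le: "p (Suc i) \<le> p i" by (rule p(3))
    have "dist (p i) (p (Suc i)) < d"
      using p(3,4)[of i] by (simp add: dist_real_def)
    then have "dist (k (p i)) (k (p (Suc i))) < y\<^sup>2" by (rule d(2)[OF mem(2,1)])
    then have small: "(k (p i) - k (p (Suc i))) / y\<^sup>2 < 1" using y(1) by (simp add: dist_real_def)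
    let ?a = "f (p i, t) z" and ?b = "f (p i, t) w"
    have U: "?a \<in> UHP" "?b \<in> UHP" using f_UHP[OF I(1) st(2) I(3)] z by auto
    have Im: "y \<le> Im ?a" "y \<le> Im ?b"
      using Im_f_ge[OF I(1) st(2) I(3) z(1)] Im_f_ge[OF I(1) st(2) I(3) z(2)] y by auto
    have ne: "?a \<noteq> ?b" using Suc by simp
    show ?case
    proof
      assume "f (p (Suc i), t) z = f (p (Suc i), t) w"
      then have "f (p (Suc i), p i) ?a = f (p (Suc i), p i) ?b"
        using f_comp[OF I(2,1) st(2) le I(3)] z by simp
      then have "norm (?a - ?b) \<le> (k (p i) - k (p (Suc i))) / y\<^sup>2 * norm (?a - ?b)"
        using f_increment[OF I(2,1) le U y(1) Im] by (simp add: norm_minus_commute)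
      also have "\<dots> < 1 * norm (?a - ?b)" using small ne by (intro mult_strict_right_mono) auto
      finally show False by simp
    qed
  qed
  from this[of N] show ?thesis using p(2) by simp
qed

text \<open>
  \<open>f (a, b)\<close> is \<open>f (s, t)\<close> composed on either side with maps close to the identity.
\<close>

lemma f_enlarge:
  assumes I: "a \<in> I" "s \<in> I" "t \<in> I" "b \<in> I" and le: "a \<le> s" "s \<le> t" "t \<le> b" and z: "z \<in> UHP"
  shows "norm (f (a, b) z - f (s, t) z) \<le> \<bar>m s - m a\<bar> + (k s - k a) / Im z
     + (1 + (k t - k s) / (Im z)\<^sup>2) * (\<bar>m b - m t\<bar> + (k b - k t) / Im z)"
proof -
  have y: "Im z > 0" using z by (simp add: UHP_def)
  let ?u = "f (t, b) z"
  have u: "?u \<in> UHP" "Im z \<le> Im ?u" using f_UHP[OF I(3,4) le(3) z] Im_f_ge[OF I(3,4) le(3) z] by auto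
  let ?v = "f (s, t) ?u"
  have v: "?v \<in> UHP" "Im z \<le> Im ?v" using f_UHP[OF I(2,3) le(2) u(1)] Im_f_ge[OF I(2,3) le(2) u(1)] u by auto
  have ab: "f (a, b) z = f (a, s) ?v"
    using f_comp[OF I(1,2,3) le(1,2) u(1)] f_comp[OF I(1,3,4) _ le(3) z] le by simp
  have "norm (f (a, s) ?v - ?v) \<le> \<bar>m s - m a\<bar> + (k s - k a) / Im ?v"
    by (rule norm_f_diff_le[OF I(1,2) le(1) v(1)])
  also have "\<dots> \<le> \<bar>m s - m a\<bar> + (k s - k a) / Im z"
    using v(2) y k_mono[OF I(1,2) le(1)] by (intro add_left_mono divide_left_mono) auto
  finally have 1: "norm (f (a, s) ?v - ?v) \<le> \<bar>m s - m a\<bar> + (k s - k a) / Im z" .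
  have "norm (?v - f (s, t) z) \<le> (1 + (k t - k s) / (Im z)\<^sup>2) * norm (?u - z)"
    by (rule f_lipschitz[OF I(2,3) le(2) u(1) z y u(2) order_refl])
  also have "\<dots> \<le> (1 + (k t - k s) / (Im z)\<^sup>2) * (\<bar>m b - m t\<bar> + (k b - k t) / Im z)"
    using k_mono[OF I(2,3) le(2)] by (intro mult_left_mono norm_f_diff_le[OF I(3,4) le(3) z]) simp
  finally show ?thesis unfolding ab using 1 norm_triangle_ineq[of "f (a, s) ?v - ?v" "?v - f (s, t) z"] by simp
qed

end

lemma LIMSEQ_if_unique_subsequence_limit:
  fixes w :: "nat \<Rightarrow> 'a::heine_borel"
  assumes bd: "bounded (range w)"
    and uniq: "\<And>\<sigma> l. strict_mono (\<sigma> :: nat \<Rightarrow> nat) \<Longrightarrow> (\<lambda>j. w (\<sigma> j)) \<longlonglongrightarrow> l \<Longrightarrow> l = L"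
  shows "w \<longlonglongrightarrow> L"
proof (rule ccontr)
  assume "\<not> w \<longlonglongrightarrow> L"
  then obtain e where e: "e > 0" and "\<not> (\<forall>\<^sub>F n in sequentially. dist (w n) L < e)"
    by (auto simp: tendsto_iff)
  then have "\<exists>\<^sub>\<infinity>n. \<not> dist (w n) L < e" by (simp add: eventually_sequentially INFM_nat_le)
  then have "infinite {n. \<not> dist (w n) L < e}" by (simp add: INFM_iff_infinite)
  from infinite_enumerate[OF this] obtain r :: "nat \<Rightarrow> nat"
    where r: "strict_mono r" "\<And>j. \<not> dist (w (r j)) L < e" by auto
  have "bounded (range (w \<circ> r))" using bd by (rule bounded_subset) auto
  from bounded_imp_convergent_subsequence[OF this] obtain l q
    where q: "strict_mono q" "((w \<circ> r) \<circ> q) \<longlonglongrightarrow> l" by blast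
  have "l = L"
    using uniq[of "r \<circ> q" l] strict_mono_o[OF r(1) q(1)] q(2) by (simp add: o_def)
  then have "\<forall>\<^sub>F j in sequentially. dist (w (r (q j))) L < e" using tendstoD[OF q(2) e] by simp
  then show False using r(2) by (auto simp: eventually_sequentially)
qed

lemma equicontinuous_if_uniform_limit:
  fixes g :: "nat \<Rightarrow> real \<Rightarrow> real"
  assumes U: "uniform_limit {a..b} g h sequentially" and c: "continuous_on {a..b} h" and e: "e > 0"
  shows "\<exists>d>0. \<forall>\<^sub>F n in sequentially. \<forall>r\<in>{a..b}. \<forall>u\<in>{a..b}. \<bar>r - u\<bar> < d \<longrightarrow> \<bar>g n r - g n u\<bar> < e"
proof -
  have "uniformly_continuous_on {a..b} h" using c by (intro compact_uniformly_continuous) auto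
  then obtain d where d: "d > 0" "\<And>r u. r \<in> {a..b} \<Longrightarrow> u \<in> {a..b} \<Longrightarrow> dist u r < d \<Longrightarrow> dist (h u) (h r) < e/3"
    unfolding uniformly_continuous_on_def using e by (metis divide_pos_pos zero_less_numeral)
  have "\<forall>\<^sub>F n in sequentially. \<forall>r\<in>{a..b}. dist (g n r) (h r) < e/3"
    using uniform_limitD[OF U, of "e/3"] e by simp
  then have "\<forall>\<^sub>F n in sequentially. \<forall>r\<in>{a..b}. \<forall>u\<in>{a..b}. \<bar>r - u\<bar> < d \<longrightarrow> \<bar>g n r - g n u\<bar> < e"
  proof eventually_elim
    case (elim n)
    show ?case
    proof (intro ballI impI)
      fix r u assume ru: "r \<in> {a..b}" "u \<in> {a..b}" "\<bar>r - u\<bar> < d"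
      then have "\<bar>h r - h u\<bar> < e/3" using d(2)[OF ru(2,1)] by (simp add: dist_real_def)
      moreover have "\<bar>g n r - h r\<bar> < e/3" "\<bar>g n u - h u\<bar> < e/3" using elim ru by (auto simp: dist_real_def)
      ultimately show "\<bar>g n r - g n u\<bar> < e" by linarith
    qed
  qed
  then show ?thesis using d(1) by blast
qed

lemma discrete_gronwall:
  fixes D a c :: "nat \<Rightarrow> real"
  assumes "D 0 = 0" "\<And>i. i < N \<Longrightarrow> a i \<ge> 0" "\<And>i. i < N \<Longrightarrow> c i \<ge> 0"
    "\<And>i. i < N \<Longrightarrow> D (Suc i) \<le> (1 + a i) * D i + c i"
  shows "D N \<le> exp (\<Sum>i<N. a i) * (\<Sum>i<N. c i)"
  using assms
proof (induction N)
  case (Suc N)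
  let ?A = "\<Sum>i<N. a i" and ?C = "\<Sum>i<N. c i"
  have C: "?C \<ge> 0" using Suc.prems by (intro sum_nonneg) auto
  have A: "?A + a N \<ge> 0" using Suc.prems by (intro add_nonneg_nonneg sum_nonneg) auto
  have "D (Suc N) \<le> (1 + a N) * D N + c N" by (rule Suc.prems) simp
  also have "\<dots> \<le> exp (a N) * (exp ?A * ?C) + c N"
  proof (intro add_right_mono order_trans[OF mult_left_mono mult_right_mono])
    show "D N \<le> exp ?A * ?C" using Suc by simp
    show "1 + a N \<le> exp (a N)" by (rule exp_ge_add_one_self)
    show "0 \<le> exp ?A * ?C" using C by simp
    show "0 \<le> 1 + a N" using Suc.prems(2)[of N] by simp
  qed
  also have "\<dots> \<le> exp (?A + a N) * ?C + exp (?A + a N) * c N"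
  proof (intro add_mono)
    show "exp (a N) * (exp ?A * ?C) \<le> exp (?A + a N) * ?C" by (simp add: exp_add)
    show "c N \<le> exp (?A + a N) * c N"
      using Suc.prems(3)[of N] A mult_right_mono[of 1 "exp (?A + a N)" "c N"] by simp
  qed
  also have "\<dots> = exp (\<Sum>i<Suc N. a i) * (\<Sum>i<Suc N. c i)"
    by (simp add: distrib_left)
  finally show ?case .
qed simp

context evolution_family
begin

lemma norm_cauchy_G_time_diff_le:
  assumes st: "s \<in> I" "t \<in> I" "s \<le> t" and z: "z \<in> UHP"
  shows "norm (cauchy_G (\<kappa> t) z - cauchy_G (\<kappa> s) z) \<le> (k t - k s) / Im z"
proof -
  have c: "continuous_on (UNIV \<times> {s..t}) (\<lambda>p::real \<times> real. 1 / (z - of_real (fst p)))"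
    by (rule continuous_on_compose2[OF continuous_on_resolvent[OF z]]) (auto intro!: continuous_intros)
  show ?thesis
    using slab_integrable_bound(2)[OF st c norm_resolvent_le[OF z]]
    unfolding slab_integral_space[OF st continuous_on_resolvent[OF z] norm_resolvent_le[OF z]]
    by (simp add: cauchy_G_def)
qed

lemma integral_\<kappa>_time_diff_le:
  assumes st: "s \<in> I" "t \<in> I" "s \<le> t" and \<phi>: "continuous_on UNIV \<phi>" "\<And>x. \<bar>\<phi> x\<bar> \<le> B"
  shows "\<bar>integral\<^sup>L (\<kappa> t) \<phi> - integral\<^sup>L (\<kappa> s) \<phi>\<bar> \<le> B * (k t - k s)"
proof -
  have c1: "continuous_on UNIV (\<lambda>x. complex_of_real (\<phi> x))" using \<phi>(1) by (intro continuous_intros)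
  have b: "norm (complex_of_real (\<phi> x)) \<le> B" for x using \<phi>(2) by simp
  have c: "continuous_on (UNIV \<times> {s..t}) (\<lambda>p::real \<times> real. complex_of_real (\<phi> (fst p)))"
    by (rule continuous_on_compose2[OF c1]) (auto intro!: continuous_intros)
  have "norm (complex_of_real (integral\<^sup>L (\<kappa> t) \<phi>) - complex_of_real (integral\<^sup>L (\<kappa> s) \<phi>)) \<le> B * (k t - k s)"
    using slab_integrable_bound(2)[OF st c b] unfolding slab_integral_space[OF st c1 b] by simp
  then show ?thesis by (simp flip: of_real_diff)
qed

lemma continuous_integral_\<kappa>:
  assumes "bdd_cont \<phi>"
  shows "continuous_on I (\<lambda>t. integral\<^sup>L (\<kappa> t) \<phi>)"
  unfolding continuous_on_def
proof
  obtain B where B: "\<And>x. \<bar>\<phi> x\<bar> \<le> B" using assms unfolding bdd_cont_def bounded_iff by auto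
  have c: "continuous_on UNIV \<phi>" using assms by (simp add: bdd_cont_def)
  fix t assume t: "t \<in> I"
  have "((\<lambda>r. B * \<bar>k r - k t\<bar>) \<longlongrightarrow> B * \<bar>k t - k t\<bar>) (at t within I)"
    using continuous_k t by (intro tendsto_intros) (auto simp: continuous_on_def)
  then have lim: "((\<lambda>r. B * \<bar>k r - k t\<bar>) \<longlongrightarrow> 0) (at t within I)" by simp
  have "\<bar>integral\<^sup>L (\<kappa> r) \<phi> - integral\<^sup>L (\<kappa> t) \<phi>\<bar> \<le> B * \<bar>k r - k t\<bar>" if r: "r \<in> I" for r
  proof (cases "r \<le> t")
    case True
    then show ?thesis using integral_\<kappa>_time_diff_le[OF r t True c B] k_mono[OF r t True] by (simp add: abs_minus_commute)
  next
    case False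
    then have "t \<le> r" by simp
    then show ?thesis using integral_\<kappa>_time_diff_le[OF t r _ c B] k_mono[OF t r] by simp
  qed
  then have "\<forall>\<^sub>F r in at t within I. norm (integral\<^sup>L (\<kappa> r) \<phi> - integral\<^sup>L (\<kappa> t) \<phi>) \<le> B * \<bar>k r - k t\<bar>"
    unfolding eventually_at_filter by (intro always_eventually) simp
  from Lim_null_comparison[OF this lim] show "((\<lambda>r. integral\<^sup>L (\<kappa> r) \<phi>) \<longlongrightarrow> integral\<^sup>L (\<kappa> t) \<phi>) (at t within I)"
    by (rule LIM_zero_cancel)
qed

text \<open>
  The increments of the generator telescope, so that the Euler steps over a fine grid recover the generator
  from the maps over the cells of the grid.
\<close>

lemma euler_sum:
  assumes st: "s \<in> I" "t \<in> I" and z: "z \<in> UHP"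
    and p: "p 0 = t" "p N = s" "\<And>i. i \<le> N \<Longrightarrow> p i \<in> {s..t}" "\<And>i. p (Suc i) \<le> p i"
    and D: "\<And>i r. i < N \<Longrightarrow> r \<in> {p (Suc i)..p i} \<Longrightarrow> norm (f (r, p i) z - z) \<le> D"
  shows "norm ((\<Sum>i<N. f (p (Suc i), p i) z - z) + of_real (m t - m s) + (cauchy_G (\<kappa> t) z - cauchy_G (\<kappa> s) z))
    \<le> D / (Im z)\<^sup>2 * (k t - k s)"
proof -
  have pI: "p i \<in> I" if "i \<le> N" for i using p(3)[OF that] slab_subset[OF st] by blast
  have tele: "(\<Sum>i<N. g (p i) - g (p (Suc i))) = g t - g s" for g :: "real \<Rightarrow> 'c::ab_group_add"
    using sum_lessThan_telescope'[of "\<lambda>i. g (p i)" N] p(1,2) by simp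
  let ?e = "\<lambda>i. f (p (Suc i), p i) z - z + of_real (m (p i) - m (p (Suc i))) + (cauchy_G (\<kappa> (p i)) z - cauchy_G (\<kappa> (p (Suc i))) z)"
  have "(\<Sum>i<N. ?e i) = (\<Sum>i<N. f (p (Suc i), p i) z - z) + of_real (m t - m s) + (cauchy_G (\<kappa> t) z - cauchy_G (\<kappa> s) z)"
    unfolding sum.distrib tele[of "\<lambda>r. cauchy_G (\<kappa> r) z"] of_real_sum[symmetric] tele[of m] ..
  moreover have "norm (\<Sum>i<N. ?e i) \<le> (\<Sum>i<N. D / (Im z)\<^sup>2 * (k (p i) - k (p (Suc i))))"
    by (intro sum_norm_le euler_step pI p(4) z D) auto
  moreover have "(\<Sum>i<N. D / (Im z)\<^sup>2 * (k (p i) - k (p (Suc i)))) = D / (Im z)\<^sup>2 * (k t - k s)"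
    unfolding sum_distrib_left[symmetric] tele ..
  ultimately show ?thesis by simp
qed

end

section \<open>Convergence of evolution families\<close>

locale evolution_family_sequence = evolution_family I m \<kappa> f
  for I m \<kappa> f +
  fixes mn :: "nat \<Rightarrow> real \<Rightarrow> real" and \<kappa>n :: "nat \<Rightarrow> real \<Rightarrow> real measure"
    and fn :: "nat \<Rightarrow> real \<times> real \<Rightarrow> complex \<Rightarrow> complex"
  assumes seq: "\<And>n. evolution_family I (mn n) (\<kappa>n n) (fn n)"
begin

sublocale seq: evolution_family I "mn n" "\<kappa>n n" "fn n" for n
  by (rule seq)

text \<open>
  The part of the convergence that is common to all conditions.
\<close>

definition mean_mass_converge :: bool where
  "mean_mass_converge \<longleftrightarrow> loc_unif_conv I mn m \<and> loc_unif_conv I seq.k k"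

lemma mean_mass_convergeD:
  assumes "mean_mass_converge" "\<And>n. t n \<in> I" "l \<in> I" "t \<longlonglongrightarrow> l"
  shows "(\<lambda>n. mn n (t n)) \<longlonglongrightarrow> m l" "(\<lambda>n. seq.k n (t n)) \<longlonglongrightarrow> k l"
proof -
  have "loc_unif_conv I mn m" "loc_unif_conv I seq.k k" using assms(1) by (simp_all add: mean_mass_converge_def)
  from this(1)[unfolded loc_unif_conv_iff_sequential[OF continuous_m], rule_format, OF assms(2-4)]
    this(2)[unfolded loc_unif_conv_iff_sequential[OF continuous_k], rule_format, OF assms(2-4)]
  show "(\<lambda>n. mn n (t n)) \<longlonglongrightarrow> m l" "(\<lambda>n. seq.k n (t n)) \<longlonglongrightarrow> k l" .
qed

lemma mean_mass_converge_const:
  assumes "mean_mass_converge" "t \<in> I"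
  shows "(\<lambda>n. mn n t) \<longlonglongrightarrow> m t" "(\<lambda>n. seq.k n t) \<longlonglongrightarrow> k t"
  using mean_mass_convergeD[OF assms(1), of "\<lambda>_. t" t] assms(2) by auto

text \<open>
  A uniformly convergent sequence of functions on a compact interval, with continuous limit, is
  equicontinuous up to finitely many terms.
\<close>

lemma mean_mass_equicontinuous:
  assumes mk: "mean_mass_converge" and st: "s \<in> I" "t \<in> I" and e: "e > 0"
  obtains d where "d > 0" "\<forall>\<^sub>F n in sequentially. \<forall>r\<in>{s..t}. \<forall>u\<in>{s..t}. \<bar>r - u\<bar> < d \<longrightarrow>
      \<bar>mn n r - mn n u\<bar> < e \<and> \<bar>seq.k n r - seq.k n u\<bar> < e \<and> \<bar>m r - m u\<bar> < e \<and> \<bar>k r - k u\<bar> < e"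
proof -
  note sub = slab_subset[OF st]
  have U: "uniform_limit {s..t} mn m sequentially" "uniform_limit {s..t} seq.k k sequentially"
    "uniform_limit {s..t} (\<lambda>_::nat. m) m sequentially" "uniform_limit {s..t} (\<lambda>_::nat. k) k sequentially"
    using mk sub by (auto simp: mean_mass_converge_def loc_unif_conv_def uniform_limit_const)
  have c: "continuous_on {s..t} m" "continuous_on {s..t} k"
    using continuous_on_subset[OF continuous_m sub] continuous_on_subset[OF continuous_k sub] .
  obtain d1 where d1: "d1 > 0" "\<forall>\<^sub>F n in sequentially. \<forall>r\<in>{s..t}. \<forall>u\<in>{s..t}. \<bar>r - u\<bar> < d1 \<longrightarrow> \<bar>mn n r - mn n u\<bar> < e"
    using equicontinuous_if_uniform_limit[OF U(1) c(1) e] by blast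
  obtain d2 where d2: "d2 > 0" "\<forall>\<^sub>F n in sequentially. \<forall>r\<in>{s..t}. \<forall>u\<in>{s..t}. \<bar>r - u\<bar> < d2 \<longrightarrow> \<bar>seq.k n r - seq.k n u\<bar> < e"
    using equicontinuous_if_uniform_limit[OF U(2) c(2) e] by blast
  obtain d3 where d3: "d3 > 0" "\<forall>\<^sub>F n::nat in sequentially. \<forall>r\<in>{s..t}. \<forall>u\<in>{s..t}. \<bar>r - u\<bar> < d3 \<longrightarrow> \<bar>m r - m u\<bar> < e"
    using equicontinuous_if_uniform_limit[OF U(3) c(1) e] by blast
  obtain d4 where d4: "d4 > 0" "\<forall>\<^sub>F n::nat in sequentially. \<forall>r\<in>{s..t}. \<forall>u\<in>{s..t}. \<bar>r - u\<bar> < d4 \<longrightarrow> \<bar>k r - k u\<bar> < e"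
    using equicontinuous_if_uniform_limit[OF U(4) c(2) e] by blast
  show thesis
  proof (rule that[of "min (min d1 d2) (min d3 d4)"])
    show "\<forall>\<^sub>F n in sequentially. \<forall>r\<in>{s..t}. \<forall>u\<in>{s..t}. \<bar>r - u\<bar> < min (min d1 d2) (min d3 d4) \<longrightarrow>
      \<bar>mn n r - mn n u\<bar> < e \<and> \<bar>seq.k n r - seq.k n u\<bar> < e \<and> \<bar>m r - m u\<bar> < e \<and> \<bar>k r - k u\<bar> < e"
      using d1(2) d2(2) d3(2) d4(2)
    proof eventually_elim
      case (elim n)
      show ?case
      proof (intro ballI impI)
        fix r u assume r: "r \<in> {s..t}" and u: "u \<in> {s..t}" and "\<bar>r - u\<bar> < min (min d1 d2) (min d3 d4)"
        then have "\<bar>r - u\<bar> < d1" "\<bar>r - u\<bar> < d2" "\<bar>r - u\<bar> < d3" "\<bar>r - u\<bar> < d4" by simp_all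
        then show "\<bar>mn n r - mn n u\<bar> < e \<and> \<bar>seq.k n r - seq.k n u\<bar> < e \<and> \<bar>m r - m u\<bar> < e \<and> \<bar>k r - k u\<bar> < e"
          using elim[rule_format, OF r u] by simp
      qed
    qed
  qed (use d1(1) d2(1) d3(1) d4(1) in simp)
qed

text \<open>
  From pointwise convergence at fixed times and fixed \<open>z\<close> to convergence along moving times and moving
  \<open>z\<close>: all maps are equicontinuous, with moduli controlled by the generator.
\<close>

lemma f_converge_moving:
  assumes mk: "mean_mass_converge"
    and pw: "\<And>s t z. s \<in> I \<Longrightarrow> t \<in> I \<Longrightarrow> s \<le> t \<Longrightarrow> z \<in> UHP \<Longrightarrow> (\<lambda>n. fn n (s, t) z) \<longlonglongrightarrow> f (s, t) z"
    and sn: "\<And>n. sn n \<in> I" "sn \<longlonglongrightarrow> s" and tn: "\<And>n. tn n \<in> I" "tn \<longlonglongrightarrow> t" and le: "\<And>n. sn n \<le> tn n"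
    and s: "s \<in> I" and t: "t \<in> I" and st: "s \<le> t"
    and zn: "\<And>n. zn n \<in> UHP" "zn \<longlonglongrightarrow> z" and z: "z \<in> UHP"
  shows "(\<lambda>n. fn n (sn n, tn n) (zn n)) \<longlonglongrightarrow> f (s, t) z"
proof -
  define a where "a n = min s (sn n)" for n
  define b where "b n = max t (tn n)" for n
  have aI: "a n \<in> I" for n unfolding a_def min_def using s sn(1)[of n] by presburger
  have bI: "b n \<in> I" for n unfolding b_def max_def using t tn(1)[of n] by presburger
  have "a \<longlonglongrightarrow> min s s" "b \<longlonglongrightarrow> max t t" unfolding a_def b_def by (intro tendsto_min tendsto_max tendsto_const sn tn)+
  then have ab: "a \<longlonglongrightarrow> s" "b \<longlonglongrightarrow> t" by simp_all
  have le': "a n \<le> s" "a n \<le> sn n" "t \<le> b n" "tn n \<le> b n" for n by (auto simp: a_def b_def)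
  have y: "Im z > 0" using z by (simp add: UHP_def)
  have Imn: "(\<lambda>n. Im (zn n)) \<longlonglongrightarrow> Im z" using zn(2) by (rule tendsto_Im)
  define E where "E n s' t' = \<bar>mn n s' - mn n (a n)\<bar> + (seq.k n s' - seq.k n (a n)) / Im (zn n)
     + (1 + (seq.k n t' - seq.k n s') / (Im (zn n))\<^sup>2) * (\<bar>mn n (b n) - mn n t'\<bar> + (seq.k n (b n) - seq.k n t') / Im (zn n))" for n s' t'
  have E0: "(\<lambda>n. E n (s' n) (t' n)) \<longlonglongrightarrow> 0" if s': "\<And>n. s' n \<in> I" "s' \<longlonglongrightarrow> s" and t': "\<And>n. t' n \<in> I" "t' \<longlonglongrightarrow> t" for s' t'
  proof -
    note c = mean_mass_convergeD[OF mk aI s ab(1)] mean_mass_convergeD[OF mk bI t ab(2)] mean_mass_convergeD[OF mk s'(1) s s'(2)] mean_mass_convergeD[OF mk t'(1) t t'(2)]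
    have "(\<lambda>n. E n (s' n) (t' n)) \<longlonglongrightarrow> \<bar>m s - m s\<bar> + (k s - k s) / Im z + (1 + (k t - k s) / (Im z)\<^sup>2) * (\<bar>m t - m t\<bar> + (k t - k t) / Im z)"
      unfolding E_def
      by (intro tendsto_add tendsto_mult tendsto_divide tendsto_rabs tendsto_diff tendsto_power tendsto_const c Imn)
         (use y in simp_all)
    then show ?thesis by simp
  qed
  have d1: "(\<lambda>n. fn n (a n, b n) (zn n) - fn n (sn n, tn n) (zn n)) \<longlonglongrightarrow> 0"
  proof (rule Lim_null_comparison[OF always_eventually E0[OF sn tn]], rule allI)
    fix n show "norm (fn n (a n, b n) (zn n) - fn n (sn n, tn n) (zn n)) \<le> E n (sn n) (tn n)"
      unfolding E_def by (rule seq.f_enlarge[OF aI sn(1) tn(1) bI le'(2) le le'(4) zn(1)])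
  qed
  have d2: "(\<lambda>n. fn n (a n, b n) (zn n) - fn n (s, t) (zn n)) \<longlonglongrightarrow> 0"
  proof (rule Lim_null_comparison[OF always_eventually E0[of "\<lambda>_. s" "\<lambda>_. t"]], rule allI)
    fix n show "norm (fn n (a n, b n) (zn n) - fn n (s, t) (zn n)) \<le> E n s t"
      unfolding E_def by (rule seq.f_enlarge[OF aI s t bI le'(1) st le'(3) zn(1)])
  qed (use s t in simp_all)
  have d3: "(\<lambda>n. fn n (s, t) (zn n) - fn n (s, t) z) \<longlonglongrightarrow> 0"
  proof (rule Lim_null_comparison)
    show "\<forall>\<^sub>F n in sequentially. norm (fn n (s, t) (zn n) - fn n (s, t) z)
        \<le> (1 + (seq.k n t - seq.k n s) / (Im z / 2)\<^sup>2) * norm (zn n - z)"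
    proof -
      have "Im z / 2 < Im z" using y by simp
      from order_tendstoD(1)[OF Imn this] show ?thesis
      proof eventually_elim
        case (elim n)
        show ?case using y elim by (intro seq.f_lipschitz[OF s t st zn(1) z]) auto
      qed
    qed
    have "(\<lambda>n. (1 + (seq.k n t - seq.k n s) / (Im z / 2)\<^sup>2) * norm (zn n - z)) \<longlonglongrightarrow> (1 + (k t - k s) / (Im z / 2)\<^sup>2) * norm (z - z)"
      using y by (intro tendsto_intros mean_mass_converge_const[OF mk] s t zn) auto
    then show "(\<lambda>n. (1 + (seq.k n t - seq.k n s) / (Im z / 2)\<^sup>2) * norm (zn n - z)) \<longlonglongrightarrow> 0" by simp
  qed
  have "(\<lambda>n. fn n (s, t) z + (fn n (s, t) (zn n) - fn n (s, t) z) + (fn n (a n, b n) (zn n) - fn n (s, t) (zn n))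
     - (fn n (a n, b n) (zn n) - fn n (sn n, tn n) (zn n))) \<longlonglongrightarrow> f (s, t) z + 0 + 0 - 0"
    by (intro tendsto_intros pw s t st z d1 d2 d3)
  then show ?thesis by simp
qed

end

lemma (in evolution_family) continuous_f: "continuous_on (UHP \<times> I2le I) (\<lambda>(z, \<tau>). f \<tau> z)"
proof -
  interpret c: evolution_family_sequence I m \<kappa> f "\<lambda>_. m" "\<lambda>_. \<kappa>" "\<lambda>_. f"
    by unfold_locales
  have mk: "c.mean_mass_converge" unfolding c.mean_mass_converge_def loc_unif_conv_def by (simp add: uniform_limit_const)
  show ?thesis
    unfolding continuous_on_sequentially
  proof (intro allI ballI impI)
    fix x l assume l: "l \<in> UHP \<times> I2le I" and "(\<forall>n. x n \<in> UHP \<times> I2le I) \<and> x \<longlonglongrightarrow> l"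
    then have x: "\<And>n. x n \<in> UHP \<times> I2le I" and lim: "x \<longlonglongrightarrow> l" by auto
    have x': "fst (x n) \<in> UHP" "fst (snd (x n)) \<in> I" "snd (snd (x n)) \<in> I" "fst (snd (x n)) \<le> snd (snd (x n))" for n
      using x[of n] by (auto simp: I2le_def)
    have l': "fst l \<in> UHP" "fst (snd l) \<in> I" "snd (snd l) \<in> I" "fst (snd l) \<le> snd (snd l)"
      using l by (auto simp: I2le_def)
    have "(\<lambda>n. f (fst (snd (x n)), snd (snd (x n))) (fst (x n))) \<longlonglongrightarrow> f (fst (snd l), snd (snd l)) (fst l)"
      by (rule c.f_converge_moving[OF mk tendsto_const x'(2) tendsto_fst[OF tendsto_snd[OF lim]]
            x'(3) tendsto_snd[OF tendsto_snd[OF lim]] x'(4) l'(2,3,4) x'(1) tendsto_fst[OF lim] l'(1)])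
    then show "((\<lambda>(z, \<tau>). f \<tau> z) \<circ> x) \<longlonglongrightarrow> (case l of (z, \<tau>) \<Rightarrow> f \<tau> z)" by (simp add: o_def split_beta)
  qed
qed

lemma (in evolution_family) continuous_f_0: "continuous_on (UHP \<times> I) (\<lambda>(z, t). f (0, t) z)"
proof -
  have "continuous_on (UHP \<times> I) (\<lambda>x. (\<lambda>(z, \<tau>). f \<tau> z) (fst x, (0, snd x)))"
  proof (rule continuous_on_compose2[OF continuous_f])
    show "(\<lambda>x. (fst x, 0, snd x)) ` (UHP \<times> I) \<subseteq> UHP \<times> I2le I"
      using zero_in_I I_nonneg by (auto simp: I2le_def)
  qed (intro continuous_intros)
  then show ?thesis by (simp add: split_beta)
qed

context evolution_family_sequence
begin

text \<open>
  Convergence of the chain started at time \<open>0\<close> determines the limits of \<open>m\<close>: for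
  \<open>z = iy\<close> and \<open>y\<close> large, \<open>f (0, t) z - z\<close> is close to
  \<open>- m t\<close>, uniformly in \<open>n\<close>.
\<close>

lemma mean_mass_converge_if_f_0_converge:
  assumes f: "\<And>t l z. (\<And>n. t n \<in> I) \<Longrightarrow> l \<in> I \<Longrightarrow> t \<longlonglongrightarrow> l \<Longrightarrow> z \<in> UHP \<Longrightarrow> (\<lambda>n. fn n (0, t n) z) \<longlonglongrightarrow> f (0, l) z"
    and kc: "loc_unif_conv I seq.k k"
  shows "mean_mass_converge"
  unfolding mean_mass_converge_def
proof (intro conjI kc)
  have k: "(\<lambda>n. seq.k n (t n)) \<longlonglongrightarrow> k l" if "\<And>n. t n \<in> I" "l \<in> I" "t \<longlonglongrightarrow> l" for t l
    by (rule kc[unfolded loc_unif_conv_iff_sequential[OF continuous_k], rule_format, OF that])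
  have "(\<lambda>n. mn n (t n)) \<longlonglongrightarrow> m l" if t: "\<And>n. t n \<in> I" "l \<in> I" "t \<longlonglongrightarrow> l" for t l
  proof (rule LIMSEQ_I)
    fix e :: real assume e: "e > 0"
    \<comment> \<open>both displacement errors at \<open>iy\<close> together are then below \<open>e / 2\<close>\<close>
    define y where "y = 2 * (2 * k l + 1) / e"
    have kl: "2 * k l + 1 > 0" using k_nonneg[of l] by linarith
    then have y: "y > 0" using e by (simp add: y_def)
    have "c / (2 * c / e) = e / 2" if "c > 0" for c using e that by simp
    from this[OF kl] have ye: "(2 * k l + 1) / y = e / 2" unfolding y_def .
    have U: "\<i> * of_real y \<in> UHP" using y by (simp add: UHP_def)
    have "\<forall>\<^sub>F n in sequentially. dist (fn n (0, t n) (\<i> * of_real y)) (f (0, l) (\<i> * of_real y)) < e / 2"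
      using tendstoD[OF f[OF t U], of "e/2"] e by simp
    moreover have "\<forall>\<^sub>F n in sequentially. seq.k n (t n) < k l + 1"
      by (rule order_tendstoD(2)[OF k[OF t]]) simp
    ultimately have "\<forall>\<^sub>F n in sequentially. norm (mn n (t n) - m l) < e"
    proof eventually_elim
      case (elim n)
      let ?z = "\<i> * of_real y"
      define A where "A = fn n (0, t n) ?z - ?z + of_real (mn n (t n))"
      define B where "B = f (0, l) ?z - ?z + of_real (m l)"
      define C where "C = fn n (0, t n) ?z - f (0, l) ?z"
      have "norm A \<le> seq.k n (t n) / y"
        unfolding A_def using seq.f_displacement[OF zero_in_I t(1) I_nonneg[OF t(1)] U, of n] by (simp add: seq.m_0 seq.k_0)
      moreover have "norm B \<le> k l / y"
        unfolding B_def using f_displacement[OF zero_in_I t(2) I_nonneg[OF t(2)] U] by (simp add: m_0 k_0)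
      moreover have "complex_of_real (mn n (t n) - m l) = A - B - C" by (simp add: A_def B_def C_def)
      then have "\<bar>mn n (t n) - m l\<bar> = norm (A - B - C)" by (metis norm_of_real)
      moreover have "norm (A - B - C) \<le> norm A + norm B + norm C"
        using norm_triangle_ineq4[of "A - B" C] norm_triangle_ineq4[of A B] by linarith
      ultimately have "\<bar>mn n (t n) - m l\<bar> \<le> seq.k n (t n) / y + k l / y + norm (fn n (0, t n) ?z - f (0, l) ?z)"
        unfolding C_def by linarith
      moreover have "seq.k n (t n) / y + k l / y < (2 * k l + 1) / y"
        using elim y unfolding add_divide_distrib[symmetric] by (intro divide_strict_right_mono) auto
      ultimately show ?case using elim(1) ye unfolding dist_norm real_norm_def by linarith
    qed
    then show "\<exists>no. \<forall>n\<ge>no. norm (mn n (t n) - m l) < e" by (simp add: eventually_sequentially)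
  qed
  then show "loc_unif_conv I mn m" unfolding loc_unif_conv_iff_sequential[OF continuous_m] by simp
qed

end

lemma loc_unif_conv_cong:
  assumes "\<And>n x. x \<in> D \<Longrightarrow> g n x = g' n x" "\<And>x. x \<in> D \<Longrightarrow> h x = h' x"
  shows "loc_unif_conv D g h \<longleftrightarrow> loc_unif_conv D g' h'"
proof -
  have "uniform_limit C g h sequentially \<longleftrightarrow> uniform_limit C g' h' sequentially" if "C \<subseteq> D" for C
    by (rule uniform_limit_cong') (use assms that in auto)
  then show ?thesis unfolding loc_unif_conv_def by blast
qed

lemma complex_integral_converges_if_weak:
  fixes M :: "nat \<Rightarrow> real measure" and \<psi> :: "real \<Rightarrow> complex"
  assumes fin: "\<And>n. finite_borel_measure (M n)" "finite_borel_measure N"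
    and weak: "\<And>\<phi>. bdd_cont \<phi> \<Longrightarrow> (\<lambda>n. integral\<^sup>L (M n) \<phi>) \<longlonglongrightarrow> integral\<^sup>L N \<phi>"
    and \<psi>: "continuous_on UNIV \<psi>" "\<And>x. norm (\<psi> x) \<le> B"
  shows "(\<lambda>n. integral\<^sup>L (M n) \<psi>) \<longlonglongrightarrow> integral\<^sup>L N \<psi>"
proof -
  have "\<bar>Re (\<psi> x)\<bar> \<le> B" "\<bar>Im (\<psi> x)\<bar> \<le> B" for x
    using abs_Re_le_cmod[of "\<psi> x"] abs_Im_le_cmod[of "\<psi> x"] \<psi>(2)[of x] by linarith+
  then have "bounded (range (\<lambda>x. Re (\<psi> x)))" "bounded (range (\<lambda>x. Im (\<psi> x)))"
    unfolding bounded_iff real_norm_def by auto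
  then have b: "bdd_cont (\<lambda>x. Re (\<psi> x))" "bdd_cont (\<lambda>x. Im (\<psi> x))"
    unfolding bdd_cont_def using \<psi>(1) by (auto intro!: continuous_intros)
  have int: "integrable (M n) \<psi>" "integrable N \<psi>" for n
    using finite_borel_measure.integrable_bounded_continuous[OF fin(1) \<psi>]
      finite_borel_measure.integrable_bounded_continuous[OF fin(2) \<psi>] by auto
  have "(\<lambda>n. Complex (\<integral>x. Re (\<psi> x) \<partial>(M n)) (\<integral>x. Im (\<psi> x) \<partial>(M n))) \<longlonglongrightarrow> Complex (\<integral>x. Re (\<psi> x) \<partial>N) (\<integral>x. Im (\<psi> x) \<partial>N)"
    by (intro tendsto_Complex weak b)
  then show ?thesis using int by simp
qed

lemma cauchy_G_converges_if_weak:
  assumes fin: "\<And>n. finite_borel_measure (M n)" "finite_borel_measure N"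
    and weak: "\<And>\<phi>. bdd_cont \<phi> \<Longrightarrow> (\<lambda>n. integral\<^sup>L (M n) \<phi>) \<longlonglongrightarrow> integral\<^sup>L N \<phi>"
    and z: "z \<in> UHP"
  shows "(\<lambda>n. cauchy_G (M n) z) \<longlonglongrightarrow> cauchy_G N z"
  unfolding cauchy_G_def
  by (rule complex_integral_converges_if_weak[OF fin weak continuous_on_resolvent[OF z] norm_resolvent_le[OF z]])

lemma (in generator) cauchy_G_\<kappa>_0: "cauchy_G (\<kappa> 0) z = 0"
  by (simp add: cauchy_G_def \<kappa>_0 integral_null_measure)

context evolution_family_sequence
begin

text \<open>
  Convergence of maps and of generators at fixed times, the latter tested by Cauchy transforms.
\<close>

definition f_converge :: bool where
  "f_converge \<longleftrightarrow> (\<forall>s\<in>I. \<forall>t\<in>I. s \<le> t \<longrightarrow> (\<forall>z\<in>UHP. (\<lambda>n. fn n (s, t) z) \<longlonglongrightarrow> f (s, t) z))"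

definition \<kappa>_converge :: bool where
  "\<kappa>_converge \<longleftrightarrow> (\<forall>t\<in>I. \<forall>z\<in>UHP. (\<lambda>n. cauchy_G (\<kappa>n n t) z) \<longlonglongrightarrow> cauchy_G (\<kappa> t) z)"

lemma f_convergeD:
  assumes "f_converge" "s \<in> I" "t \<in> I" "s \<le> t" "z \<in> UHP"
  shows "(\<lambda>n. fn n (s, t) z) \<longlonglongrightarrow> f (s, t) z"
  using assms by (simp add: f_converge_def)

text \<open>
  By equicontinuity of \<open>m\<close> and \<open>k\<close> a grid can be so fine that, uniformly in
  \<open>n\<close>, no point at height at least \<open>y\<close> moves by more than \<open>D\<close> over one of its
  cells.
\<close>

lemma uniformly_fine_grid:
  assumes mk: "mean_mass_converge" and st: "s \<in> I" "t \<in> I" "s \<le> t" and y: "y > 0" and D: "D > 0"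
  obtains p :: "nat \<Rightarrow> real" and N where "p 0 = t" "p N = s" "\<And>i. i \<le> N \<Longrightarrow> p i \<in> {s..t}" "\<And>i. p (Suc i) \<le> p i"
    and "\<forall>\<^sub>F n in sequentially. \<forall>i<N. \<forall>r\<in>{p (Suc i)..p i}. \<forall>z. y \<le> Im z \<longrightarrow>
      norm (fn n (r, p i) z - z) \<le> D \<and> norm (f (r, p i) z - z) \<le> D"
proof -
  define e where "e = D / (1 + 1 / y)"
  have "1 + 1 / y > 0" using y by (simp add: add_pos_pos)
  then have "e > 0" "e * (1 + 1 / y) = D" using D by (simp_all add: e_def)
  then have e: "e > 0" "e + e / y = D" by (simp_all add: distrib_left)
  obtain d where d: "d > 0" and ev: "\<forall>\<^sub>F n in sequentially. \<forall>r\<in>{s..t}. \<forall>u\<in>{s..t}. \<bar>r - u\<bar> < d \<longrightarrow>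
      \<bar>mn n r - mn n u\<bar> < e \<and> \<bar>seq.k n r - seq.k n u\<bar> < e \<and> \<bar>m r - m u\<bar> < e \<and> \<bar>k r - k u\<bar> < e"
    by (rule mean_mass_equicontinuous[OF mk st(1,2) e(1)])
  obtain p N where p: "p 0 = t" "p N = s" "\<And>i. i \<le> N \<Longrightarrow> p i \<in> {s..t}" "\<And>i. p (Suc i) \<le> p i" "\<And>i. p i - p (Suc i) < d"
    by (rule fine_grid[OF st(3) d(1)]) (rule that)
  show thesis
  proof (rule that[OF p(1-4)])
    show "\<forall>\<^sub>F n in sequentially. \<forall>i<N. \<forall>r\<in>{p (Suc i)..p i}. \<forall>z. y \<le> Im z \<longrightarrow>
      norm (fn n (r, p i) z - z) \<le> D \<and> norm (f (r, p i) z - z) \<le> D"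
      using ev
    proof eventually_elim
      case (elim n)
      show ?case
      proof (intro allI impI ballI)
        fix i r z assume i: "i < N" and r: "r \<in> {p (Suc i)..p i}" and z: "y \<le> Im z"
        have U: "z \<in> UHP" using z y by (simp add: UHP_def)
        have mem: "p i \<in> {s..t}" "p (Suc i) \<in> {s..t}" using p(3) i by (simp_all del: atLeastAtMost_iff)
        then have rmem: "r \<in> {s..t}" using r by simp
        have rI: "r \<in> I" "p i \<in> I" "r \<le> p i" using rmem mem(1) r slab_subset[OF st(1,2)] by auto
        have "\<bar>r - p i\<bar> < d" using r p(5)[of i] by simp
        from elim[rule_format, OF rmem mem(1) this]
        have b: "\<bar>mn n (p i) - mn n r\<bar> \<le> e" "seq.k n (p i) - seq.k n r \<le> e" "\<bar>m (p i) - m r\<bar> \<le> e" "k (p i) - k r \<le> e"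
          by linarith+
        have "(k (p i) - k r) / Im z \<le> e / y" "(seq.k n (p i) - seq.k n r) / Im z \<le> e / y"
          using b z y e(1) k_mono[OF rI] seq.k_mono[OF rI, of n] by (auto intro!: frac_le)
        then show "norm (fn n (r, p i) z - z) \<le> D \<and> norm (f (r, p i) z - z) \<le> D"
          using norm_f_diff_le[OF rI U] seq.norm_f_diff_le[OF rI U, of n] b e(2) by linarith
      qed
    qed
  qed
qed

text \<open>
  By summation of Euler steps from time \<open>0\<close>, the Cauchy transforms are sums of finitely many
  displacements up to an error that is small uniformly in \<open>n\<close>.
\<close>

lemma \<kappa>_converge_if_f_converge:
  assumes mk: "mean_mass_converge" and fc: "f_converge"
  shows "\<kappa>_converge"
  unfolding \<kappa>_converge_def
proof (intro ballI LIMSEQ_I)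
  fix t z and \<epsilon> :: real assume t: "t \<in> I" and z: "z \<in> UHP" and \<epsilon>: "\<epsilon> > 0"
  define y where "y = Im z"
  have y: "y > 0" using z by (simp add: y_def UHP_def)
  \<comment> \<open>\<open>D * c\<close> bounds the errors of both Euler sums, once \<open>k\<close> at time \<open>t\<close> has converged up to \<open>1\<close>\<close>
  define c where "c = (2 * k t + 1) / y\<^sup>2"
  have c: "c > 0" using y k_nonneg[of t] by (simp add: c_def)
  define D where "D = \<epsilon> / (4 * c)"
  have D: "D > 0" "D * c = \<epsilon> / 4" using \<epsilon> c by (auto simp: D_def)
  note t0 = I_nonneg[OF t]
  obtain p N where p: "p 0 = t" "p N = 0" "\<And>i. i \<le> N \<Longrightarrow> p i \<in> {0..t}" "\<And>i. p (Suc i) \<le> p i"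
    and ev: "\<forall>\<^sub>F n in sequentially. \<forall>i<N. \<forall>r\<in>{p (Suc i)..p i}. \<forall>z. y \<le> Im z \<longrightarrow>
      norm (fn n (r, p i) z - z) \<le> D \<and> norm (f (r, p i) z - z) \<le> D"
    by (rule uniformly_fine_grid[OF mk zero_in_I t t0 y D(1)]) (rule that)
  have pI: "p i \<in> I" if "i \<le> N" for i by (rule subsetD[OF slab_subset[OF zero_in_I t] p(3)[OF that]])
  let ?Sn = "\<lambda>n. \<Sum>i<N. fn n (p (Suc i), p i) z - z" and ?S = "\<Sum>i<N. f (p (Suc i), p i) z - z"
  have "?Sn \<longlonglongrightarrow> ?S"
    by (intro tendsto_sum tendsto_diff tendsto_const f_convergeD[OF fc _ _ p(4) z] pI) auto
  then have "\<forall>\<^sub>F n in sequentially. dist (?Sn n) ?S < \<epsilon>/4" using \<epsilon> by (intro tendstoD) auto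
  moreover have "\<forall>\<^sub>F n in sequentially. dist (mn n t) (m t) < \<epsilon>/4"
    using \<epsilon> by (intro tendstoD mean_mass_converge_const[OF mk t]) auto
  moreover have "\<forall>\<^sub>F n in sequentially. seq.k n t < k t + 1"
    by (rule order_tendstoD(2)[OF mean_mass_converge_const(2)[OF mk t]]) simp
  ultimately have "\<forall>\<^sub>F n in sequentially. norm (cauchy_G (\<kappa>n n t) z - cauchy_G (\<kappa> t) z) < \<epsilon>"
    using ev
  proof eventually_elim
    case (elim n)
    have "norm (?Sn n + of_real (mn n t - mn n 0) + (cauchy_G (\<kappa>n n t) z - cauchy_G (\<kappa>n n 0) z)) \<le> D / (Im z)\<^sup>2 * (seq.k n t - seq.k n 0)"
      by (rule seq.euler_sum[OF zero_in_I t z p elim(4)[rule_format, THEN conjunct1]]) (simp_all only: y_def order_refl)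
    then have 1: "norm (?Sn n + of_real (mn n t) + cauchy_G (\<kappa>n n t) z) \<le> D / y\<^sup>2 * seq.k n t"
      by (simp add: seq.m_0 seq.k_0 seq.cauchy_G_\<kappa>_0 y_def)
    have "norm (?S + of_real (m t - m 0) + (cauchy_G (\<kappa> t) z - cauchy_G (\<kappa> 0) z)) \<le> D / (Im z)\<^sup>2 * (k t - k 0)"
      by (rule euler_sum[OF zero_in_I t z p elim(4)[rule_format, THEN conjunct2]]) (simp_all only: y_def order_refl)
    then have 2: "norm (?S + of_real (m t) + cauchy_G (\<kappa> t) z) \<le> D / y\<^sup>2 * k t"
      by (simp add: m_0 k_0 cauchy_G_\<kappa>_0 y_def)
    define A where "A = ?Sn n + of_real (mn n t) + cauchy_G (\<kappa>n n t) z"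
    define B where "B = ?S + of_real (m t) + cauchy_G (\<kappa> t) z"
    have "D / y\<^sup>2 * seq.k n t + D / y\<^sup>2 * k t = D / y\<^sup>2 * (seq.k n t + k t)" by (simp add: distrib_left)
    also have "\<dots> \<le> D / y\<^sup>2 * (2 * k t + 1)" using elim(3) D(1) by (intro mult_left_mono) auto
    also have "\<dots> = D * c" by (simp add: c_def)
    finally have AB: "norm A + norm B \<le> \<epsilon> / 4" using 1 2 D(2) unfolding A_def[symmetric] B_def[symmetric] by linarith
    have "cauchy_G (\<kappa>n n t) z - cauchy_G (\<kappa> t) z = (A - B) - ((?Sn n - ?S) + of_real (mn n t - m t))"
      by (simp add: A_def B_def)
    then have "norm (cauchy_G (\<kappa>n n t) z - cauchy_G (\<kappa> t) z) = norm ((A - B) - ((?Sn n - ?S) + of_real (mn n t - m t)))"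
      by (rule arg_cong)
    also have "\<dots> \<le> norm A + norm B + (norm (?Sn n - ?S) + norm (complex_of_real (mn n t - m t)))"
      by (intro order_trans[OF norm_triangle_ineq4] add_mono norm_triangle_ineq norm_triangle_ineq4)
    also have "\<dots> < \<epsilon>"
      using AB elim(1,2) \<epsilon> unfolding dist_norm norm_of_real real_norm_def by linarith
    finally show ?case .
  qed
  then show "\<exists>no. \<forall>n\<ge>no. norm (cauchy_G (\<kappa>n n t) z - cauchy_G (\<kappa> t) z) < \<epsilon>"
    by (simp add: eventually_sequentially)
qed

text \<open>
  Conversely the Euler steps converge if the generator does. Errors accumulate along the grid
  as in Gronwall's inequality, the maps being Lipschitz with constants controlled by the mass increments.
\<close>

lemma f_converge_if_\<kappa>_converge:
  assumes mk: "mean_mass_converge" and \<kappa>c: "\<kappa>_converge"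
  shows "f_converge"
  unfolding f_converge_def
proof (intro ballI impI LIMSEQ_I)
  fix s t z and \<epsilon> :: real
  assume st: "s \<in> I" "t \<in> I" "s \<le> t" and z: "z \<in> UHP" and \<epsilon>: "\<epsilon> > 0"
  define y where "y = Im z"
  have y: "y > 0" using z by (simp add: y_def UHP_def)
  define K where "K = k t - k s"
  have K: "K \<ge> 0" using k_mono[OF st] by (simp add: K_def)
  \<comment> \<open>\<open>D * c\<close> bounds the limit of the accumulated errors of all Euler steps\<close>
  define c where "c = exp (K / y\<^sup>2) * ((2 * K + 1) / y\<^sup>2)"
  have c: "c > 0" using y K by (simp add: c_def)
  define D where "D = \<epsilon> / (2 * c)"
  have D: "D > 0" "D * c = \<epsilon> / 2" using \<epsilon> c by (auto simp: D_def)
  obtain p N where p: "p 0 = t" "p N = s" "\<And>i. i \<le> N \<Longrightarrow> p i \<in> {s..t}" "\<And>i. p (Suc i) \<le> p i"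
    and ev: "\<forall>\<^sub>F n in sequentially. \<forall>i<N. \<forall>r\<in>{p (Suc i)..p i}. \<forall>z. y \<le> Im z \<longrightarrow>
      norm (fn n (r, p i) z - z) \<le> D \<and> norm (f (r, p i) z - z) \<le> D"
    by (rule uniformly_fine_grid[OF mk st y D(1)]) (rule that)
  have pI: "p i \<in> I" "p i \<le> t" if "i \<le> N" for i
    using subsetD[OF slab_subset[OF st(1,2)] p(3)[OF that]] p(3)[OF that] by simp_all
  define g where "g i = f (p i, t) z" for i
  have gU: "g i \<in> UHP" "y \<le> Im (g i)" if "i \<le> N" for i
    unfolding g_def y_def by (rule f_UHP[OF pI(1)[OF that] st(2) pI(2)[OF that] z], rule Im_f_ge[OF pI(1)[OF that] st(2) pI(2)[OF that] z])
  define E where "E n i = norm ((of_real (mn n (p i) - mn n (p (Suc i))) + (cauchy_G (\<kappa>n n (p i)) (g i) - cauchy_G (\<kappa>n n (p (Suc i))) (g i)))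
     - (of_real (m (p i) - m (p (Suc i))) + (cauchy_G (\<kappa> (p i)) (g i) - cauchy_G (\<kappa> (p (Suc i))) (g i))))" for n i
  have E0: "(\<lambda>n. E n i) \<longlonglongrightarrow> 0" if "i < N" for i
  proof -
    have i: "i \<le> N" "Suc i \<le> N" using that by auto
    have G: "(\<lambda>n. cauchy_G (\<kappa>n n u) (g i)) \<longlonglongrightarrow> cauchy_G (\<kappa> u) (g i)" if "u \<in> I" for u
      using \<kappa>c that gU(1)[OF i(1)] by (simp add: \<kappa>_converge_def)
    have "(\<lambda>n. E n i) \<longlonglongrightarrow> norm ((of_real (m (p i) - m (p (Suc i))) + (cauchy_G (\<kappa> (p i)) (g i) - cauchy_G (\<kappa> (p (Suc i))) (g i)))
     - (of_real (m (p i) - m (p (Suc i))) + (cauchy_G (\<kappa> (p i)) (g i) - cauchy_G (\<kappa> (p (Suc i))) (g i))))"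
      unfolding E_def
      by (intro tendsto_norm tendsto_diff tendsto_add tendsto_of_real tendsto_const G mean_mass_converge_const(1)[OF mk] pI i)
    then show ?thesis by simp
  qed
  define bound where "bound n = exp ((seq.k n t - seq.k n s) / y\<^sup>2) * (D / y\<^sup>2 * ((seq.k n t - seq.k n s) + (k t - k s)) + (\<Sum>i<N. E n i))" for n
  have bound_lim: "bound \<longlonglongrightarrow> exp (K / y\<^sup>2) * (D / y\<^sup>2 * (K + K) + (\<Sum>i<N. 0))"
    unfolding bound_def K_def
    by (intro tendsto_intros tendsto_sum E0 mean_mass_converge_const(2)[OF mk] st) (use y in auto)
  have "exp (K / y\<^sup>2) * (D / y\<^sup>2 * (K + K) + (\<Sum>i<N. 0)) < \<epsilon>"
  proof -
    have "exp (K / y\<^sup>2) * (D / y\<^sup>2 * (K + K)) \<le> exp (K / y\<^sup>2) * (D / y\<^sup>2 * (2 * K + 1))"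
      using D(1) K by (intro mult_left_mono) auto
    also have "\<dots> = D * c" by (simp add: c_def)
    finally show ?thesis using D(2) \<epsilon> by simp
  qed
  from order_tendstoD(2)[OF bound_lim this]
  have "\<forall>\<^sub>F n in sequentially. norm (fn n (s, t) z - f (s, t) z) < \<epsilon>"
    using ev
  proof eventually_elim
    case (elim n)
    define a where "a i = (seq.k n (p i) - seq.k n (p (Suc i))) / y\<^sup>2" for i
    define b where "b i = D / y\<^sup>2 * ((seq.k n (p i) - seq.k n (p (Suc i))) + (k (p i) - k (p (Suc i)))) + E n i" for i
    have tele: "(\<Sum>i<N. q (p i) - q (p (Suc i))) = q t - q s" for q :: "real \<Rightarrow> real"
      using sum_lessThan_telescope'[of "\<lambda>i. q (p i)" N] p(1,2) by simp
    have "norm (fn n (p N, t) z - g N) \<le> exp (\<Sum>i<N. a i) * (\<Sum>i<N. b i)"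
    proof (rule discrete_gronwall[where D="\<lambda>i. norm (fn n (p i, t) z - g i)"])
      show "norm (fn n (p 0, t) z - g 0) = 0" using f_id[OF st(2) z] seq.f_id[OF st(2) z] by (simp add: g_def p(1))
      fix i assume i: "i < N"
      then have i': "i \<le> N" "Suc i \<le> N" by auto
      note pi = pI[OF i'(1)] and ps = pI[OF i'(2)]
      show "0 \<le> a i" unfolding a_def using seq.k_mono[OF ps(1) pi(1) p(4), of n] y by simp
      show "0 \<le> b i" unfolding b_def E_def
        using seq.k_mono[OF ps(1) pi(1) p(4), of n] k_mono[OF ps(1) pi(1) p(4)] y D(1) by simp
      let ?u = "fn n (p i, t) z" and ?F = "fn n (p (Suc i), p i)" and ?f = "f (p (Suc i), p i)"
      have u: "?u \<in> UHP" "y \<le> Im ?u"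
        using seq.f_UHP[OF pi(1) st(2) pi(2) z] seq.Im_f_ge[OF pi(1) st(2) pi(2) z] by (auto simp: y_def)
      have gi: "g i \<in> UHP" "y \<le> Im (g i)" using gU[OF i'(1)] .
      have eqn: "fn n (p (Suc i), t) z = ?F ?u" by (rule seq.f_comp[OF ps(1) pi(1) st(2) p(4) pi(2) z, symmetric])
      have eqg: "g (Suc i) = ?f (g i)" unfolding g_def by (rule f_comp[OF ps(1) pi(1) st(2) p(4) pi(2) z, symmetric])
      have lip: "norm (?F ?u - ?F (g i)) \<le> (1 + a i) * norm (?u - g i)"
        unfolding a_def by (rule seq.f_lipschitz[OF ps(1) pi(1) p(4) u(1) gi(1) y u(2) gi(2)])
      have dy: "D / (Im (g i))\<^sup>2 \<le> D / y\<^sup>2" using gi(2) y D(1) by (intro divide_left_mono power_mono) auto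
      define P where "P = ?F (g i) - g i + of_real (mn n (p i) - mn n (p (Suc i))) + (cauchy_G (\<kappa>n n (p i)) (g i) - cauchy_G (\<kappa>n n (p (Suc i))) (g i))"
      define Q where "Q = ?f (g i) - g i + of_real (m (p i) - m (p (Suc i))) + (cauchy_G (\<kappa> (p i)) (g i) - cauchy_G (\<kappa> (p (Suc i))) (g i))"
      define R where "R = (of_real (mn n (p i) - mn n (p (Suc i))) + (cauchy_G (\<kappa>n n (p i)) (g i) - cauchy_G (\<kappa>n n (p (Suc i))) (g i)))
     - (of_real (m (p i) - m (p (Suc i))) + (cauchy_G (\<kappa> (p i)) (g i) - cauchy_G (\<kappa> (p (Suc i))) (g i)))"
      have "norm P \<le> D / (Im (g i))\<^sup>2 * (seq.k n (p i) - seq.k n (p (Suc i)))"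
        unfolding P_def by (rule seq.euler_step[OF ps(1) pi(1) p(4) gi(1) elim(2)[rule_format, OF i _ gi(2), THEN conjunct1]])
      also have "\<dots> \<le> D / y\<^sup>2 * (seq.k n (p i) - seq.k n (p (Suc i)))"
        using dy seq.k_mono[OF ps(1) pi(1) p(4), of n] by (intro mult_right_mono) auto
      finally have P: "norm P \<le> D / y\<^sup>2 * (seq.k n (p i) - seq.k n (p (Suc i)))" .
      have "norm Q \<le> D / (Im (g i))\<^sup>2 * (k (p i) - k (p (Suc i)))"
        unfolding Q_def by (rule euler_step[OF ps(1) pi(1) p(4) gi(1) elim(2)[rule_format, OF i _ gi(2), THEN conjunct2]])
      also have "\<dots> \<le> D / y\<^sup>2 * (k (p i) - k (p (Suc i)))"
        using dy k_mono[OF ps(1) pi(1) p(4)] by (intro mult_right_mono) auto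
      finally have Q: "norm Q \<le> D / y\<^sup>2 * (k (p i) - k (p (Suc i)))" .
      have "?F (g i) - ?f (g i) = P - Q - R" by (simp add: P_def Q_def R_def)
      then have "norm (?F (g i) - ?f (g i)) = norm (P - Q - R)" by (rule arg_cong)
      also have "\<dots> \<le> norm P + norm Q + norm R"
        using norm_triangle_ineq4[of "P - Q" R] norm_triangle_ineq4[of P Q] by linarith
      also have "\<dots> \<le> b i" unfolding b_def using P Q by (simp add: E_def R_def distrib_left)
      finally have "norm (?F (g i) - ?f (g i)) \<le> b i" .
      then show "norm (fn n (p (Suc i), t) z - g (Suc i)) \<le> (1 + a i) * norm (?u - g i) + b i"
        unfolding eqn eqg using lip norm_triangle_ineq[of "?F ?u - ?F (g i)" "?F (g i) - ?f (g i)"] by simp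
    qed
    moreover have "(\<Sum>i<N. a i) = (seq.k n t - seq.k n s) / y\<^sup>2"
      unfolding a_def sum_divide_distrib[symmetric] tele ..
    moreover have "(\<Sum>i<N. b i) = D / y\<^sup>2 * ((seq.k n t - seq.k n s) + (k t - k s)) + (\<Sum>i<N. E n i)"
      unfolding b_def sum.distrib sum_distrib_left[symmetric] tele ..
    ultimately have "norm (fn n (p N, t) z - g N) \<le> bound n" unfolding bound_def by simp
    then show ?case using elim(1) by (simp add: g_def p(2))
  qed
  then show "\<exists>no. \<forall>n\<ge>no. norm (fn n (s, t) z - f (s, t) z) < \<epsilon>"
    by (simp add: eventually_sequentially)
qed

end

context evolution_family_sequence
begin

lemma f_converge_iff_\<kappa>_converge: "mean_mass_converge \<and> f_converge \<longleftrightarrow> mean_mass_converge \<and> \<kappa>_converge"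
  using f_converge_if_\<kappa>_converge \<kappa>_converge_if_f_converge by blast

text \<open>
  The constant test function gives the masses. In the other direction the Cauchy transforms at moving times
  differ from those at the limit time by at most the increments of the masses.
\<close>

lemma generator_condition_iff:
  "loc_unif_conv I mn m \<and> weak_conv_loc_unif I \<kappa>n \<kappa> \<longleftrightarrow> mean_mass_converge \<and> \<kappa>_converge"
proof
  assume A: "loc_unif_conv I mn m \<and> weak_conv_loc_unif I \<kappa>n \<kappa>"
  then have weak: "loc_unif_conv I (\<lambda>n t. integral\<^sup>L (\<kappa>n n t) \<phi>) (\<lambda>t. integral\<^sup>L (\<kappa> t) \<phi>)" if "bdd_cont \<phi>" for \<phi>
    using that by (simp add: weak_conv_loc_unif_def)
  have "bdd_cont (\<lambda>_. 1)" by (simp add: bdd_cont_def)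
  from weak[OF this] have "loc_unif_conv I (\<lambda>n t. integral\<^sup>L (\<kappa>n n t) (\<lambda>_. 1::real)) (\<lambda>t. integral\<^sup>L (\<kappa> t) (\<lambda>_. 1::real))" .
  also have "?this \<longleftrightarrow> loc_unif_conv I seq.k k"
  proof (rule loc_unif_conv_cong)
    fix n t assume t: "t \<in> I"
    show "integral\<^sup>L (\<kappa>n n t) (\<lambda>_. 1) = seq.k n t"
      using finite_borel_measure.borel_UNIV[OF seq.finite_\<kappa>[OF t]] by (simp add: seq.k_def)
    show "integral\<^sup>L (\<kappa> t) (\<lambda>_. 1) = k t"
      using finite_borel_measure.borel_UNIV[OF finite_\<kappa>[OF t]] by (simp add: k_def)
  qed
  finally have "mean_mass_converge" using A by (simp add: mean_mass_converge_def)
  moreover have "\<kappa>_converge"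
    unfolding \<kappa>_converge_def
  proof (intro ballI)
    fix t z assume t: "t \<in> I" and z: "z \<in> UHP"
    show "(\<lambda>n. cauchy_G (\<kappa>n n t) z) \<longlonglongrightarrow> cauchy_G (\<kappa> t) z"
    proof (rule cauchy_G_converges_if_weak[OF seq.finite_\<kappa>[OF t] finite_\<kappa>[OF t] _ z])
      fix \<phi> :: "real \<Rightarrow> real" assume \<phi>: "bdd_cont \<phi>"
      show "(\<lambda>n. integral\<^sup>L (\<kappa>n n t) \<phi>) \<longlonglongrightarrow> integral\<^sup>L (\<kappa> t) \<phi>"
        using weak[OF \<phi>, unfolded loc_unif_conv_iff_sequential[OF continuous_integral_\<kappa>[OF \<phi>]], rule_format, of "\<lambda>_. t" t] t
        by simp
    qed
  qed
  ultimately show "mean_mass_converge \<and> \<kappa>_converge" ..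
next
  assume A: "mean_mass_converge \<and> \<kappa>_converge"
  then have mk: "mean_mass_converge" and \<kappa>c: "\<kappa>_converge" by auto
  have "weak_conv_loc_unif I \<kappa>n \<kappa>"
    unfolding weak_conv_loc_unif_def
  proof (intro allI impI)
    fix \<phi> :: "real \<Rightarrow> real" assume \<phi>: "bdd_cont \<phi>"
    show "loc_unif_conv I (\<lambda>n t. integral\<^sup>L (\<kappa>n n t) \<phi>) (\<lambda>t. integral\<^sup>L (\<kappa> t) \<phi>)"
      unfolding loc_unif_conv_iff_sequential[OF continuous_integral_\<kappa>[OF \<phi>]]
    proof (intro allI impI)
      fix x l assume "\<forall>n. x n \<in> I" and l: "l \<in> I" and lim: "x \<longlonglongrightarrow> l"
      then have x: "x n \<in> I" for n by simp
      show "(\<lambda>n. integral\<^sup>L (\<kappa>n n (x n)) \<phi>) \<longlonglongrightarrow> integral\<^sup>L (\<kappa> l) \<phi>"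
      proof (rule cauchy_G_continuity[OF seq.finite_\<kappa>[OF x] finite_\<kappa>[OF l] _ _ \<phi>])
        show "(\<lambda>n. measure (\<kappa>n n (x n)) UNIV) \<longlonglongrightarrow> measure (\<kappa> l) UNIV"
          using mean_mass_convergeD(2)[OF mk x l lim] by (simp add: k_def seq.k_def)
        fix z assume z: "z \<in> UHP"
        have y: "Im z > 0" using z by (simp add: UHP_def)
        have "(\<lambda>n. cauchy_G (\<kappa>n n (x n)) z - cauchy_G (\<kappa>n n l) z) \<longlonglongrightarrow> 0"
        proof (rule Lim_null_comparison)
          have "(\<lambda>n. \<bar>seq.k n (x n) - seq.k n l\<bar> / Im z) \<longlonglongrightarrow> \<bar>k l - k l\<bar> / Im z"
            by (intro tendsto_intros mean_mass_convergeD(2)[OF mk x l lim] mean_mass_converge_const(2)[OF mk l]) (use y in simp)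
          then show "(\<lambda>n. \<bar>seq.k n (x n) - seq.k n l\<bar> / Im z) \<longlonglongrightarrow> 0" by simp
          have "norm (cauchy_G (\<kappa>n n (x n)) z - cauchy_G (\<kappa>n n l) z) \<le> \<bar>seq.k n (x n) - seq.k n l\<bar> / Im z" for n
          proof (cases "x n \<le> l")
            case True
            have "norm (cauchy_G (\<kappa>n n l) z - cauchy_G (\<kappa>n n (x n)) z) \<le> (seq.k n l - seq.k n (x n)) / Im z"
              by (rule seq.norm_cauchy_G_time_diff_le[OF x l True z])
            also have "\<dots> \<le> \<bar>seq.k n (x n) - seq.k n l\<bar> / Im z" using y by (intro divide_right_mono) auto
            finally show ?thesis by (simp only: norm_minus_commute)
          next
            case False
            then have "l \<le> x n" by simp
            from seq.norm_cauchy_G_time_diff_le[OF l x this z]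
            have "norm (cauchy_G (\<kappa>n n (x n)) z - cauchy_G (\<kappa>n n l) z) \<le> (seq.k n (x n) - seq.k n l) / Im z" .
            also have "\<dots> \<le> \<bar>seq.k n (x n) - seq.k n l\<bar> / Im z" using y by (intro divide_right_mono) auto
            finally show ?thesis .
          qed
          then show "\<forall>\<^sub>F n in sequentially. norm (cauchy_G (\<kappa>n n (x n)) z - cauchy_G (\<kappa>n n l) z) \<le> \<bar>seq.k n (x n) - seq.k n l\<bar> / Im z"
            by (intro always_eventually allI)
        qed
        moreover have "(\<lambda>n. cauchy_G (\<kappa>n n l) z) \<longlonglongrightarrow> cauchy_G (\<kappa> l) z"
          using \<kappa>c l z by (simp add: \<kappa>_converge_def)
        ultimately show "(\<lambda>n. cauchy_G (\<kappa>n n (x n)) z) \<longlonglongrightarrow> cauchy_G (\<kappa> l) z"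
          by (rule Lim_transform[rotated])
      qed
    qed
  qed
  then show "loc_unif_conv I mn m \<and> weak_conv_loc_unif I \<kappa>n \<kappa>"
    using mk by (simp add: mean_mass_converge_def)
qed

lemma nev_r_DLC_conv_iff:
  "loc_unif_conv I (\<lambda>n t. nev_r (P2_DLC (fn n) t)) (\<lambda>t. nev_r (P2_DLC f t)) \<longleftrightarrow> loc_unif_conv I seq.k k"
proof (rule loc_unif_conv_cong)
  fix n t assume t: "t \<in> I"
  show "nev_r (P2_DLC (fn n) t) = seq.k n t"
    using seq.nev_r_f[OF zero_in_I t I_nonneg[OF t], of n] by (simp add: P2_DLC_def seq.k_0)
  show "nev_r (P2_DLC f t) = k t"
    using nev_r_f[OF zero_in_I t I_nonneg[OF t]] by (simp add: P2_DLC_def k_0)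
qed

text \<open>
  The maps \<open>f (0, t)\<close> determine \<open>f (s, t)\<close>, because
  \<open>f (0, s) (f (s, t) z) = f (0, t) z\<close> and \<open>f (0, s)\<close> is injective.
  A bounded sequence with a unique limit point converges, which makes this dependence continuous.
\<close>

lemma f_converge_if_DLC_converge:
  assumes L: "loc_unif_conv (UHP \<times> I) (\<lambda>n (z, t). fn n (0, t) z) (\<lambda>(z, t). f (0, t) z)"
    and mk: "mean_mass_converge"
  shows "f_converge"
  unfolding f_converge_def
proof (intro ballI impI)
  fix s t z assume st: "s \<in> I" "t \<in> I" "s \<le> t" and z: "z \<in> UHP"
  have y: "Im z > 0" using z by (simp add: UHP_def)
  note s0 = I_nonneg[OF st(1)]
  define w where "w n = fn n (s, t) z" for n
  have wU: "w n \<in> UHP" "Im z \<le> Im (w n)" for n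
    unfolding w_def by (rule seq.f_UHP[OF st z], rule seq.Im_f_ge[OF st z])
  show "(\<lambda>n. fn n (s, t) z) \<longlonglongrightarrow> f (s, t) z"
    unfolding w_def[symmetric]
  proof (rule LIMSEQ_if_unique_subsequence_limit)
    let ?b = "\<lambda>n. norm z + (\<bar>mn n t - mn n s\<bar> + (seq.k n t - seq.k n s) / Im z)"
    have "?b \<longlonglongrightarrow> norm z + (\<bar>m t - m s\<bar> + (k t - k s) / Im z)"
      by (intro tendsto_intros mean_mass_converge_const[OF mk] st) (use y in simp)
    then have "Bseq ?b" by (intro convergent_imp_Bseq) (auto simp: convergent_def)
    then obtain B where B: "\<And>n. norm (?b n) \<le> B" unfolding Bseq_def by blast
    have "norm (w n) \<le> B" for n
    proof -
      have "norm (w n) \<le> norm z + norm (w n - z)" using norm_triangle_ineq[of z "w n - z"] by simp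
      also have "\<dots> \<le> ?b n" unfolding w_def by (intro add_left_mono seq.norm_f_diff_le[OF st z])
      also have "\<dots> \<le> B" using B[of n] by simp
      finally show ?thesis .
    qed
    then show "bounded (range w)" unfolding bounded_iff by blast
    fix \<sigma> :: "nat \<Rightarrow> nat" and l assume \<sigma>: "strict_mono \<sigma>" and lim: "(\<lambda>j. w (\<sigma> j)) \<longlonglongrightarrow> l"
    have "Im z \<le> Im l"
      by (rule LIMSEQ_le_const[OF tendsto_Im[OF lim]]) (use wU(2) in auto)
    then have lU: "l \<in> UHP" using y by (simp add: UHP_def)
    have "(\<lambda>j. (\<lambda>(z, t). fn (\<sigma> j) (0, t) z) (w (\<sigma> j), s)) \<longlonglongrightarrow> (\<lambda>(z, t). f (0, t) z) (l, s)"
      by (rule loc_unif_conv_subsequence[OF L continuous_f_0 \<sigma>])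
         (use wU(1) lU st(1) in \<open>auto intro!: tendsto_Pair lim\<close>)
    then have "(\<lambda>j. fn (\<sigma> j) (0, t) z) \<longlonglongrightarrow> f (0, s) l"
      using seq.f_comp[OF zero_in_I st(1,2) s0 st(3) z] by (simp add: w_def)
    moreover have "(\<lambda>j. (\<lambda>(z, t). fn (\<sigma> j) (0, t) z) (z, t)) \<longlonglongrightarrow> (\<lambda>(z, t). f (0, t) z) (z, t)"
      by (rule loc_unif_conv_subsequence[OF L continuous_f_0 \<sigma>]) (use z st(2) in auto)
    ultimately have "f (0, s) l = f (0, t) z" by (intro LIMSEQ_unique) auto
    also have "\<dots> = f (0, s) (f (s, t) z)" by (rule f_comp[OF zero_in_I st(1,2) s0 st(3) z, symmetric])
    finally show "l = f (s, t) z"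
      using f_injective[OF zero_in_I st(1) s0 lU f_UHP[OF st z]] by auto
  qed
qed

lemma DLC_condition_iff:
  "loc_unif_conv (UHP \<times> I) (\<lambda>n (z, t). P2_DLC (fn n) t z) (\<lambda>(z, t). P2_DLC f t z) \<and>
   loc_unif_conv I (\<lambda>n t. nev_r (P2_DLC (fn n) t)) (\<lambda>t. nev_r (P2_DLC f t))
   \<longleftrightarrow> mean_mass_converge \<and> f_converge"
  unfolding nev_r_DLC_conv_iff unfolding P2_DLC_def
proof
  assume A: "loc_unif_conv (UHP \<times> I) (\<lambda>n (z, t). fn n (0, t) z) (\<lambda>(z, t). f (0, t) z) \<and> loc_unif_conv I seq.k k"
  then have L: "loc_unif_conv (UHP \<times> I) (\<lambda>n (z, t). fn n (0, t) z) (\<lambda>(z, t). f (0, t) z)" ..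
  have "mean_mass_converge"
  proof (rule mean_mass_converge_if_f_0_converge)
    fix t :: "nat \<Rightarrow> real" and l z assume t: "\<And>n. t n \<in> I" "l \<in> I" "t \<longlonglongrightarrow> l" and z: "z \<in> UHP"
    have "(\<lambda>n. (\<lambda>(z, t). fn n (0, t) z) (z, t n)) \<longlonglongrightarrow> (\<lambda>(z, t). f (0, t) z) (z, l)"
      by (rule L[unfolded loc_unif_conv_iff_sequential[OF continuous_f_0], rule_format])
         (use t z in \<open>auto intro!: tendsto_Pair\<close>)
    then show "(\<lambda>n. fn n (0, t n) z) \<longlonglongrightarrow> f (0, l) z" by simp
  qed (use A in blast)
  then show "mean_mass_converge \<and> f_converge" using f_converge_if_DLC_converge[OF L] by blast
next
  assume A: "mean_mass_converge \<and> f_converge"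
  then have mk: "mean_mass_converge" and fc: "f_converge" by auto
  have "loc_unif_conv (UHP \<times> I) (\<lambda>n (z, t). fn n (0, t) z) (\<lambda>(z, t). f (0, t) z)"
    unfolding loc_unif_conv_iff_sequential[OF continuous_f_0]
  proof (intro allI impI)
    fix x l assume "\<forall>n. x n \<in> UHP \<times> I" and l: "l \<in> UHP \<times> I" and lim: "x \<longlonglongrightarrow> l"
    then have x: "fst (x n) \<in> UHP" "snd (x n) \<in> I" for n by (simp_all add: mem_Times_iff)
    have l': "fst l \<in> UHP" "snd l \<in> I" using l by (simp_all add: mem_Times_iff)
    have "(\<lambda>n. fn n (0, snd (x n)) (fst (x n))) \<longlonglongrightarrow> f (0, snd l) (fst l)"
      by (rule f_converge_moving[OF mk f_convergeD[OF fc] zero_in_I tendsto_const x(2) tendsto_snd[OF lim]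
            I_nonneg[OF x(2)] zero_in_I l'(2) I_nonneg[OF l'(2)] x(1) tendsto_fst[OF lim] l'(1)])
    then show "(\<lambda>n. (\<lambda>(z, t). fn n (0, t) z) (x n)) \<longlonglongrightarrow> (\<lambda>(z, t). f (0, t) z) l"
      by (simp add: split_beta)
  qed
  then show "loc_unif_conv (UHP \<times> I) (\<lambda>n (z, t). fn n (0, t) z) (\<lambda>(z, t). f (0, t) z) \<and> loc_unif_conv I seq.k k"
    using mk by (simp add: mean_mass_converge_def)
qed

lemma continuous_k_increment: "continuous_on (I2le I) (\<lambda>\<tau>. k (snd \<tau>) - k (fst \<tau>))"
  by (intro continuous_on_diff continuous_on_compose2[OF continuous_k] continuous_intros) (auto simp: I2le_def)

text \<open>Values are increments from time \<open>0\<close>, as \<open>k 0 = 0\<close>.\<close>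

lemma k_increment_converge_iff:
  "loc_unif_conv (I2le I) (\<lambda>n \<tau>. seq.k n (snd \<tau>) - seq.k n (fst \<tau>)) (\<lambda>\<tau>. k (snd \<tau>) - k (fst \<tau>)) \<longleftrightarrow> loc_unif_conv I seq.k k"
  unfolding loc_unif_conv_iff_sequential[OF continuous_k_increment] loc_unif_conv_iff_sequential[OF continuous_k]
proof safe
  fix x :: "nat \<Rightarrow> real" and l
  assume *: "\<forall>x l. (\<forall>n. x n \<in> I2le I) \<longrightarrow> l \<in> I2le I \<longrightarrow> x \<longlonglongrightarrow> l \<longrightarrow>
      (\<lambda>n. seq.k n (snd (x n)) - seq.k n (fst (x n))) \<longlonglongrightarrow> k (snd l) - k (fst l)"
    and x: "\<forall>n. x n \<in> I" and l: "l \<in> I" and lim: "x \<longlonglongrightarrow> l"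
  have "(\<lambda>n. seq.k n (snd (0::real, x n)) - seq.k n (fst (0, x n))) \<longlonglongrightarrow> k (snd (0::real, l)) - k (fst (0, l))"
    by (rule *[rule_format]) (use x l zero_in_I I_nonneg in \<open>auto simp: I2le_def intro!: tendsto_Pair lim\<close>)
  then show "(\<lambda>n. seq.k n (x n)) \<longlonglongrightarrow> k l" by (simp add: k_0 seq.k_0)
next
  fix x :: "nat \<Rightarrow> real \<times> real" and a b
  assume *: "\<forall>x l. (\<forall>n. x n \<in> I) \<longrightarrow> l \<in> I \<longrightarrow> x \<longlonglongrightarrow> l \<longrightarrow> (\<lambda>n. seq.k n (x n)) \<longlonglongrightarrow> k l"
    and x: "\<forall>n. x n \<in> I2le I" and l: "(a, b) \<in> I2le I" and lim: "x \<longlonglongrightarrow> (a, b)"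
  have x': "fst (x n) \<in> I" "snd (x n) \<in> I" for n using x[rule_format, of n] by (auto simp: I2le_def)
  show "(\<lambda>n. seq.k n (snd (x n)) - seq.k n (fst (x n))) \<longlonglongrightarrow> k (snd (a, b)) - k (fst (a, b))"
    by (intro tendsto_diff *[rule_format] x' tendsto_fst[OF lim] tendsto_snd[OF lim])
       (use l tendsto_fst[OF lim] tendsto_snd[OF lim] in \<open>auto simp: I2le_def\<close>)
qed

lemma nev_r_REF_conv_iff:
  "loc_unif_conv (I2le I) (\<lambda>n \<tau>. nev_r (fn n \<tau>)) (\<lambda>\<tau>. nev_r (f \<tau>)) \<longleftrightarrow> loc_unif_conv I seq.k k"
  unfolding k_increment_converge_iff[symmetric]
proof (rule loc_unif_conv_cong)
  fix n \<tau> assume "\<tau> \<in> I2le I"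
  then obtain s t where \<tau>: "\<tau> = (s, t)" "s \<in> I" "t \<in> I" "s \<le> t" by (auto simp: I2le_def)
  show "nev_r (fn n \<tau>) = seq.k n (snd \<tau>) - seq.k n (fst \<tau>)" unfolding \<tau>(1) using seq.nev_r_f[OF \<tau>(2-4)] by simp
  show "nev_r (f \<tau>) = k (snd \<tau>) - k (fst \<tau>)" unfolding \<tau>(1) using nev_r_f[OF \<tau>(2-4)] by simp
qed

lemma f_converge_moving_pair:
  assumes mk: "mean_mass_converge" and fc: "f_converge"
    and x: "\<And>n. x n \<in> UHP \<times> I2le I" and l: "l \<in> UHP \<times> I2le I" and lim: "x \<longlonglongrightarrow> l"
  shows "(\<lambda>n. fn n (snd (x n)) (fst (x n))) \<longlonglongrightarrow> f (snd l) (fst l)"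
proof -
  have x': "fst (x n) \<in> UHP" "fst (snd (x n)) \<in> I" "snd (snd (x n)) \<in> I" "fst (snd (x n)) \<le> snd (snd (x n))" for n
    using x[of n] by (auto simp: I2le_def)
  have l': "fst l \<in> UHP" "fst (snd l) \<in> I" "snd (snd l) \<in> I" "fst (snd l) \<le> snd (snd l)"
    using l by (auto simp: I2le_def)
  have "(\<lambda>n. fn n (fst (snd (x n)), snd (snd (x n))) (fst (x n))) \<longlonglongrightarrow> f (fst (snd l), snd (snd l)) (fst l)"
    by (rule f_converge_moving[OF mk f_convergeD[OF fc] x'(2) tendsto_fst[OF tendsto_snd[OF lim]]
          x'(3) tendsto_snd[OF tendsto_snd[OF lim]] x'(4) l'(2,3,4) x'(1) tendsto_fst[OF lim] l'(1)])
  then show ?thesis by simp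
qed

lemma REF_condition_iff:
  "loc_unif_conv (UHP \<times> I2le I) (\<lambda>n (z, \<tau>). fn n \<tau> z) (\<lambda>(z, \<tau>). f \<tau> z) \<and>
   loc_unif_conv (I2le I) (\<lambda>n \<tau>. nev_r (fn n \<tau>)) (\<lambda>\<tau>. nev_r (f \<tau>))
   \<longleftrightarrow> mean_mass_converge \<and> f_converge"
  unfolding nev_r_REF_conv_iff loc_unif_conv_iff_sequential[OF continuous_f]
proof
  assume A: "(\<forall>x l. (\<forall>n. x n \<in> UHP \<times> I2le I) \<longrightarrow> l \<in> UHP \<times> I2le I \<longrightarrow> x \<longlonglongrightarrow> l \<longrightarrow>
      (\<lambda>n. case x n of (z, \<tau>) \<Rightarrow> fn n \<tau> z) \<longlonglongrightarrow> (case l of (z, \<tau>) \<Rightarrow> f \<tau> z)) \<and> loc_unif_conv I seq.k k"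
  have lim: "(\<lambda>n. fn n (s n, t n) z) \<longlonglongrightarrow> f (s', t') z"
    if "\<And>n. (s n, t n) \<in> I2le I" "(s', t') \<in> I2le I" "s \<longlonglongrightarrow> s'" "t \<longlonglongrightarrow> t'" "z \<in> UHP" for s t s' t' z
  proof -
    have "(\<lambda>n. case (z, (s n, t n)) of (z, \<tau>) \<Rightarrow> fn n \<tau> z) \<longlonglongrightarrow> (case (z, (s', t')) of (z, \<tau>) \<Rightarrow> f \<tau> z)"
      by (rule A[THEN conjunct1, rule_format]) (use that in \<open>auto intro!: tendsto_Pair\<close>)
    then show ?thesis by simp
  qed
  have "mean_mass_converge"
  proof (rule mean_mass_converge_if_f_0_converge)
    fix t :: "nat \<Rightarrow> real" and l z assume t: "\<And>n. t n \<in> I" "l \<in> I" "t \<longlonglongrightarrow> l" and z: "z \<in> UHP"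
    show "(\<lambda>n. fn n (0, t n) z) \<longlonglongrightarrow> f (0, l) z"
      by (rule lim[OF _ _ tendsto_const t(3) z]) (use t zero_in_I I_nonneg in \<open>auto simp: I2le_def\<close>)
  qed (use A in blast)
  moreover have "f_converge"
    unfolding f_converge_def
  proof (intro ballI impI)
    fix s t z assume "s \<in> I" "t \<in> I" "s \<le> t" "z \<in> UHP"
    then show "(\<lambda>n. fn n (s, t) z) \<longlonglongrightarrow> f (s, t) z"
      by (intro lim tendsto_const) (auto simp: I2le_def)
  qed
  ultimately show "mean_mass_converge \<and> f_converge" ..
next
  assume A: "mean_mass_converge \<and> f_converge"
  then have mk: "mean_mass_converge" and fc: "f_converge" by auto
  show "(\<forall>x l. (\<forall>n. x n \<in> UHP \<times> I2le I) \<longrightarrow> l \<in> UHP \<times> I2le I \<longrightarrow> x \<longlonglongrightarrow> l \<longrightarrow>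
      (\<lambda>n. case x n of (z, \<tau>) \<Rightarrow> fn n \<tau> z) \<longlonglongrightarrow> (case l of (z, \<tau>) \<Rightarrow> f \<tau> z)) \<and> loc_unif_conv I seq.k k"
    using f_converge_moving_pair[OF mk fc] mk by (simp add: split_beta mean_mass_converge_def)
qed

text \<open>
  For the monotone hemigroups, weak convergence is convergence of Cauchy transforms, that is of
  reciprocals of the maps \<open>f\<close>.
\<close>

lemma monotone_condition_iff:
  assumes mu: "monotone_hemigroup_of I f mu" "finite_second_moment I mu"
    and mun: "\<And>n. monotone_hemigroup_of I (fn n) (mun n)" "\<And>n. finite_second_moment I (mun n)"
  shows "weak_conv_loc_unif (I2le I) mun mu \<and> loc_unif_conv (I2le I) (\<lambda>n \<tau>. Var (mun n \<tau>)) (\<lambda>\<tau>. Var (mu \<tau>))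
    \<longleftrightarrow> mean_mass_converge \<and> f_converge"
proof -
  have dist: "real_distribution (mu \<tau>)" "real_distribution (mun n \<tau>)" if "\<tau> \<in> I2le I" for \<tau> n
    using mu(1) mun(1)[of n] that by (simp_all add: monotone_hemigroup_of_def conv_hemigroup_def)
  have F: "cauchy_F (mu \<tau>) z = f \<tau> z" "cauchy_F (mun n \<tau>) z = fn n \<tau> z" if "\<tau> \<in> I2le I" "z \<in> UHP" for \<tau> n z
    using mu(1) mun(1)[of n] that by (simp_all add: monotone_hemigroup_of_def)
  have sq: "integrable (mu \<tau>) (\<lambda>x. x\<^sup>2)" "integrable (mun n \<tau>) (\<lambda>x. x\<^sup>2)" if "\<tau> \<in> I2le I" for \<tau> n
    using mu(2) mun(2)[of n] that by (simp_all add: finite_second_moment_def)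
  have cont: "continuous_on (I2le I) (\<lambda>\<tau>. LINT x|mu \<tau>. \<phi> x)" if "bdd_cont \<phi>" for \<phi>
    using mu(1) that by (simp add: monotone_hemigroup_of_def conv_hemigroup_def)
  have "loc_unif_conv (I2le I) (\<lambda>n \<tau>. Var (mun n \<tau>)) (\<lambda>\<tau>. Var (mu \<tau>)) \<longleftrightarrow>
    loc_unif_conv (I2le I) (\<lambda>n \<tau>. nev_r (fn n \<tau>)) (\<lambda>\<tau>. nev_r (f \<tau>))"
    by (rule loc_unif_conv_cong; rule nev_r_eq_Var[OF dist(2) sq(2) F(2), symmetric] nev_r_eq_Var[OF dist(1) sq(1) F(1), symmetric]; assumption)
  then have var: "loc_unif_conv (I2le I) (\<lambda>n \<tau>. Var (mun n \<tau>)) (\<lambda>\<tau>. Var (mu \<tau>)) \<longleftrightarrow> loc_unif_conv I seq.k k"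
    by (simp only: nev_r_REF_conv_iff)
  have fbm: "finite_borel_measure (mu \<tau>)" "finite_borel_measure (mun n \<tau>)" if "\<tau> \<in> I2le I" for \<tau> n
    using dist[OF that] real_distribution.finite_borel_measure_M by blast+
  show ?thesis unfolding var
  proof
    assume A: "weak_conv_loc_unif (I2le I) mun mu \<and> loc_unif_conv I seq.k k"
    have lim: "(\<lambda>n. fn n (\<tau> n) z) \<longlonglongrightarrow> f l z"
      if \<tau>: "\<And>n. \<tau> n \<in> I2le I" and l: "l \<in> I2le I" and tl: "\<tau> \<longlonglongrightarrow> l" and z: "z \<in> UHP" for \<tau> l z
    proof -
      have "(\<lambda>n. cauchy_G (mun n (\<tau> n)) z) \<longlonglongrightarrow> cauchy_G (mu l) z"
      proof (rule cauchy_G_converges_if_weak[OF fbm(2)[OF \<tau>] fbm(1)[OF l] _ z])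
        fix \<phi> :: "real \<Rightarrow> real" assume \<phi>: "bdd_cont \<phi>"
        have "loc_unif_conv (I2le I) (\<lambda>n \<tau>. LINT x|mun n \<tau>. \<phi> x) (\<lambda>\<tau>. LINT x|mu \<tau>. \<phi> x)"
          using A \<phi> by (simp add: weak_conv_loc_unif_def)
        from this[unfolded loc_unif_conv_iff_sequential[OF cont[OF \<phi>]], rule_format, OF \<tau> l tl]
        show "(\<lambda>n. integral\<^sup>L (mun n (\<tau> n)) \<phi>) \<longlonglongrightarrow> integral\<^sup>L (mu l) \<phi>" .
      qed
      then have "(\<lambda>n. 1 / cauchy_G (mun n (\<tau> n)) z) \<longlonglongrightarrow> 1 / cauchy_G (mu l) z"
        by (intro tendsto_divide tendsto_const real_distribution.cauchy_G_nonzero[OF dist(1)[OF l] z])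
      then show ?thesis unfolding cauchy_F_def[symmetric] F(1)[OF l z] F(2)[OF \<tau> z] .
    qed
    have "mean_mass_converge"
    proof (rule mean_mass_converge_if_f_0_converge)
      fix t :: "nat \<Rightarrow> real" and l z assume t: "\<And>n. t n \<in> I" "l \<in> I" "t \<longlonglongrightarrow> l" and z: "z \<in> UHP"
      show "(\<lambda>n. fn n (0, t n) z) \<longlonglongrightarrow> f (0, l) z"
        by (rule lim[OF _ _ tendsto_Pair[OF tendsto_const t(3)] z]) (use t zero_in_I I_nonneg in \<open>auto simp: I2le_def\<close>)
    qed (use A in blast)
    moreover have "f_converge"
      unfolding f_converge_def
    proof (intro ballI impI)
      fix s t z assume "s \<in> I" "t \<in> I" "s \<le> t" "z \<in> UHP"
      then show "(\<lambda>n. fn n (s, t) z) \<longlonglongrightarrow> f (s, t) z"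
        by (intro lim tendsto_const) (auto simp: I2le_def)
    qed
    ultimately show "mean_mass_converge \<and> f_converge" ..
  next
    assume A: "mean_mass_converge \<and> f_converge"
    then have mk: "mean_mass_converge" and fc: "f_converge" by auto
    have "weak_conv_loc_unif (I2le I) mun mu"
      unfolding weak_conv_loc_unif_def
    proof (intro allI impI)
      fix \<phi> :: "real \<Rightarrow> real" assume \<phi>: "bdd_cont \<phi>"
      show "loc_unif_conv (I2le I) (\<lambda>n \<tau>. LINT x|mun n \<tau>. \<phi> x) (\<lambda>\<tau>. LINT x|mu \<tau>. \<phi> x)"
        unfolding loc_unif_conv_iff_sequential[OF cont[OF \<phi>]]
      proof (intro allI impI)
        fix x l assume "\<forall>n. x n \<in> I2le I" and l: "l \<in> I2le I" and lim: "x \<longlonglongrightarrow> l"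
        then have x: "x n \<in> I2le I" for n by simp
        show "(\<lambda>n. LINT y|mun n (x n). \<phi> y) \<longlonglongrightarrow> (LINT y|mu l. \<phi> y)"
        proof (rule cauchy_G_continuity[OF fbm(2)[OF x] fbm(1)[OF l] _ _ \<phi>])
          have one: "measure M UNIV = 1" if "real_distribution M" for M
            using prob_space.prob_space[OF real_distribution.axioms(1)[OF that]] real_distribution.space_eq_univ[OF that] by simp
          show "(\<lambda>n. measure (mun n (x n)) UNIV) \<longlonglongrightarrow> measure (mu l) UNIV"
            using one[OF dist(1)[OF l]] one[OF dist(2)[OF x]] by simp
          fix z assume z: "z \<in> UHP"
          have "(\<lambda>n. fn n (snd (z, x n)) (fst (z, x n))) \<longlonglongrightarrow> f (snd (z, l)) (fst (z, l))"
            by (rule f_converge_moving_pair[OF mk fc]) (use x l z in \<open>auto intro!: tendsto_Pair lim\<close>)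
          then have "(\<lambda>n. fn n (x n) z) \<longlonglongrightarrow> f l z" by simp
          then have "(\<lambda>n. cauchy_F (mun n (x n)) z) \<longlonglongrightarrow> cauchy_F (mu l) z"
            unfolding F(1)[OF l z] F(2)[OF x z] .
          moreover have "cauchy_F (mu l) z \<noteq> 0"
            using real_distribution.cauchy_G_nonzero[OF dist(1)[OF l] z] by (simp add: cauchy_F_def)
          ultimately have "(\<lambda>n. 1 / cauchy_F (mun n (x n)) z) \<longlonglongrightarrow> 1 / cauchy_F (mu l) z"
            by (intro tendsto_divide tendsto_const)
          then show "(\<lambda>n. cauchy_G (mun n (x n)) z) \<longlonglongrightarrow> cauchy_G (mu l) z"
            by (simp add: cauchy_F_def)
        qed
      qed
    qed
    then show "weak_conv_loc_unif (I2le I) mun mu \<and> loc_unif_conv I seq.k k"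
      using mk by (simp add: mean_mass_converge_def)
  qed
qed

end

section \<open>Characteristic functions and moments\<close>

text \<open>
  The mean value inequality dominates the remainders of the difference quotients by \<open>2 * w\<close>.
\<close>

lemma has_vector_derivative_lebesgue_integral:
  fixes g :: "real \<Rightarrow> 'a \<Rightarrow> complex"
  assumes d: "\<And>\<eta> x. ((\<lambda>\<eta>. g \<eta> x) has_vector_derivative g' \<eta> x) (at \<eta>)"
    and bd: "\<And>\<eta> x. \<bar>\<eta> - \<xi>\<bar> \<le> 1 \<Longrightarrow> norm (g' \<eta> x) \<le> w x"
    and int: "\<And>\<eta>. integrable M (g \<eta>)" "integrable M (g' \<xi>)" "integrable M w"
  shows "((\<lambda>\<eta>. \<integral>x. g \<eta> x \<partial>M) has_vector_derivative (\<integral>x. g' \<xi> x \<partial>M)) (at \<xi>)"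
proof -
  define q where "q \<eta> x = (1 / \<bar>\<eta> - \<xi>\<bar>) *\<^sub>R (g \<eta> x - g \<xi> x - (\<eta> - \<xi>) *\<^sub>R g' \<xi> x)" for \<eta> x
  have qint: "integrable M (q \<eta>)" for \<eta>
    unfolding q_def by (intro integrable_scaleR_right Bochner_Integration.integrable_diff int)
  have qeq: "norm ((\<integral>x. g \<eta> x \<partial>M) - (\<integral>x. g \<xi> x \<partial>M) - (\<eta> - \<xi>) *\<^sub>R (\<integral>x. g' \<xi> x \<partial>M)) / norm (\<eta> - \<xi>)
     = norm (\<integral>x. q \<eta> x \<partial>M)" for \<eta>
  proof -
    have "(\<integral>x. q \<eta> x \<partial>M) = (1 / \<bar>\<eta> - \<xi>\<bar>) *\<^sub>R ((\<integral>x. g \<eta> x \<partial>M) - (\<integral>x. g \<xi> x \<partial>M) - (\<eta> - \<xi>) *\<^sub>R (\<integral>x. g' \<xi> x \<partial>M))"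
      unfolding q_def by (simp only: integral_scaleR_right Bochner_Integration.integral_diff int
          integrable_scaleR_right Bochner_Integration.integrable_diff)
    then show ?thesis by simp
  qed
  have qbd: "norm (q \<eta> x) \<le> 2 * w x" if "\<bar>\<eta> - \<xi>\<bar> \<le> 1" for \<eta> x
  proof -
    have seg: "\<bar>u - \<xi>\<bar> \<le> 1" if "u \<in> closed_segment \<xi> \<eta>" for u
    proof -
      have "norm (u - \<xi>) \<le> norm (\<eta> - \<xi>)" using that by (rule segment_bound1)
      then show ?thesis using \<open>\<bar>\<eta> - \<xi>\<bar> \<le> 1\<close> by simp
    qed
    have "norm (g \<eta> x - g \<xi> x - (\<eta> - \<xi>) *\<^sub>R g' \<xi> x) \<le> norm (\<eta> - \<xi>) * (2 * w x)"
    proof (rule vector_differentiable_bound_linearization[where S="closed_segment \<xi> \<eta>"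
          and f="\<lambda>\<eta>. g \<eta> x" and f'="\<lambda>\<eta>. g' \<eta> x"])
      show "((\<lambda>\<eta>. g \<eta> x) has_vector_derivative g' u x) (at u within closed_segment \<xi> \<eta>)" for u
        by (rule has_vector_derivative_at_within) (rule d)
      fix u assume "u \<in> closed_segment \<xi> \<eta>"
      then have "norm (g' u x) \<le> w x" by (intro bd seg)
      moreover have "norm (g' \<xi> x) \<le> w x" by (rule bd) simp
      ultimately show "norm (g' u x - g' \<xi> x) \<le> 2 * w x"
        using norm_triangle_ineq4[of "g' u x" "g' \<xi> x"] by linarith
    qed simp_all
    note rem = this
    have "norm (g' \<xi> x) \<le> w x" by (rule bd) simp
    then have "0 \<le> w x" by (rule order_trans[OF norm_ge_zero])
    then show ?thesis
    proof (cases "\<eta> = \<xi>")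
      case False
      then have "norm (q \<eta> x) = norm (g \<eta> x - g \<xi> x - (\<eta> - \<xi>) *\<^sub>R g' \<xi> x) / norm (\<eta> - \<xi>)" by (simp add: q_def)
      also have "\<dots> \<le> 2 * w x" using rem False by (subst pos_divide_le_eq) (simp_all add: mult.commute)
      finally show ?thesis .
    qed (simp add: q_def)
  qed
  have "((\<lambda>\<eta>. norm ((\<integral>x. g \<eta> x \<partial>M) - (\<integral>x. g \<xi> x \<partial>M) - (\<eta> - \<xi>) *\<^sub>R (\<integral>x. g' \<xi> x \<partial>M)) / norm (\<eta> - \<xi>)) \<longlongrightarrow> 0) (at \<xi>)"
    unfolding qeq tendsto_at_iff_sequentially o_def
  proof (intro allI impI)
    fix \<eta> :: "nat \<Rightarrow> real" assume \<eta>: "\<forall>i. \<eta> i \<in> UNIV - {\<xi>}" "\<eta> \<longlonglongrightarrow> \<xi>"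
    from LIMSEQ_D[OF \<eta>(2), of 1] obtain K where "\<forall>i\<ge>K. norm (\<eta> i - \<xi>) < 1" by auto
    then have K: "\<bar>\<eta> (i + K) - \<xi>\<bar> \<le> 1" for i by (simp add: less_imp_le)
    have "(\<lambda>i. \<integral>x. q (\<eta> (i + K)) x \<partial>M) \<longlonglongrightarrow> (\<integral>x. 0 \<partial>M)"
    proof (rule integral_dominated_convergence[where w="\<lambda>x. 2 * w x"])
      show "AE x in M. (\<lambda>i. q (\<eta> (i + K)) x) \<longlonglongrightarrow> 0"
      proof (rule AE_I2)
        fix x
        have "((\<lambda>u. norm (g u x - g \<xi> x - (u - \<xi>) *\<^sub>R g' \<xi> x) / norm (u - \<xi>)) \<longlongrightarrow> 0) (at \<xi>)"
          using d[of x \<xi>, unfolded has_vector_derivative_def has_derivative_iff_norm] by (rule conjunct2)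
        from this[unfolded tendsto_at_iff_sequentially o_def, rule_format, OF \<eta>(1)[rule_format] \<eta>(2)]
        have "(\<lambda>i. norm (g (\<eta> i) x - g \<xi> x - (\<eta> i - \<xi>) *\<^sub>R g' \<xi> x) / norm (\<eta> i - \<xi>)) \<longlonglongrightarrow> 0" .
        then have "(\<lambda>i. norm (q (\<eta> i) x)) \<longlonglongrightarrow> 0" by (simp add: q_def)
        then have "(\<lambda>i. q (\<eta> i) x) \<longlonglongrightarrow> 0" by (rule tendsto_norm_zero_cancel)
        then show "(\<lambda>i. q (\<eta> (i + K)) x) \<longlonglongrightarrow> 0" by (rule LIMSEQ_ignore_initial_segment)
      qed
      show "AE x in M. norm (q (\<eta> (i + K)) x) \<le> 2 * w x" for i
        using qbd[OF K[of i]] by (intro AE_I2)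
      show "integrable M (\<lambda>x. 2 * w x)" using int(3) by (rule integrable_mult_right)
      show "q (\<eta> (i + K)) \<in> borel_measurable M" for i by (rule borel_measurable_integrable[OF qint])
    qed simp
    then have "(\<lambda>i. norm (\<integral>x. q (\<eta> (i + K)) x \<partial>M)) \<longlonglongrightarrow> 0" by (simp add: tendsto_norm_zero)
    then show "(\<lambda>i. norm (\<integral>x. q (\<eta> i) x \<partial>M)) \<longlonglongrightarrow> 0" by (rule LIMSEQ_offset)
  qed
  then show ?thesis
    unfolding has_vector_derivative_def has_derivative_iff_norm by (simp add: bounded_linear_scaleR_left)
qed

lemma iexp_has_vector_derivative:
  "((\<lambda>\<eta>. iexp (\<eta> * x)) has_vector_derivative \<i> * of_real x * iexp (\<xi> * x)) (at \<xi>)"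
proof -
  have "((\<lambda>\<eta>. \<eta> * x) has_vector_derivative x) (at \<xi>)"
    by (auto intro!: derivative_eq_intros simp: has_real_derivative_iff_has_vector_derivative[symmetric])
  from vector_diff_chain_at[OF this has_vector_derivative_iexp]
  show ?thesis by (simp add: o_def scaleR_conv_of_real ac_simps)
qed

text \<open>
  The characteristic function is differentiated twice in two ways: under the integral sign, and as
  \<open>exp \<circ> \<psi>\<close>.
\<close>

lemma (in real_distribution) char_exponent_derivatives:
  assumes sq: "integrable M (\<lambda>x. x\<^sup>2)"
    and char: "\<And>\<xi>. char M \<xi> = exp (\<psi> \<xi>)"
    and \<psi>1: "\<And>\<xi>. (\<psi> has_vector_derivative \<psi>1 \<xi>) (at \<xi>)"
    and \<psi>2: "\<And>\<xi>. (\<psi>1 has_vector_derivative \<psi>2 \<xi>) (at \<xi>)"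
  shows "(\<integral>x. of_real x * iexp (\<xi> * x) \<partial>M) = - \<i> * \<psi>1 \<xi> * char M \<xi>"
    and "(\<integral>x. of_real (x\<^sup>2) * iexp (\<xi> * x) \<partial>M) = - (\<psi>2 \<xi> + (\<psi>1 \<xi>)\<^sup>2) * char M \<xi>"
proof -
  have i1: "integrable M (\<lambda>x. x)" by (rule square_integrable_imp_integrable[where f="\<lambda>x. x", OF _ sq]) simp
  have int0: "integrable M (\<lambda>x. iexp (\<eta> * x))" for \<eta>
    by (rule integrable_const_bound[where B=1]) auto
  have int1: "integrable M (\<lambda>x. \<i> * of_real x * iexp (\<eta> * x))" for \<eta>
    by (rule Bochner_Integration.integrable_bound[OF i1]) (auto simp: norm_mult)
  have int2: "integrable M (\<lambda>x. - of_real (x\<^sup>2) * iexp (\<eta> * x))" for \<eta>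
    by (rule Bochner_Integration.integrable_bound[OF sq]) (auto simp: norm_mult norm_power)
  have D1: "((\<lambda>\<eta>. char M \<eta>) has_vector_derivative (\<integral>x. \<i> * of_real x * iexp (\<xi> * x) \<partial>M)) (at \<xi>)" for \<xi>
    unfolding char_def
    by (rule has_vector_derivative_lebesgue_integral[where w="\<lambda>x. \<bar>x\<bar>", OF iexp_has_vector_derivative _ int0 int1])
       (use i1 in \<open>auto simp: norm_mult\<close>)
  have D2: "((\<lambda>\<eta>. \<integral>x. \<i> * of_real x * iexp (\<eta> * x) \<partial>M) has_vector_derivative (\<integral>x. - of_real (x\<^sup>2) * iexp (\<xi> * x) \<partial>M)) (at \<xi>)" for \<xi>
  proof (rule has_vector_derivative_lebesgue_integral[where w="\<lambda>x. x\<^sup>2", OF _ _ int1 int2 sq])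
    fix \<eta> x :: real
    have "((\<lambda>\<eta>. (\<i> * of_real x) * iexp (\<eta> * x)) has_vector_derivative (\<i> * of_real x) * (\<i> * of_real x * iexp (\<eta> * x))) (at \<eta>)"
      by (intro has_vector_derivative_mult_right iexp_has_vector_derivative)
    moreover have "(\<i> * of_real x) * (\<i> * of_real x * iexp (\<eta> * x)) = - of_real (x\<^sup>2) * iexp (\<eta> * x)"
    proof -
      have "(\<i> * a) * (\<i> * a * e) = (\<i> * \<i>) * (a\<^sup>2 * e)" for a e :: complex
        by (simp only: power2_eq_square ac_simps)
      then show ?thesis by simp
    qed
    ultimately show "((\<lambda>\<eta>. \<i> * of_real x * iexp (\<eta> * x)) has_vector_derivative - of_real (x\<^sup>2) * iexp (\<eta> * x)) (at \<eta>)"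
      by (simp only:)
  qed (auto simp: norm_mult norm_power)
  have C: "((\<lambda>\<eta>. char M \<eta>) has_vector_derivative \<psi>1 \<xi> * char M \<xi>) (at \<xi>)" for \<xi>
    using field_vector_diff_chain_at[OF \<psi>1 DERIV_exp] unfolding o_def char .
  have eq1: "(\<integral>x. \<i> * of_real x * iexp (\<xi> * x) \<partial>M) = \<psi>1 \<xi> * char M \<xi>" for \<xi>
    by (rule vector_derivative_unique_at[OF D1 C])
  have "((\<lambda>\<eta>. \<psi>1 \<eta> * char M \<eta>) has_vector_derivative \<psi>1 \<xi> * (\<psi>1 \<xi> * char M \<xi>) + \<psi>2 \<xi> * char M \<xi>) (at \<xi>)"
    by (rule has_vector_derivative_mult[OF \<psi>2 C])
  from vector_derivative_unique_at[OF D2[unfolded eq1] this]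
  have eq2: "(\<integral>x. - of_real (x\<^sup>2) * iexp (\<xi> * x) \<partial>M) = \<psi>1 \<xi> * (\<psi>1 \<xi> * char M \<xi>) + \<psi>2 \<xi> * char M \<xi>" .
  have "\<i> * (\<integral>x. of_real x * iexp (\<xi> * x) \<partial>M) = \<psi>1 \<xi> * char M \<xi>"
    unfolding eq1[symmetric] by (simp add: mult.assoc)
  then have "- \<i> * (\<i> * (\<integral>x. of_real x * iexp (\<xi> * x) \<partial>M)) = - \<i> * (\<psi>1 \<xi> * char M \<xi>)" by (rule arg_cong)
  then show "(\<integral>x. of_real x * iexp (\<xi> * x) \<partial>M) = - \<i> * \<psi>1 \<xi> * char M \<xi>" by simp
  have "- (\<integral>x. of_real (x\<^sup>2) * iexp (\<xi> * x) \<partial>M) = (\<psi>2 \<xi> + (\<psi>1 \<xi>)\<^sup>2) * char M \<xi>"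
    using eq2 by (simp add: power2_eq_square algebra_simps)
  then show "(\<integral>x. of_real (x\<^sup>2) * iexp (\<xi> * x) \<partial>M) = - (\<psi>2 \<xi> + (\<psi>1 \<xi>)\<^sup>2) * char M \<xi>"
    by (metis minus_mult_left minus_minus)
qed

lemma (in real_distribution) Var_eq:
  assumes sq: "integrable M (\<lambda>x. x\<^sup>2)"
  shows "Var M = (\<integral>x. x\<^sup>2 \<partial>M) - (\<integral>x. x \<partial>M)\<^sup>2"
  unfolding Var_def
  by (rule variance_eq[OF square_integrable_imp_integrable[where f="\<lambda>x. x", OF _ sq] sq]) simp

lemma bdd_contI: "continuous_on UNIV \<phi> \<Longrightarrow> (\<And>x. \<bar>\<phi> x\<bar> \<le> B) \<Longrightarrow> bdd_cont \<phi>"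
  unfolding bdd_cont_def bounded_iff by auto

text \<open>
  More than half of the mass stays in a fixed compact set. If the mean were far away from it, this part alone
  would make the variance large.
\<close>

lemma means_bounded_if_weak_Var:
  fixes M :: "nat \<Rightarrow> real measure"
  assumes dist: "\<And>n. real_distribution (M n)" "real_distribution N"
    and sq: "\<And>n. integrable (M n) (\<lambda>x. x\<^sup>2)"
    and weak: "\<And>\<phi>. bdd_cont \<phi> \<Longrightarrow> (\<lambda>n. integral\<^sup>L (M n) \<phi>) \<longlonglongrightarrow> integral\<^sup>L N \<phi>"
    and Var: "\<And>n. Var (M n) \<le> V"
  shows "\<exists>A. \<forall>\<^sub>F n in sequentially. \<bar>\<integral>x. x \<partial>M n\<bar> \<le> A"
proof -
  interpret M: real_distribution "M n" for n by fact
  interpret N: real_distribution N by fact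
  have c: "continuous_on UNIV (cutoff R)" for R by (rule continuous_cutoff)
  have cut01: "0 \<le> cutoff R x" "cutoff R x \<le> 1" for R x by (rule cutoff_bounds)+
  have bc: "bdd_cont (cutoff R)" for R using c cut01 by (intro bdd_contI[where B=1]) auto
  have "(\<lambda>j. integral\<^sup>L N (cutoff (real j))) \<longlonglongrightarrow> 1"
    using N.integral_cutoff_tendsto_mass N.prob_space by simp
  from order_tendstoD(1)[OF this, of "1/2"]
  obtain j where j: "integral\<^sup>L N (cutoff (real j)) > 1/2" by (auto simp: eventually_sequentially)
  define R where "R = real j + 1"
  have "\<forall>\<^sub>F n in sequentially. integral\<^sup>L (M n) (cutoff (real j)) > 1/2"
    by (rule order_tendstoD(1)[OF weak[OF bc] j])
  \<comment> \<open>half of the mass at distance \<open>1 + 2 * V\<close> from the mean contributes \<open>(1 + 2 * V)\<^sup>2 / 2 > V\<close>\<close>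
  then have "\<forall>\<^sub>F n in sequentially. \<bar>\<integral>x. x \<partial>M n\<bar> \<le> R + (1 + 2 * V)"
  proof eventually_elim
    case (elim n)
    let ?a = "\<integral>x. x \<partial>M n"
    have V: "Var (M n) = (\<integral>x. (x - ?a)\<^sup>2 \<partial>M n)" by (simp add: Var_def)
    have i1: "integrable (M n) (\<lambda>x. x)"
      by (rule M.square_integrable_imp_integrable[where f="\<lambda>x. x", OF _ sq]) simp
    show ?case
    proof (rule ccontr)
      assume "\<not> ?thesis"
      then have big: "\<bar>?a\<bar> > R + (1 + 2 * V)" by simp
      have V0: "0 \<le> V" using Var[of n] M.variance_positive[of n "\<lambda>x. x"] unfolding Var_def by linarith
      have isq: "integrable (M n) (\<lambda>x. (x - ?a)\<^sup>2)"
      proof -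
        have "integrable (M n) (\<lambda>x. (x\<^sup>2 + ?a\<^sup>2) - (2 * ?a) * x)"
          by (rule Bochner_Integration.integrable_diff[OF Bochner_Integration.integrable_add[OF sq M.integrable_const]
                integrable_mult_right[OF i1]])
        then show ?thesis by (simp add: power2_diff mult.commute mult.left_commute)
      qed
      have pt: "(1 + 2 * V)\<^sup>2 * cutoff (real j) x \<le> (x - ?a)\<^sup>2" for x
      proof (cases "\<bar>x\<bar> \<le> R")
        case True
        then have "1 + 2 * V \<le> \<bar>x - ?a\<bar>" using big by linarith
        then have "(1 + 2 * V)\<^sup>2 \<le> \<bar>x - ?a\<bar>\<^sup>2" using V0 by (intro power_mono) auto
        moreover have "(1 + 2 * V)\<^sup>2 * cutoff (real j) x \<le> (1 + 2 * V)\<^sup>2 * 1" using cut01 by (intro mult_left_mono) auto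
        ultimately show ?thesis by simp
      next
        case False
        then have "cutoff (real j) x = 0" by (simp add: cutoff_def R_def)
        then show ?thesis by simp
      qed
      have icut: "integrable (M n) (cutoff (real j))"
        using c cut01 by (intro M.integrable_bounded_continuous[where B=1]) auto
      have "(1 + 2 * V)\<^sup>2 * integral\<^sup>L (M n) (cutoff (real j)) = (\<integral>x. (1 + 2 * V)\<^sup>2 * cutoff (real j) x \<partial>M n)" by simp
      also have "\<dots> \<le> Var (M n)" unfolding V by (intro integral_mono pt isq integrable_mult_right icut)
      also have "\<dots> \<le> V" by (rule Var)
      finally have "(1 + 2 * V)\<^sup>2 * integral\<^sup>L (M n) (cutoff (real j)) \<le> V" .
      moreover have "(1 + 2 * V)\<^sup>2 * (1 / 2) \<le> (1 + 2 * V)\<^sup>2 * integral\<^sup>L (M n) (cutoff (real j))"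
        using elim by (intro mult_left_mono) auto
      ultimately have "(1 + 2 * V)\<^sup>2 \<le> 2 * V" by linarith
      moreover have "(1 + 2 * V)\<^sup>2 = 1 + 4 * V + 4 * V\<^sup>2" by (simp add: power2_eq_square algebra_simps)
      ultimately show False using V0 zero_le_power2[of V] by linarith
    qed
  qed
  then show ?thesis by blast
qed

text \<open>
  The second moments are bounded because the means and the variances are. Hence the first moments are limits of
  truncated ones, uniformly in \<open>n\<close>, and second moments are variances plus squared means.
\<close>

theorem moments_converge_if_weak_Var:
  fixes M :: "nat \<Rightarrow> real measure"
  assumes dist: "\<And>n. real_distribution (M n)" "real_distribution N"
    and sq: "\<And>n. integrable (M n) (\<lambda>x. x\<^sup>2)" "integrable N (\<lambda>x. x\<^sup>2)"
    and weak: "\<And>\<phi>. bdd_cont \<phi> \<Longrightarrow> (\<lambda>n. integral\<^sup>L (M n) \<phi>) \<longlonglongrightarrow> integral\<^sup>L N \<phi>"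
    and Var: "(\<lambda>n. Var (M n)) \<longlonglongrightarrow> Var N"
  shows "(\<lambda>n. \<integral>x. x \<partial>M n) \<longlonglongrightarrow> (\<integral>x. x \<partial>N)"
    and "(\<lambda>n. \<integral>x. x\<^sup>2 \<partial>M n) \<longlonglongrightarrow> (\<integral>x. x\<^sup>2 \<partial>N)"
proof -
  interpret M: real_distribution "M n" for n by fact
  interpret N: real_distribution N by fact
  have i1: "integrable (M n) (\<lambda>x. x)" "integrable N (\<lambda>x. x)" for n
    by (rule M.square_integrable_imp_integrable[where f="\<lambda>x. x", OF _ sq(1)], simp)
       (rule N.square_integrable_imp_integrable[where f="\<lambda>x. x", OF _ sq(2)], simp)
  have "Bseq (\<lambda>n. Var (M n))" using Var by (intro convergent_imp_Bseq) (auto simp: convergent_def)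
  then obtain V where V: "\<And>n. norm (Var (M n)) \<le> V" unfolding Bseq_def by blast
  have V': "Var (M n) \<le> V" for n using V[of n] by simp
  obtain A where A: "\<forall>\<^sub>F n in sequentially. \<bar>\<integral>x. x \<partial>M n\<bar> \<le> A"
    using means_bounded_if_weak_Var[OF dist sq(1) weak V'] by (rule exE)
  define S where "S = max (V + A\<^sup>2) (\<integral>x. x\<^sup>2 \<partial>N)"
  have S: "\<forall>\<^sub>F n in sequentially. (\<integral>x. x\<^sup>2 \<partial>M n) \<le> S"
    using A
  proof eventually_elim
    case (elim n)
    have "(\<integral>x. x \<partial>M n)\<^sup>2 \<le> A\<^sup>2" using power_mono[OF elim abs_ge_zero, of 2] by simp
    then show ?case using M.Var_eq[OF sq(1), of n] V'[of n] by (simp add: S_def)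
  qed
  have SN: "(\<integral>x. x\<^sup>2 \<partial>N) \<le> S" by (simp add: S_def)
  moreover have "0 \<le> (\<integral>x. x\<^sup>2 \<partial>N)" by simp
  ultimately have S0: "S \<ge> 0" by linarith
  define clamp where "clamp R x = max (- R) (min R x)" for R x :: real
  have cc: "continuous_on UNIV (clamp R)" for R unfolding clamp_def by (intro continuous_intros)
  have cb: "\<bar>clamp R x\<bar> \<le> R" if "R > 0" for R x using that by (auto simp: clamp_def)
  have cd: "\<bar>x - clamp R x\<bar> \<le> x\<^sup>2 / R" if "R > 0" for R x
  proof (cases "\<bar>x\<bar> \<le> R")
    case True then show ?thesis using that by (auto simp: clamp_def)
  next
    case False
    then have "\<bar>x - clamp R x\<bar> \<le> \<bar>x\<bar>" using that by (auto simp: clamp_def)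
    also have "\<dots> \<le> \<bar>x\<bar> * (\<bar>x\<bar> / R)" using False that mult_left_mono[of 1 "\<bar>x\<bar> / R" "\<bar>x\<bar>"] by simp
    also have "\<dots> = x\<^sup>2 / R" by (simp add: power2_eq_square)
    finally show ?thesis .
  qed
  have trunc: "\<bar>(\<integral>x. x \<partial>L) - integral\<^sup>L L (clamp R)\<bar> \<le> S / R"
    if L: "real_distribution L" "integrable L (\<lambda>x. x)" "integrable L (\<lambda>x. x\<^sup>2)" "(\<integral>x. x\<^sup>2 \<partial>L) \<le> S" and R: "R > 0" for L R
  proof -
    interpret L: real_distribution L by fact
    have ic: "integrable L (clamp R)" using cc cb[OF R] by (intro L.integrable_bounded_continuous[where B=R]) auto
    have "\<bar>(\<integral>x. x \<partial>L) - integral\<^sup>L L (clamp R)\<bar> = \<bar>\<integral>x. x - clamp R x \<partial>L\<bar>" using L ic by simp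
    also have "\<dots> \<le> (\<integral>x. \<bar>x - clamp R x\<bar> \<partial>L)" by (rule integral_abs_bound)
    also have "\<dots> \<le> (\<integral>x. x\<^sup>2 / R \<partial>L)"
      by (rule integral_mono) (use L ic cd[OF R] in auto)
    also have "\<dots> = (\<integral>x. x\<^sup>2 \<partial>L) / R" by simp
    also have "\<dots> \<le> S / R" using L(4) R by (intro divide_right_mono) auto
    finally show ?thesis .
  qed
  show mean: "(\<lambda>n. \<integral>x. x \<partial>M n) \<longlonglongrightarrow> (\<integral>x. x \<partial>N)"
  proof (rule LIMSEQ_I)
    fix \<epsilon> :: real assume \<epsilon>: "\<epsilon> > 0"
    define R where "R = 3 * (S + 1) / \<epsilon>"
    have R: "R > 0" using \<epsilon> S0 by (simp add: R_def)
    have "S / R = \<epsilon> * S / (3 * (S + 1))" by (simp add: R_def)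
    also have "\<dots> < \<epsilon> / 3" using \<epsilon> S0 by (simp add: field_simps)
    finally have SR: "S / R < \<epsilon> / 3" .
    have "bdd_cont (clamp R)" using cc cb[OF R] by (rule bdd_contI)
    from tendstoD[OF weak[OF this], of "\<epsilon> / 3"] \<epsilon>
    have "\<forall>\<^sub>F n in sequentially. dist (integral\<^sup>L (M n) (clamp R)) (integral\<^sup>L N (clamp R)) < \<epsilon> / 3" by simp
    then have "\<forall>\<^sub>F n in sequentially. norm ((\<integral>x. x \<partial>M n) - (\<integral>x. x \<partial>N)) < \<epsilon>"
      using S
    proof eventually_elim
      case (elim n)
      show ?case
        using elim(1) trunc[OF dist(1) i1(1) sq(1) elim(2) R] trunc[OF dist(2) i1(2) sq(2) SN R] SR
        unfolding dist_real_def real_norm_def by linarith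
    qed
    then show "\<exists>no. \<forall>n\<ge>no. norm ((\<integral>x. x \<partial>M n) - (\<integral>x. x \<partial>N)) < \<epsilon>" by (simp add: eventually_sequentially)
  qed
  have "(\<lambda>n. Var (M n) + (\<integral>x. x \<partial>M n)\<^sup>2) \<longlonglongrightarrow> Var N + (\<integral>x. x \<partial>N)\<^sup>2"
    by (intro tendsto_intros Var mean)
  then show "(\<lambda>n. \<integral>x. x\<^sup>2 \<partial>M n) \<longlonglongrightarrow> (\<integral>x. x\<^sup>2 \<partial>N)"
    using M.Var_eq[OF sq(1)] N.Var_eq[OF sq(2)] by simp
qed

text \<open>
  The measures \<open>(1 + x\<^sup>2) M n(dx)\<close> converge vaguely and, by convergence of the second moments, in
  total mass, hence weakly; a test function of quadratic growth becomes bounded on division by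
  \<open>1 + x\<^sup>2\<close>.
\<close>

lemma quadratic_test_functions_converge:
  fixes M :: "nat \<Rightarrow> real measure" and \<psi> :: "real \<Rightarrow> complex"
  assumes dist: "\<And>n. real_distribution (M n)" "real_distribution N"
    and sq: "\<And>n. integrable (M n) (\<lambda>x. x\<^sup>2)" "integrable N (\<lambda>x. x\<^sup>2)"
    and weak: "\<And>\<phi>. bdd_cont \<phi> \<Longrightarrow> (\<lambda>n. integral\<^sup>L (M n) \<phi>) \<longlonglongrightarrow> integral\<^sup>L N \<phi>"
    and Var: "(\<lambda>n. Var (M n)) \<longlonglongrightarrow> Var N"
    and \<psi>: "continuous_on UNIV \<psi>" "\<And>x. norm (\<psi> x) \<le> B * (1 + x\<^sup>2)"
  shows "(\<lambda>n. integral\<^sup>L (M n) \<psi>) \<longlonglongrightarrow> integral\<^sup>L N \<psi>"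
proof -
  define W where "W L = density L (\<lambda>x::real. ennreal (1 + x\<^sup>2))" for L
  have pos: "1 + x\<^sup>2 > 0" for x :: real by (simp add: add_pos_nonneg)
  have W: "finite_borel_measure (W L)" "measure (W L) UNIV = 1 + (\<integral>x. x\<^sup>2 \<partial>L)"
    "\<And>f :: real \<Rightarrow> real. f \<in> borel_measurable borel \<Longrightarrow> integral\<^sup>L (W L) f = (\<integral>x. (1 + x\<^sup>2) * f x \<partial>L)"
    "\<And>f :: real \<Rightarrow> complex. f \<in> borel_measurable borel \<Longrightarrow> integral\<^sup>L (W L) f = (\<integral>x. of_real (1 + x\<^sup>2) * f x \<partial>L)"
    if L: "real_distribution L" "integrable L (\<lambda>x. x\<^sup>2)" for L
  proof -
    interpret L: real_distribution L by fact
    have int: "integrable L (\<lambda>x. 1 + x\<^sup>2)" using L(2) by simp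
    have I: "(\<integral>x. 1 + x\<^sup>2 \<partial>L) = 1 + (\<integral>x. x\<^sup>2 \<partial>L)" using L(2) L.prob_space by simp
    have em: "emeasure (W L) UNIV = ennreal (1 + (\<integral>x. x\<^sup>2 \<partial>L))"
      unfolding I[symmetric] W_def using int pos
      by (subst emeasure_density) (simp_all add: nn_integral_eq_integral less_imp_le del: ennreal_plus)
    show "finite_borel_measure (W L)"
      by (intro finite_borel_measure.intro finite_measureI finite_borel_measure_axioms.intro)
         (use em in \<open>simp_all add: W_def\<close>)
    have "0 \<le> (\<integral>x. x\<^sup>2 \<partial>L)" by simp
    then show "measure (W L) UNIV = 1 + (\<integral>x. x\<^sup>2 \<partial>L)" using em by (simp add: measure_def del: ennreal_plus)
    show "integral\<^sup>L (W L) f = (\<integral>x. (1 + x\<^sup>2) * f x \<partial>L)" if "f \<in> borel_measurable borel" for f :: "real \<Rightarrow> real"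
      unfolding W_def using that pos by (subst integral_density) (auto simp: less_imp_le)
    show "integral\<^sup>L (W L) f = (\<integral>x. of_real (1 + x\<^sup>2) * f x \<partial>L)" if "f \<in> borel_measurable borel" for f :: "real \<Rightarrow> complex"
      unfolding W_def using that pos by (subst integral_density) (auto simp: less_imp_le scaleR_conv_of_real)
  qed
  have fin: "\<And>n. finite_borel_measure (W (M n))" "finite_borel_measure (W N)"
    by (rule W(1)[OF dist(1) sq(1)], rule W(1)[OF dist(2) sq(2)])
  have Wweak: "(\<lambda>n. integral\<^sup>L (W (M n)) \<phi>) \<longlonglongrightarrow> integral\<^sup>L (W N) \<phi>" if \<phi>: "bdd_cont \<phi>" for \<phi>
  proof (rule vague_mass_imp_weak[OF fin _ _ \<phi>])
    show "(\<lambda>n. measure (W (M n)) UNIV) \<longlonglongrightarrow> measure (W N) UNIV"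
      unfolding W(2)[OF dist(1) sq(1)] W(2)[OF dist(2) sq(2)]
      by (intro tendsto_intros moments_converge_if_weak_Var(2)[OF dist sq weak Var])
    fix \<phi> :: "real \<Rightarrow> real" assume c: "continuous_on UNIV \<phi>" and "\<exists>R. \<forall>x. \<bar>x\<bar> \<ge> R \<longrightarrow> \<phi> x = 0"
    then obtain R where R: "\<And>x. \<bar>x\<bar> \<ge> R \<Longrightarrow> \<phi> x = 0" by blast
    have m: "\<phi> \<in> borel_measurable borel" using c by (rule borel_measurable_continuous_onI)
    have "bdd_cont (\<lambda>x. (1 + x\<^sup>2) * \<phi> x)"
      by (rule bdd_cont_if_compact_support[where R=R]) (use c R in \<open>auto intro!: continuous_intros\<close>)
    from weak[OF this] show "(\<lambda>n. integral\<^sup>L (W (M n)) \<phi>) \<longlonglongrightarrow> integral\<^sup>L (W N) \<phi>"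
      unfolding W(3)[OF dist(1) sq(1) m] W(3)[OF dist(2) sq(2) m] .
  qed
  define f where "f x = \<psi> x / of_real (1 + x\<^sup>2)" for x
  have nz: "complex_of_real (1 + x\<^sup>2) \<noteq> 0" for x using pos[of x] by (simp only: of_real_eq_0_iff)
  have f: "continuous_on UNIV f" unfolding f_def using \<psi>(1) nz by (intro continuous_intros) auto
  have fb: "norm (f x) \<le> B" for x
  proof -
    have "norm (f x) = norm (\<psi> x) / (1 + x\<^sup>2)" unfolding f_def norm_divide norm_of_real using pos[of x] by simp
    then show ?thesis using \<psi>(2)[of x] pos[of x] by (simp add: pos_divide_le_eq)
  qed
  have m: "f \<in> borel_measurable borel" using f by (rule borel_measurable_continuous_onI)
  have "of_real (1 + x\<^sup>2) * f x = \<psi> x" for x unfolding f_def using nz by simp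
  then show ?thesis
    using complex_integral_converges_if_weak[OF fin Wweak f fb]
    unfolding W(4)[OF dist(1) sq(1) m] W(4)[OF dist(2) sq(2) m] by simp
qed

text \<open>
  Normalisation reduces this to Levy's continuity theorem, except when the limit is zero and the masses
  tend to zero.
\<close>

lemma weak_if_fourier_transforms_converge:
  fixes M :: "nat \<Rightarrow> real measure"
  assumes fin: "\<And>n. finite_borel_measure (M n)" "finite_borel_measure N"
    and char: "\<And>\<xi>. (\<lambda>n. CLINT x|M n. iexp (\<xi> * x)) \<longlonglongrightarrow> (CLINT x|N. iexp (\<xi> * x))"
    and \<phi>: "bdd_cont \<phi>"
  shows "(\<lambda>n. integral\<^sup>L (M n) \<phi>) \<longlonglongrightarrow> integral\<^sup>L N \<phi>"
proof -
  interpret M: finite_borel_measure "M n" for n by fact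
  interpret N: finite_borel_measure N by fact
  have c\<phi>: "continuous_on UNIV \<phi>" using \<phi> by (simp add: bdd_cont_def)
  obtain B where B: "\<And>x. \<bar>\<phi> x\<bar> \<le> B" using \<phi> unfolding bdd_cont_def bounded_iff by auto
  have "(\<lambda>n. complex_of_real (measure (M n) UNIV)) \<longlonglongrightarrow> of_real (measure N UNIV)"
    using char[of 0] by (simp add: M.borel_UNIV N.borel_UNIV scaleR_conv_of_real)
  then have mass: "(\<lambda>n. measure (M n) UNIV) \<longlonglongrightarrow> measure N UNIV" by (simp only: tendsto_of_real_iff)
  show ?thesis
  proof (cases "measure N UNIV = 0")
    case True
    have bd: "\<bar>integral\<^sup>L (M n) \<phi>\<bar> \<le> B * measure (M n) UNIV" for n
      using M.norm_integral_le_mass[of \<phi> B n] c\<phi> B by simp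
    have "integral\<^sup>L N \<phi> = 0" using N.norm_integral_le_mass[of \<phi> B] c\<phi> B True by simp
    moreover have "(\<lambda>n. integral\<^sup>L (M n) \<phi>) \<longlonglongrightarrow> 0"
    proof (rule Lim_null_comparison)
      show "\<forall>\<^sub>F n in sequentially. norm (integral\<^sup>L (M n) \<phi>) \<le> B * measure (M n) UNIV" using bd by simp
      show "(\<lambda>n. B * measure (M n) UNIV) \<longlonglongrightarrow> 0" using tendsto_mult_left[OF mass, of B] True by simp
    qed
    ultimately show ?thesis by simp
  next
    case False
    then have pos: "measure N UNIV > 0" by (simp add: zero_less_measure_iff)
    define nm where "nm L = density L (\<lambda>_. ennreal (1 / measure L UNIV))" for L :: "real measure"
    have nm: "real_distribution (nm L)" "\<And>f :: real \<Rightarrow> complex. f \<in> borel_measurable borel \<Longrightarrow>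
        integral\<^sup>L (nm L) f = of_real (1 / measure L UNIV) * integral\<^sup>L L f"
      if L: "finite_borel_measure L" "measure L UNIV > 0" for L
    proof -
      note d = density_const_finite_borel_measure[OF L(1), of "1 / measure L UNIV"]
      show "\<And>f :: real \<Rightarrow> complex. f \<in> borel_measurable borel \<Longrightarrow>
        integral\<^sup>L (nm L) f = of_real (1 / measure L UNIV) * integral\<^sup>L L f" unfolding nm_def by (rule d(3)) (use L in simp_all)
      interpret D: finite_borel_measure "nm L" unfolding nm_def by (rule d(1)) (use L in simp)
      have "measure (nm L) UNIV = 1" unfolding nm_def using d(2) L by simp
      then have "emeasure (nm L) (space (nm L)) = 1" by (simp add: D.borel_UNIV D.emeasure_eq_measure)
      then show "real_distribution (nm L)"
        by (intro real_distribution.intro prob_spaceI real_distribution_axioms.intro D.M_is_borel)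
    qed
    have "\<forall>\<^sub>F n in sequentially. measure (M n) UNIV > 0" by (rule order_tendstoD(1)[OF mass pos])
    then obtain n0 where n0: "\<And>n. measure (M (n + n0)) UNIV > 0" unfolding eventually_sequentially by (metis le_add2)
    have mass0: "(\<lambda>n. measure (M (n + n0)) UNIV) \<longlonglongrightarrow> measure N UNIV" by (rule LIMSEQ_ignore_initial_segment[OF mass])
    have "weak_conv_m (\<lambda>n. nm (M (n + n0))) (nm N)"
    proof (rule levy_continuity[OF nm(1)[OF fin(1) n0] nm(1)[OF fin(2) pos]])
      fix \<xi>
      have m: "(\<lambda>x. iexp (\<xi> * x)) \<in> borel_measurable borel" by measurable
      show "(\<lambda>n. char (nm (M (n + n0))) \<xi>) \<longlonglongrightarrow> char (nm N) \<xi>"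
        unfolding char_def nm(2)[OF fin(1) n0 m] nm(2)[OF fin(2) pos m]
        by (intro tendsto_mult tendsto_of_real tendsto_divide tendsto_const mass0 LIMSEQ_ignore_initial_segment[OF char])
           (use pos in simp)
    qed
    then have lim: "(\<lambda>n. integral\<^sup>L (nm (M (n + n0))) (\<lambda>x. complex_of_real (\<phi> x))) \<longlonglongrightarrow> integral\<^sup>L (nm N) (\<lambda>x. complex_of_real (\<phi> x))"
    proof (rule weak_conv_imp_integral_bdd_continuous_conv[OF nm(1)[OF fin(1) n0] nm(1)[OF fin(2) pos], where B=B])
      show "isCont (\<lambda>x. complex_of_real (\<phi> x)) x" for x
        using c\<phi> by (intro continuous_of_real) (simp add: continuous_on_eq_continuous_at)
    qed (use B in simp)
    have m\<phi>: "(\<lambda>x. complex_of_real (\<phi> x)) \<in> borel_measurable borel"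
      using c\<phi> by (intro borel_measurable_continuous_onI continuous_intros)
    from tendsto_mult[OF tendsto_of_real[OF mass0] lim[unfolded nm(2)[OF fin(1) n0 m\<phi>] nm(2)[OF fin(2) pos m\<phi>]]]
    have "(\<lambda>n. of_real (measure (M (n + n0)) UNIV) * (of_real (1 / measure (M (n + n0)) UNIV) * (CLINT x|M (n + n0). of_real (\<phi> x))))
      \<longlonglongrightarrow> of_real (measure N UNIV) * (of_real (1 / measure N UNIV) * (CLINT x|N. of_real (\<phi> x)))"
      .
    moreover have cancel: "of_real r * (of_real (1 / r) * z) = z" if "r > 0" for r and z :: complex using that by simp
    ultimately have "(\<lambda>n. CLINT x|M (n + n0). of_real (\<phi> x)) \<longlonglongrightarrow> (CLINT x|N. of_real (\<phi> x))"
      unfolding cancel[OF n0] cancel[OF pos] by simp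
    then have "(\<lambda>n. integral\<^sup>L (M (n + n0)) \<phi>) \<longlonglongrightarrow> integral\<^sup>L N \<phi>"
      unfolding integral_complex_of_real by (simp only: tendsto_of_real_iff)
    then show ?thesis by (rule LIMSEQ_offset)
  qed
qed

lemma char_convolution:
  assumes "real_distribution M" "real_distribution N"
  shows "char (M \<star> N) \<xi> = char M \<xi> * char N \<xi>"
proof -
  interpret M: real_distribution M by fact
  interpret N: real_distribution N by fact
  interpret P: pair_prob_space M N ..
  have m: "(\<lambda>(x, y). x + y) \<in> borel_measurable (M \<Otimes>\<^sub>M N)" by measurable
  have "char (M \<star> N) \<xi> = (CLINT p|M \<Otimes>\<^sub>M N. iexp (\<xi> * (case p of (x, y) \<Rightarrow> x + y)))"
    unfolding char_def convolution_def by (rule integral_distr[OF m]) measurable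
  also have "\<dots> = (CLINT p|M \<Otimes>\<^sub>M N. iexp (\<xi> * fst p) * iexp (\<xi> * snd p))"
    by (rule Bochner_Integration.integral_cong) (auto simp: distrib_left exp_add)
  also have "\<dots> = (CLINT x|M. CLINT y|N. iexp (\<xi> * x) * iexp (\<xi> * y))"
    by (subst P.integral_fst'[symmetric]) (auto intro!: P.integrable_const_bound[where B=1] simp: norm_mult)
  also have "\<dots> = char M \<xi> * char N \<xi>" by (simp add: char_def)
  finally show ?thesis .
qed

section \<open>Classical hemigroups\<close>

text \<open>
  The integrand of the exponent of the characteristic function, followed by its derivative in
  \<open>\<xi>\<close>. The second derivative is \<open>- exp (i \<xi> x)\<close>, without a singularity at
  \<open>x = 0\<close>.
\<close>

definition levy_kernel :: "real \<Rightarrow> real \<Rightarrow> complex" where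
  "levy_kernel \<xi> x = (if x = 0 then - of_real (\<xi>\<^sup>2 / 2)
     else (iexp (\<xi> * x) - 1 - \<i> * of_real (\<xi> * x)) / of_real (x\<^sup>2))"

definition levy_kernel_deriv :: "real \<Rightarrow> real \<Rightarrow> complex" where
  "levy_kernel_deriv \<xi> x = (if x = 0 then - of_real \<xi> else \<i> * (iexp (\<xi> * x) - 1) / of_real x)"

lemma norm_levy_kernel_le: "norm (levy_kernel \<xi> x) \<le> \<xi>\<^sup>2 / 2"
proof (cases "x = 0")
  case False
  have "norm (iexp (\<xi> * x) - 1 - \<i> * of_real (\<xi> * x)) \<le> \<bar>\<xi> * x\<bar>\<^sup>2 / 2"
    using iexp_approx1[of "\<xi> * x" 1] by (simp add: numeral_2_eq_2 diff_diff_eq)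
  then have "norm (iexp (\<xi> * x) - 1 - \<i> * of_real (\<xi> * x)) / x\<^sup>2 \<le> (\<bar>\<xi> * x\<bar>\<^sup>2 / 2) / x\<^sup>2"
    by (rule divide_right_mono) simp
  moreover have "norm (levy_kernel \<xi> x) = norm (iexp (\<xi> * x) - 1 - \<i> * of_real (\<xi> * x)) / x\<^sup>2"
    using False by (simp add: levy_kernel_def norm_divide norm_power)
  ultimately have "norm (levy_kernel \<xi> x) \<le> (\<bar>\<xi> * x\<bar>\<^sup>2 / 2) / x\<^sup>2" by (simp only:)
  also have "\<dots> = \<xi>\<^sup>2 / 2" using False by (simp add: power_mult_distrib)
  finally show ?thesis .
qed (simp add: levy_kernel_def norm_divide norm_power)

lemma norm_levy_kernel_deriv_le: "norm (levy_kernel_deriv \<xi> x) \<le> \<bar>\<xi>\<bar>"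
proof (cases "x = 0")
  case False
  have "norm (iexp (\<xi> * x) - 1) \<le> \<bar>\<xi> * x\<bar>" using iexp_approx1[of "\<xi> * x" 0] by simp
  then have "norm (levy_kernel_deriv \<xi> x) \<le> \<bar>\<xi> * x\<bar> / \<bar>x\<bar>"
    using False by (simp add: levy_kernel_deriv_def norm_divide norm_mult divide_right_mono)
  also have "\<dots> = \<bar>\<xi>\<bar>" using False by (simp add: abs_mult)
  finally show ?thesis .
qed (simp add: levy_kernel_deriv_def)

lemma continuous_levy_kernel: "continuous_on UNIV (levy_kernel \<xi>)"
  unfolding continuous_on_eq_continuous_at[OF open_UNIV]
proof
  fix x :: real
  show "isCont (levy_kernel \<xi>) x"
  proof (cases "x = 0")
    case False
    have ev: "\<forall>\<^sub>F u in nhds x. levy_kernel \<xi> u = (iexp (\<xi> * u) - 1 - \<i> * of_real (\<xi> * u)) / of_real (u\<^sup>2)"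
      using t1_space_nhds[OF False] by eventually_elim (simp add: levy_kernel_def)
    show ?thesis unfolding isCont_cong[OF ev] using False by (intro continuous_intros) auto
  next
    case True
    have "((\<lambda>u. levy_kernel \<xi> u - levy_kernel \<xi> 0) \<longlongrightarrow> 0) (at 0)"
    proof (rule Lim_null_comparison)
      have "((\<lambda>u. \<bar>\<xi>\<bar> ^ 3 / 6 * \<bar>u\<bar>) \<longlongrightarrow> \<bar>\<xi>\<bar> ^ 3 / 6 * \<bar>0::real\<bar>) (at 0)" by (intro tendsto_intros)
      then show "((\<lambda>u. \<bar>\<xi>\<bar> ^ 3 / 6 * \<bar>u\<bar>) \<longlongrightarrow> 0) (at (0::real))" by simp
      show "\<forall>\<^sub>F u in at 0. norm (levy_kernel \<xi> u - levy_kernel \<xi> 0) \<le> \<bar>\<xi>\<bar> ^ 3 / 6 * \<bar>u\<bar>"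
      proof (rule eventually_at_filter[THEN iffD2], intro always_eventually allI impI)
        fix u :: real assume u: "u \<noteq> 0"
        have s: "(\<Sum>k\<le>2. (\<i> * complex_of_real v) ^ k / fact k) = 1 + \<i> * of_real v - of_real (v\<^sup>2 / 2)" for v
          by (simp add: numeral_2_eq_2 power_mult_distrib)
        have b: "norm (iexp (\<xi> * u) - (1 + \<i> * of_real (\<xi> * u) - of_real ((\<xi> * u)\<^sup>2 / 2))) \<le> \<bar>\<xi> * u\<bar> ^ 3 / 6"
          using iexp_approx1[of "\<xi> * u" 2] unfolding s by (simp add: fact_numeral eval_nat_numeral)
        have "levy_kernel \<xi> u - levy_kernel \<xi> 0 = (iexp (\<xi> * u) - (1 + \<i> * of_real (\<xi> * u) - of_real ((\<xi> * u)\<^sup>2 / 2))) / of_real (u\<^sup>2)"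
          using u by (simp add: levy_kernel_def power_mult_distrib field_simps)
        then have "norm (levy_kernel \<xi> u - levy_kernel \<xi> 0) = norm (iexp (\<xi> * u) - (1 + \<i> * of_real (\<xi> * u) - of_real ((\<xi> * u)\<^sup>2 / 2))) / u\<^sup>2"
          by (simp only: norm_divide norm_of_real abs_power2)
        also have "\<dots> \<le> (\<bar>\<xi> * u\<bar> ^ 3 / 6) / u\<^sup>2" by (rule divide_right_mono[OF b]) simp
        also have "\<dots> = \<bar>\<xi>\<bar> ^ 3 / 6 * (\<bar>u\<bar> ^ 3 / \<bar>u\<bar>\<^sup>2)" by (simp add: abs_mult power_mult_distrib)
        also have "\<bar>u\<bar> ^ 3 / \<bar>u\<bar>\<^sup>2 = \<bar>u\<bar>" using u by (simp add: power3_eq_cube power2_eq_square del: power2_abs)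
        finally show "norm (levy_kernel \<xi> u - levy_kernel \<xi> 0) \<le> \<bar>\<xi>\<bar> ^ 3 / 6 * \<bar>u\<bar>" .
      qed
    qed
    then show ?thesis unfolding True isCont_def by (rule LIM_zero_cancel)
  qed
qed

lemma levy_kernel_has_vector_derivative:
  "((\<lambda>\<eta>. levy_kernel \<eta> x) has_vector_derivative levy_kernel_deriv \<xi> x) (at \<xi>)"
proof (cases "x = 0")
  case True
  have "((\<lambda>\<eta>. - (\<eta>\<^sup>2 / 2)) has_real_derivative - \<xi>) (at \<xi>)"
    by (auto intro!: derivative_eq_intros)
  from has_vector_derivative_of_real[OF this, where 'a=complex] show ?thesis
    using True by (simp add: levy_kernel_def levy_kernel_deriv_def)
next
  case False
  have lin: "((\<lambda>\<eta>. \<i> * of_real (\<eta> * x)) has_vector_derivative \<i> * of_real x) (at \<xi>)"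
    by (intro has_vector_derivative_mult_right has_vector_derivative_of_real)
       (auto intro!: derivative_eq_intros simp: has_real_derivative_iff_has_vector_derivative[symmetric])
  have "((\<lambda>\<eta>. (iexp (\<eta> * x) - 1 - \<i> * of_real (\<eta> * x)) / of_real (x\<^sup>2)) has_vector_derivative
     ((\<i> * of_real x * iexp (\<xi> * x) - 0 - \<i> * of_real x) / of_real (x\<^sup>2))) (at \<xi>)"
    by (intro has_vector_derivative_divide has_vector_derivative_diff has_vector_derivative_const iexp_has_vector_derivative lin)
  moreover have "(\<i> * of_real x * iexp (\<xi> * x) - 0 - \<i> * of_real x) / of_real (x\<^sup>2) = levy_kernel_deriv \<xi> x"
    using False by (simp add: levy_kernel_deriv_def power2_eq_square field_simps)
  ultimately show ?thesis using False by (simp add: levy_kernel_def)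
qed

lemma levy_kernel_deriv_has_vector_derivative:
  "((\<lambda>\<eta>. levy_kernel_deriv \<eta> x) has_vector_derivative - iexp (\<xi> * x)) (at \<xi>)"
proof (cases "x = 0")
  case True
  have "((\<lambda>\<eta>::real. - \<eta>) has_real_derivative - 1) (at \<xi>)"
    by (auto intro!: derivative_eq_intros)
  from has_vector_derivative_of_real[OF this, where 'a=complex] show ?thesis
    using True by (simp add: levy_kernel_deriv_def)
next
  case False
  have "((\<lambda>\<eta>. \<i> * (iexp (\<eta> * x) - 1) / of_real x) has_vector_derivative
     (\<i> * (\<i> * of_real x * iexp (\<xi> * x) - 0) / of_real x)) (at \<xi>)"
    by (intro has_vector_derivative_divide has_vector_derivative_mult_right has_vector_derivative_diff has_vector_derivative_const iexp_has_vector_derivative)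
  moreover have "\<i> * (\<i> * of_real x * iexp (\<xi> * x) - 0) / of_real x = - iexp (\<xi> * x)"
    using False by (simp add: mult.assoc)
  ultimately show ?thesis using False by (simp add: levy_kernel_deriv_def)
qed

lemma borel_measurable_levy_kernel [measurable]:
  "levy_kernel \<xi> \<in> borel_measurable borel" "levy_kernel_deriv \<xi> \<in> borel_measurable borel"
  unfolding levy_kernel_def levy_kernel_deriv_def by measurable

context finite_borel_measure
begin

lemma levy_exponent_derivatives:
  shows "((\<lambda>\<eta>. \<integral>x. levy_kernel \<eta> x \<partial>M) has_vector_derivative (\<integral>x. levy_kernel_deriv \<xi> x \<partial>M)) (at \<xi>)"
    and "((\<lambda>\<eta>. \<integral>x. levy_kernel_deriv \<eta> x \<partial>M) has_vector_derivative - (CLINT x|M. iexp (\<xi> * x))) (at \<xi>)"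
proof -
  note [measurable_cong] = M_is_borel
  have i0: "integrable M (levy_kernel \<eta>)" for \<eta>
    by (rule integrable_const_bound[OF AE_I2[OF norm_levy_kernel_le]]) measurable
  have i1: "integrable M (levy_kernel_deriv \<eta>)" for \<eta>
    by (rule integrable_const_bound[OF AE_I2[OF norm_levy_kernel_deriv_le]]) measurable
  have i2: "integrable M (\<lambda>x. - iexp (\<eta> * x))" for \<eta>
    by (rule integrable_const_bound[where B=1]) auto
  show "((\<lambda>\<eta>. \<integral>x. levy_kernel \<eta> x \<partial>M) has_vector_derivative (\<integral>x. levy_kernel_deriv \<xi> x \<partial>M)) (at \<xi>)"
  proof (rule has_vector_derivative_lebesgue_integral[where w="\<lambda>_. \<bar>\<xi>\<bar> + 1", OF levy_kernel_has_vector_derivative _ i0 i1])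
    fix \<eta> x :: real assume "\<bar>\<eta> - \<xi>\<bar> \<le> 1"
    then have "\<bar>\<eta>\<bar> \<le> \<bar>\<xi>\<bar> + 1" by linarith
    then show "norm (levy_kernel_deriv \<eta> x) \<le> \<bar>\<xi>\<bar> + 1" by (rule order_trans[OF norm_levy_kernel_deriv_le])
  qed simp
  have "((\<lambda>\<eta>. \<integral>x. levy_kernel_deriv \<eta> x \<partial>M) has_vector_derivative (\<integral>x. - iexp (\<xi> * x) \<partial>M)) (at \<xi>)"
    by (rule has_vector_derivative_lebesgue_integral[where w="\<lambda>_. 1", OF levy_kernel_deriv_has_vector_derivative _ i1 i2]) auto
  then show "((\<lambda>\<eta>. \<integral>x. levy_kernel_deriv \<eta> x \<partial>M) has_vector_derivative - (CLINT x|M. iexp (\<xi> * x))) (at \<xi>)" by simp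
qed

end

locale classical_hemigroup = generator +
  fixes c :: "real \<times> real \<Rightarrow> real measure"
  assumes classical: "classical_hemigroup_of I m \<kappa> c" and second_moment: "finite_second_moment I c"
begin

lemma c_distribution: "s \<in> I \<Longrightarrow> t \<in> I \<Longrightarrow> s \<le> t \<Longrightarrow> real_distribution (c (s, t))"
  and c_sq: "s \<in> I \<Longrightarrow> t \<in> I \<Longrightarrow> s \<le> t \<Longrightarrow> integrable (c (s, t)) (\<lambda>x. x\<^sup>2)"
  and c_convolution: "s \<in> I \<Longrightarrow> t \<in> I \<Longrightarrow> u \<in> I \<Longrightarrow> s \<le> t \<Longrightarrow> t \<le> u \<Longrightarrow> c (s, t) \<star> c (t, u) = c (s, u)"
  and c_continuous: "bdd_cont \<phi> \<Longrightarrow> continuous_on (I2le I) (\<lambda>\<tau>. LINT x|c \<tau>. \<phi> x)"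
  using classical second_moment
  by (simp_all add: classical_hemigroup_of_def conv_hemigroup_def finite_second_moment_def I2le_def)

text \<open>
  The logarithm of the characteristic function of \<open>c (s, t)\<close>, and its derivative.
\<close>

definition exponent :: "real \<Rightarrow> real \<Rightarrow> real \<Rightarrow> complex" where
  "exponent s t \<xi> = \<i> * of_real (m t - m s) * of_real \<xi>
     + ((\<integral>x. levy_kernel \<xi> x \<partial>(\<kappa> t)) - (\<integral>x. levy_kernel \<xi> x \<partial>(\<kappa> s)))"

definition exponent_deriv :: "real \<Rightarrow> real \<Rightarrow> real \<Rightarrow> complex" where
  "exponent_deriv s t \<xi> = \<i> * of_real (m t - m s)
     + ((\<integral>x. levy_kernel_deriv \<xi> x \<partial>(\<kappa> t)) - (\<integral>x. levy_kernel_deriv \<xi> x \<partial>(\<kappa> s)))"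

lemma exponent_deriv_0: "exponent_deriv s t 0 = \<i> * of_real (m t - m s)"
proof -
  have "levy_kernel_deriv 0 x = 0" for x by (simp add: levy_kernel_deriv_def)
  then show ?thesis by (simp add: exponent_deriv_def)
qed

lemma exponent_derivatives:
  assumes "s \<in> I" "t \<in> I"
  shows "(exponent s t has_vector_derivative exponent_deriv s t \<xi>) (at \<xi>)"
    and "(exponent_deriv s t has_vector_derivative
      - ((CLINT x|\<kappa> t. iexp (\<xi> * x)) - (CLINT x|\<kappa> s. iexp (\<xi> * x)))) (at \<xi>)"
proof -
  note dt = finite_borel_measure.levy_exponent_derivatives[OF finite_\<kappa>[OF assms(2)]]
    and ds = finite_borel_measure.levy_exponent_derivatives[OF finite_\<kappa>[OF assms(1)]]
  have "((\<lambda>\<eta>. complex_of_real \<eta>) has_vector_derivative of_real 1) (at \<xi>)"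
    by (intro has_vector_derivative_of_real DERIV_ident)
  from has_vector_derivative_mult_right[OF this, of "\<i> * of_real (m t - m s)"]
  have lin: "((\<lambda>\<eta>. \<i> * of_real (m t - m s) * of_real \<eta>) has_vector_derivative \<i> * of_real (m t - m s)) (at \<xi>)"
    by simp
  show "(exponent s t has_vector_derivative exponent_deriv s t \<xi>) (at \<xi>)"
    unfolding exponent_def[abs_def] exponent_deriv_def
    by (intro has_vector_derivative_add has_vector_derivative_diff lin dt(1) ds(1))
  have "((\<lambda>\<eta>. \<i> * of_real (m t - m s) + ((\<integral>x. levy_kernel_deriv \<eta> x \<partial>(\<kappa> t)) - (\<integral>x. levy_kernel_deriv \<eta> x \<partial>(\<kappa> s))))
    has_vector_derivative 0 + (- (CLINT x|\<kappa> t. iexp (\<xi> * x)) - - (CLINT x|\<kappa> s. iexp (\<xi> * x)))) (at \<xi>)"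
    by (intro has_vector_derivative_add has_vector_derivative_diff has_vector_derivative_const dt(2) ds(2))
  then show "(exponent_deriv s t has_vector_derivative
      - ((CLINT x|\<kappa> t. iexp (\<xi> * x)) - (CLINT x|\<kappa> s. iexp (\<xi> * x)))) (at \<xi>)"
    unfolding exponent_deriv_def[abs_def] by simp
qed

text \<open>
  The characteristic function of \<open>c (0, s)\<close> has no zeros and can be divided out.
\<close>

lemma char_c:
  assumes st: "s \<in> I" "t \<in> I" "s \<le> t"
  shows "char (c (s, t)) \<xi> = exp (exponent s t \<xi>)"
proof -
  have char0: "char (c (0, u)) \<xi> = exp (\<i> * of_real (m u) * of_real \<xi> + (\<integral>x. levy_kernel \<xi> x \<partial>(\<kappa> u)))" if "u \<in> I" for u
  proof -
    have "char (c (0, u)) \<xi> = exp (\<i> * of_real (m u * \<xi>) +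
          (CLINT x|\<kappa> u. if x = 0 then - of_real (\<xi>\<^sup>2 / 2)
                       else (iexp (\<xi> * x) - 1 - \<i> * of_real (\<xi> * x)) / of_real (x\<^sup>2)))"
      using classical that unfolding classical_hemigroup_of_def by blast
    then show ?thesis unfolding levy_kernel_def by (simp add: mult.assoc)
  qed
  note s0 = I_nonneg[OF st(1)] and t0 = I_nonneg[OF st(2)]
  have "char (c (0, t)) \<xi> = char (c (0, s)) \<xi> * char (c (s, t)) \<xi>"
    unfolding c_convolution[OF zero_in_I st(1,2) s0 st(3), symmetric]
    by (rule char_convolution[OF c_distribution[OF zero_in_I st(1) s0] c_distribution[OF st]])
  then have "exp (exponent s t \<xi>) * char (c (0, s)) \<xi> = char (c (s, t)) \<xi> * char (c (0, s)) \<xi>"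
    unfolding char0[OF st(1)] char0[OF st(2)] exponent_def
    by (simp add: exp_add[symmetric] algebra_simps)
  then show ?thesis unfolding char0[OF st(1)] by simp
qed

lemma tilted_moments_c:
  assumes st: "s \<in> I" "t \<in> I" "s \<le> t"
  shows "(\<integral>x. of_real x * iexp (\<xi> * x) \<partial>c (s, t)) = - \<i> * exponent_deriv s t \<xi> * char (c (s, t)) \<xi>"
    and "(\<integral>x. of_real (x\<^sup>2) * iexp (\<xi> * x) \<partial>c (s, t))
      = - (- ((CLINT x|\<kappa> t. iexp (\<xi> * x)) - (CLINT x|\<kappa> s. iexp (\<xi> * x))) + (exponent_deriv s t \<xi>)\<^sup>2) * char (c (s, t)) \<xi>"
  by (rule real_distribution.char_exponent_derivatives[OF c_distribution[OF st] c_sq[OF st] char_c[OF st]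
        exponent_derivatives[OF st(1,2)]])+

lemma integral_iexp_0: "t \<in> I \<Longrightarrow> (CLINT x|\<kappa> t. iexp (0 * x)) = of_real (k t)"
  using finite_borel_measure.borel_UNIV[OF finite_\<kappa>] by (simp add: k_def scaleR_conv_of_real)

lemma mean_c:
  assumes st: "s \<in> I" "t \<in> I" "s \<le> t"
  shows "(\<integral>x. x \<partial>c (s, t)) = m t - m s"
proof -
  interpret real_distribution "c (s, t)" by (rule c_distribution[OF st])
  have "complex_of_real (\<integral>x. x \<partial>c (s, t)) = (\<integral>x. of_real x * iexp (0 * x) \<partial>c (s, t))"
    by (simp add: integral_complex_of_real)
  also have "\<dots> = of_real (m t - m s)" unfolding tilted_moments_c(1)[OF st] exponent_deriv_0 char_zero by simp
  finally show ?thesis by (simp only: of_real_eq_iff)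
qed

lemma Var_c:
  assumes st: "s \<in> I" "t \<in> I" "s \<le> t"
  shows "Var (c (s, t)) = k t - k s"
proof -
  interpret real_distribution "c (s, t)" by (rule c_distribution[OF st])
  have "complex_of_real (\<integral>x. x\<^sup>2 \<partial>c (s, t)) = (\<integral>x. of_real (x\<^sup>2) * iexp (0 * x) \<partial>c (s, t))"
    unfolding integral_complex_of_real[symmetric] by simp
  also have "\<dots> = of_real ((k t - k s) + (m t - m s)\<^sup>2)"
    unfolding tilted_moments_c(2)[OF st] exponent_deriv_0 char_zero integral_iexp_0[OF st(1)] integral_iexp_0[OF st(2)]
    by (simp add: power_mult_distrib)
  finally have "(\<integral>x. x\<^sup>2 \<partial>c (s, t)) = (k t - k s) + (m t - m s)\<^sup>2" by (simp only: of_real_eq_iff)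
  then show ?thesis by (simp add: Var_eq[OF c_sq[OF st]] mean_c[OF st])
qed

text \<open>
  The Fourier transform of \<open>\<kappa> t\<close> is minus the second derivative of the logarithm of the
  characteristic function of \<open>c (0, t)\<close>.
\<close>

lemma fourier_\<kappa>_eq:
  assumes t: "t \<in> I"
  shows "(CLINT x|\<kappa> t. iexp (\<xi> * x)) = (\<integral>x. of_real (x\<^sup>2) * iexp (\<xi> * x) \<partial>c (0, t)) / char (c (0, t)) \<xi>
     - ((\<integral>x. of_real x * iexp (\<xi> * x) \<partial>c (0, t)) / char (c (0, t)) \<xi>)\<^sup>2"
proof -
  note t0 = zero_in_I t I_nonneg[OF t]
  have nz: "char (c (0, t)) \<xi> \<noteq> 0" unfolding char_c[OF t0] by simp
  have "(CLINT x|\<kappa> 0. iexp (\<xi> * x)) = 0" by (simp add: \<kappa>_0 integral_null_measure)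
  then show ?thesis
    unfolding tilted_moments_c[OF t0] using nz by (simp add: power_mult_distrib)
qed

end

context evolution_family_sequence
begin

text \<open>
  The Fourier transforms of \<open>\<kappa> t\<close> are continuous functions of the characteristic function and the tilted
  first and second moments of \<open>c (0, t)\<close>, and these converge. In the other direction the exponents
  converge because the kernels are bounded and continuous.
\<close>

lemma classical_condition_iff:
  assumes c: "classical_hemigroup_of I m \<kappa> c" "finite_second_moment I c"
    and cn: "\<And>n. classical_hemigroup_of I (mn n) (\<kappa>n n) (cn n)" "\<And>n. finite_second_moment I (cn n)"
  shows "weak_conv_loc_unif (I2le I) cn c \<and> loc_unif_conv (I2le I) (\<lambda>n \<tau>. Var (cn n \<tau>)) (\<lambda>\<tau>. Var (c \<tau>))
    \<longleftrightarrow> loc_unif_conv I mn m \<and> weak_conv_loc_unif I \<kappa>n \<kappa>"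
proof -
  interpret C: classical_hemigroup I m \<kappa> c
    by (intro classical_hemigroup.intro classical_hemigroup_axioms.intro c generator_axioms)
  interpret Cn: classical_hemigroup I "mn n" "\<kappa>n n" "cn n" for n
    by (intro classical_hemigroup.intro classical_hemigroup_axioms.intro cn seq.generator_axioms)
  have "loc_unif_conv (I2le I) (\<lambda>n \<tau>. Var (cn n \<tau>)) (\<lambda>\<tau>. Var (c \<tau>)) \<longleftrightarrow>
    loc_unif_conv (I2le I) (\<lambda>n \<tau>. seq.k n (snd \<tau>) - seq.k n (fst \<tau>)) (\<lambda>\<tau>. k (snd \<tau>) - k (fst \<tau>))"
  proof (rule loc_unif_conv_cong)
    fix n \<tau> assume "\<tau> \<in> I2le I"
    then obtain s t where \<tau>: "\<tau> = (s, t)" "s \<in> I" "t \<in> I" "s \<le> t" by (auto simp: I2le_def)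
    show "Var (cn n \<tau>) = seq.k n (snd \<tau>) - seq.k n (fst \<tau>)" unfolding \<tau>(1) using Cn.Var_c[OF \<tau>(2-4)] by simp
    show "Var (c \<tau>) = k (snd \<tau>) - k (fst \<tau>)" unfolding \<tau>(1) using C.Var_c[OF \<tau>(2-4)] by simp
  qed
  then have var: "loc_unif_conv (I2le I) (\<lambda>n \<tau>. Var (cn n \<tau>)) (\<lambda>\<tau>. Var (c \<tau>)) \<longleftrightarrow> loc_unif_conv I seq.k k"
    by (simp only: k_increment_converge_iff)
  show ?thesis unfolding var
  proof
    assume A: "weak_conv_loc_unif (I2le I) cn c \<and> loc_unif_conv I seq.k k"
    have fourier: "(\<lambda>n. CLINT x|\<kappa>n n (t n). iexp (\<xi> * x)) \<longlonglongrightarrow> (CLINT x|\<kappa> l. iexp (\<xi> * x))"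
      and mean: "(\<lambda>n. mn n (t n)) \<longlonglongrightarrow> m l"
      if t: "\<And>n. t n \<in> I" and l: "l \<in> I" and lim: "t \<longlonglongrightarrow> l" for t l \<xi>
    proof -
      note t0 = zero_in_I t I_nonneg[OF t] and l0 = zero_in_I l I_nonneg[OF l]
      note distn = Cn.c_distribution[OF t0] and dist = C.c_distribution[OF l0]
        and sqn = Cn.c_sq[OF t0] and sq = C.c_sq[OF l0]
      have weak: "(\<lambda>n. integral\<^sup>L (cn n (0, t n)) \<phi>) \<longlonglongrightarrow> integral\<^sup>L (c (0, l)) \<phi>" if \<phi>: "bdd_cont \<phi>" for \<phi>
      proof -
        have "loc_unif_conv (I2le I) (\<lambda>n \<tau>. LINT x|cn n \<tau>. \<phi> x) (\<lambda>\<tau>. LINT x|c \<tau>. \<phi> x)"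
          using A \<phi> by (simp add: weak_conv_loc_unif_def)
        from this[unfolded loc_unif_conv_iff_sequential[OF C.c_continuous[OF \<phi>]], rule_format, OF _ _ tendsto_Pair[OF tendsto_const lim]]
        show ?thesis using t0 l0 by (simp add: I2le_def)
      qed
      have varlim: "(\<lambda>n. Var (cn n (0, t n))) \<longlonglongrightarrow> Var (c (0, l))"
      proof -
        have "(\<lambda>n. seq.k n (t n)) \<longlonglongrightarrow> k l"
          by (rule A[THEN conjunct2, unfolded loc_unif_conv_iff_sequential[OF continuous_k], rule_format, OF t l lim])
        then show ?thesis unfolding Cn.Var_c[OF t0] C.Var_c[OF l0] by (simp add: k_0 seq.k_0)
      qed
      have "(\<lambda>n. \<integral>x. x \<partial>cn n (0, t n)) \<longlonglongrightarrow> (\<integral>x. x \<partial>c (0, l))"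
        by (rule moments_converge_if_weak_Var(1)[OF distn dist sqn sq weak varlim])
      then show "(\<lambda>n. mn n (t n)) \<longlonglongrightarrow> m l" unfolding Cn.mean_c[OF t0] C.mean_c[OF l0] by (simp add: m_0 seq.m_0)
      note quad = quadratic_test_functions_converge[OF distn dist sqn sq weak varlim]
      have bound: "\<bar>x\<bar> \<le> 1 + x\<^sup>2" for x :: real
        using zero_le_power2[of "\<bar>x\<bar> - 1/2"] by (simp add: power2_eq_square algebra_simps abs_mult_self_eq)
      have 0: "(\<lambda>n. char (cn n (0, t n)) \<xi>) \<longlonglongrightarrow> char (c (0, l)) \<xi>"
        unfolding char_def by (rule quad[where B=1]) (auto intro!: continuous_intros)
      have 1: "(\<lambda>n. \<integral>x. of_real x * iexp (\<xi> * x) \<partial>cn n (0, t n)) \<longlonglongrightarrow> (\<integral>x. of_real x * iexp (\<xi> * x) \<partial>c (0, l))"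
        by (rule quad[where B=1]) (use bound in \<open>auto intro!: continuous_intros simp: norm_mult\<close>)
      have 2: "(\<lambda>n. \<integral>x. of_real (x\<^sup>2) * iexp (\<xi> * x) \<partial>cn n (0, t n)) \<longlonglongrightarrow> (\<integral>x. of_real (x\<^sup>2) * iexp (\<xi> * x) \<partial>c (0, l))"
        by (rule quad[where B=1]) (auto intro!: continuous_intros simp: norm_mult norm_power)
      have nz: "char (c (0, l)) \<xi> \<noteq> 0" unfolding C.char_c[OF l0] by simp
      show "(\<lambda>n. CLINT x|\<kappa>n n (t n). iexp (\<xi> * x)) \<longlonglongrightarrow> (CLINT x|\<kappa> l. iexp (\<xi> * x))"
        unfolding Cn.fourier_\<kappa>_eq[OF t] C.fourier_\<kappa>_eq[OF l]
        by (intro tendsto_diff tendsto_divide tendsto_power 0 1 2 nz)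
    qed
    have "weak_conv_loc_unif I \<kappa>n \<kappa>"
      unfolding weak_conv_loc_unif_def
    proof (intro allI impI)
      fix \<phi> :: "real \<Rightarrow> real" assume \<phi>: "bdd_cont \<phi>"
      show "loc_unif_conv I (\<lambda>n t. integral\<^sup>L (\<kappa>n n t) \<phi>) (\<lambda>t. integral\<^sup>L (\<kappa> t) \<phi>)"
        unfolding loc_unif_conv_iff_sequential[OF continuous_integral_\<kappa>[OF \<phi>]]
      proof (intro allI impI)
        fix x l assume "\<forall>n. x n \<in> I" and l: "l \<in> I" and lim: "x \<longlonglongrightarrow> l"
        then have x: "x n \<in> I" for n by simp
        show "(\<lambda>n. integral\<^sup>L (\<kappa>n n (x n)) \<phi>) \<longlonglongrightarrow> integral\<^sup>L (\<kappa> l) \<phi>"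
          by (rule weak_if_fourier_transforms_converge[OF seq.finite_\<kappa>[OF x] finite_\<kappa>[OF l] fourier[OF x l lim] \<phi>])
      qed
    qed
    moreover have "loc_unif_conv I mn m"
      unfolding loc_unif_conv_iff_sequential[OF continuous_m] using mean by simp
    ultimately show "loc_unif_conv I mn m \<and> weak_conv_loc_unif I \<kappa>n \<kappa>" by blast
  next
    assume A: "loc_unif_conv I mn m \<and> weak_conv_loc_unif I \<kappa>n \<kappa>"
    then have mk: "mean_mass_converge" using generator_condition_iff by blast
    have kernel: "(\<lambda>n. \<integral>x. levy_kernel \<xi> x \<partial>\<kappa>n n (t n)) \<longlonglongrightarrow> (\<integral>x. levy_kernel \<xi> x \<partial>\<kappa> l)"
      if t: "\<And>n. t n \<in> I" and l: "l \<in> I" and lim: "t \<longlonglongrightarrow> l" for t l \<xi>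
    proof (rule complex_integral_converges_if_weak[OF seq.finite_\<kappa>[OF t] finite_\<kappa>[OF l] _ continuous_levy_kernel norm_levy_kernel_le])
      fix \<phi> :: "real \<Rightarrow> real" assume \<phi>: "bdd_cont \<phi>"
      have "loc_unif_conv I (\<lambda>n t. integral\<^sup>L (\<kappa>n n t) \<phi>) (\<lambda>t. integral\<^sup>L (\<kappa> t) \<phi>)"
        using A \<phi> by (simp add: weak_conv_loc_unif_def)
      from this[unfolded loc_unif_conv_iff_sequential[OF continuous_integral_\<kappa>[OF \<phi>]], rule_format, OF t l lim]
      show "(\<lambda>n. integral\<^sup>L (\<kappa>n n (t n)) \<phi>) \<longlonglongrightarrow> integral\<^sup>L (\<kappa> l) \<phi>" .
    qed
    have "weak_conv_loc_unif (I2le I) cn c"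
      unfolding weak_conv_loc_unif_def
    proof (intro allI impI)
      fix \<phi> :: "real \<Rightarrow> real" assume \<phi>: "bdd_cont \<phi>"
      obtain B where B: "\<And>x. norm (\<phi> x) \<le> B" using \<phi> unfolding bdd_cont_def bounded_iff by auto
      show "loc_unif_conv (I2le I) (\<lambda>n \<tau>. LINT x|cn n \<tau>. \<phi> x) (\<lambda>\<tau>. LINT x|c \<tau>. \<phi> x)"
        unfolding loc_unif_conv_iff_sequential[OF C.c_continuous[OF \<phi>]]
      proof (intro allI impI)
        fix \<tau> l assume \<tau>: "\<forall>n. \<tau> n \<in> I2le I" and l: "l \<in> I2le I" and lim: "\<tau> \<longlonglongrightarrow> l"
        define s where "s n = fst (\<tau> n)" for n
        define t where "t n = snd (\<tau> n)" for n
        have \<tau>_eq: "\<tau> n = (s n, t n)" for n by (simp add: s_def t_def)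
        obtain a b where l_eq: "l = (a, b)" by (cases l)
        have st: "s n \<in> I" "t n \<in> I" "s n \<le> t n" for n
          using \<tau>[rule_format, of n] by (auto simp: I2le_def \<tau>_eq)
        have ab: "a \<in> I" "b \<in> I" "a \<le> b" using l by (auto simp: I2le_def l_eq)
        have sl: "s \<longlonglongrightarrow> a" and tl: "t \<longlonglongrightarrow> b"
          using tendsto_fst[OF lim] tendsto_snd[OF lim] by (simp_all add: s_def[abs_def] t_def[abs_def] l_eq)
        have "weak_conv_m (\<lambda>n. cn n (s n, t n)) (c (a, b))"
        proof (rule levy_continuity[OF Cn.c_distribution[OF st] C.c_distribution[OF ab]])
          fix \<xi>
          show "(\<lambda>n. char (cn n (s n, t n)) \<xi>) \<longlonglongrightarrow> char (c (a, b)) \<xi>"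
            unfolding Cn.char_c[OF st] C.char_c[OF ab] Cn.exponent_def C.exponent_def
            by (intro tendsto_exp tendsto_add tendsto_mult tendsto_diff tendsto_const tendsto_of_real
                mean_mass_convergeD(1)[OF mk st(1) ab(1) sl] mean_mass_convergeD(1)[OF mk st(2) ab(2) tl]
                kernel[OF st(1) ab(1) sl] kernel[OF st(2) ab(2) tl])
        qed
        then have "(\<lambda>n. integral\<^sup>L (cn n (s n, t n)) \<phi>) \<longlonglongrightarrow> integral\<^sup>L (c (a, b)) \<phi>"
        proof (rule weak_conv_imp_integral_bdd_continuous_conv[OF Cn.c_distribution[OF st] C.c_distribution[OF ab], where B=B])
          show "isCont \<phi> x" for x using \<phi> by (simp add: bdd_cont_def continuous_on_eq_continuous_at)
        qed (rule B)
        then show "(\<lambda>n. LINT x|cn n (\<tau> n). \<phi> x) \<longlonglongrightarrow> (LINT x|c l. \<phi> x)" unfolding \<tau>_eq l_eq .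
      qed
    qed
    then show "weak_conv_loc_unif (I2le I) cn c \<and> loc_unif_conv I seq.k k"
      using mk by (simp add: mean_mass_converge_def)
  qed
qed

end

theorem corollary5p25:
  fixes I :: "real set"
    and m :: "real \<Rightarrow> real" and \<kappa> :: "real \<Rightarrow> real measure"
    and mn :: "nat \<Rightarrow> real \<Rightarrow> real" and \<kappa>n :: "nat \<Rightarrow> real \<Rightarrow> real measure"
    and c mu :: "real \<times> real \<Rightarrow> real measure"
    and cn mun :: "nat \<Rightarrow> real \<times> real \<Rightarrow> real measure"
    and f :: "real \<times> real \<Rightarrow> complex \<Rightarrow> complex"
    and fn :: "nat \<Rightarrow> real \<times> real \<Rightarrow> complex \<Rightarrow> complex"
  assumes "time_interval I"
    and "reduced_generator I m \<kappa>"
    and "\<And>n. reduced_generator I (mn n) (\<kappa>n n)"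
    and "classical_hemigroup_of I m \<kappa> c" and "finite_second_moment I c"
    and "P2_REF_of I m \<kappa> f"
    and "monotone_hemigroup_of I f mu" and "finite_second_moment I mu"
    and "\<And>n. classical_hemigroup_of I (mn n) (\<kappa>n n) (cn n)"
    and "\<And>n. finite_second_moment I (cn n)"
    and "\<And>n. P2_REF_of I (mn n) (\<kappa>n n) (fn n)"
    and "\<And>n. monotone_hemigroup_of I (fn n) (mun n)"
    and "\<And>n. finite_second_moment I (mun n)"
  shows "all_equivalent
    [ weak_conv_loc_unif (I2le I) cn c \<and>
        loc_unif_conv (I2le I) (\<lambda>n \<tau>. Var (cn n \<tau>)) (\<lambda>\<tau>. Var (c \<tau>)),
      weak_conv_loc_unif (I2le I) mun mu \<and>
        loc_unif_conv (I2le I) (\<lambda>n \<tau>. Var (mun n \<tau>)) (\<lambda>\<tau>. Var (mu \<tau>)),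
      loc_unif_conv (UHP \<times> I) (\<lambda>n (z, t). P2_DLC (fn n) t z) (\<lambda>(z, t). P2_DLC f t z) \<and>
        loc_unif_conv I (\<lambda>n t. nev_r (P2_DLC (fn n) t)) (\<lambda>t. nev_r (P2_DLC f t)),
      loc_unif_conv (UHP \<times> I2le I) (\<lambda>n (z, \<tau>). fn n \<tau> z) (\<lambda>(z, \<tau>). f \<tau> z) \<and>
        loc_unif_conv (I2le I) (\<lambda>n \<tau>. nev_r (fn n \<tau>)) (\<lambda>\<tau>. nev_r (f \<tau>)),
      loc_unif_conv I mn m \<and> weak_conv_loc_unif I \<kappa>n \<kappa> ]"
proof -
  interpret evolution_family I m \<kappa> f
    by (intro evolution_family.intro generator.intro evolution_family_axioms.intro assms(1,2,6))
  interpret evolution_family_sequence I m \<kappa> f mn \<kappa>n fn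
    by (intro evolution_family_sequence.intro evolution_family_sequence_axioms.intro evolution_family_axioms
        evolution_family.intro generator.intro evolution_family_axioms.intro assms(1,3,11))
  note classical_condition_iff[OF assms(4,5,9,10)] generator_condition_iff f_converge_iff_\<kappa>_converge
    monotone_condition_iff[OF assms(7,8,12,13)] DLC_condition_iff REF_condition_iff
  then show ?thesis
    unfolding all_equivalent_def by simp
qed

end
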